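(* Let $X$ be a connected quandle and fix $x_0\in X$. There is a homomorphism (the dual $\mathcal{T}_*$ of $\mathcal{T}$, constructed in the context) $$\mathcal{T}_*:\mathrm{Ker}\Bigl(H_2^{\rm gr}(\mathrm{Inn}(X),\mathrm{Stab}(x_0);\mathbb{Z})\to H_1^{\rm gr}(\mathrm{Stab}(x_0);\mathbb{Z})\Bigr)\longrightarrow H_2^Q(X;\mathbb{Z})$$ such that, whenever $\ell$ is a prime number, $\ell$ and $\mathrm{Type}(X)$ are relatively prime, and $H_1^{\rm gr}(\mathrm{Stab}(x_0);\mathbb{Z})_{(\ell)}$ vanishes, the map localized at $\ell$ is an isomorphism $$\mathcal{T}_*:H_2^{\rm gr}(\mathrm{Inn}(X),\mathrm{Stab}(x_0);\mathbb{Z})_{(\ell)}\stackrel{\sim}{\longrightarrow}H_2^Q(X;\mathbb{Z})_{(\ell)}.$$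
   Context: **Quandles.** A quandle is a set $X$ with a binary operation $*$ such that: $a*a=a$ for all $a$; for each $b$ the map $\bullet*b:X\to X$, $x\mapsto x*b$, is bijective, with inverse denoted $\bullet*^{-1}b$; and $(a*b)*c=(a*c)*(b*c)$ for all $a,b,c$. $\mathrm{Inn}(X)$ is the group generated by the bijections $\bullet*x$ ($x\in X$), acting on $X$ from the right (in a product the left factor acts first). $\mathrm{Stab}(x_0)\subset\mathrm{Inn}(X)$ is the stabilizer of $x_0$. $X$ is connected if this action is transitive. $\mathrm{Type}(X)$ is the minimal $n\in\mathbb{N}$ such that $(\cdots(x*y)\cdots)*y=x$ ($n$ times $*y$) for all $x,y\in X$, or $\infty$ if there is none; the condition that a prime is coprime to $\mathrm{Type}(X)$ presupposes that $\mathrm{Type}(X)$ is finite. **Associated group.** $\mathrm{As}(X)=\langle e_x\ (x\in X)\mid e_xe_y=e_ye_{x*y}\ (x,y\in X)\rangle$. It acts on $X$ from the right by letting $e_y$ send $x$ to $x*y$; $\widetilde{\mathrm{Stab}}(x_0)\subset \mathrm{As}(X)$ is the stabilizer of $x_0$. The homomorphism $\psi:\mathrm{As}(X)\to\mathrm{Inn}(X)$, $e_x\mapsto \bullet*x$, is surjective with central kernel; $\mathrm{Ker}(\psi)\subset\widetilde{\mathrm{Stab}}(x_0)$, and $\psi$ restricts to a central extension $0\to\mathrm{Ker}(\psi)\to\widetilde{\mathrm{Stab}}(x_0)\to\mathrm{Stab}(x_0)\to 0$. **Quandle homology.** $C_n^R(X)=\mathbb{Z}\langle X^n\rangle$, $\partial_2^R(x,y)=(x)-(x*y)$,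 $\partial_3^R(x,y,z)=(x,z)-(x*y,z)-(x,y)+(x*z,y*z)$. $H_2^R(X;\mathbb Z)=\mathrm{Ker}(\partial_2^R)/\mathrm{Im}(\partial_3^R)$, and $H_2^Q(X;\mathbb{Z})$ is the quotient of $\mathrm{Ker}(\partial_2^R)$ by the subgroup generated by $\mathrm{Im}(\partial_3^R)$ and all $(a,a)$, $a\in X$. **Group homology.** $H_*^{\rm gr}$ is group homology with trivial coefficients $\mathbb{Z}$; for $K\subset G$, $H_n^{\rm gr}(G,K;\mathbb{Z})$ is the relative homology (homology of the mapping cone of the inclusion of bar complexes), with long exact sequence $\cdots\to H_2^{\rm gr}(K)\to H_2^{\rm gr}(G)\to H_2^{\rm gr}(G,K)\to H_1^{\rm gr}(K)\to\cdots$. The map $H_2^{\rm gr}(\mathrm{Inn}(X),\mathrm{Stab}(x_0))\to H_1^{\rm gr}(\mathrm{Stab}(x_0))$ in the claim is the connecting map of this sequence. For a central extension $0\to K\to G\to\mathcal{G}\to0$ there is the 5-term exact sequence $H_2^{\rm gr}(G)\to H_2^{\rm gr}(\mathcal{G})\xrightarrow{\delta}K\to H_1^{\rm gr}(G)\to H_1^{\rm gr}(\mathcal{G})\to0$, where $\delta$ sends the class of a bar 2-cycle $\sum_k n_k(g_k,h_k)$ to $\prod_k(\mathfrak{s}(g_k)\mathfrak{s}(h_k)\mathfrak{s}(g_kh_k)^{-1})^{n_k}$ for a set-theoretic section $\mathfrak{s}:\mathcal G\to G$. **The projection $\mathcal{P}$ and Eisermann's isomorphism.** Let $\iota:\widetilde{\mathrm{Stab}}(x_0)\hookrightarrow\mathrm{As}(X)$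 be the inclusion and $\iota_*$ the induced map on $H_1(-;\mathbb{Z})$. Its image is $\mathbb{Z}$, detected by $\epsilon_X:\mathrm{As}(X)\to\mathbb{Z}$, $e_x\mapsto1$, and it is split by $e_{x_0}\in\widetilde{\mathrm{Stab}}(x_0)$; let $\mathcal{P}:H_1(\widetilde{\mathrm{Stab}}(x_0);\mathbb{Z})\to\mathrm{Ker}(\iota_* )$, $\mathcal{P}(h)=h-\epsilon_X(h)[e_{x_0}]$. The assignment $$e_{y_1}^{\epsilon_1}\cdots e_{y_n}^{\epsilon_n}\mapsto\sum_{j=1}^n\epsilon_j\Bigl(\bigl((\cdots(x_0*^{\epsilon_1}y_1)*^{\epsilon_2}\cdots)*^{\epsilon_{j-1}}y_{j-1}\bigr)*^{\frac{\epsilon_j-1}{2}}y_j,\ y_j\Bigr)\qquad(\epsilon_j\in\{\pm1\},\ *^{1}=*,\ a*^0b=a)$$ induces an isomorphism $H_1(\widetilde{\mathrm{Stab}}(x_0);\mathbb{Z})\cong H_2^R(X;\mathbb{Z})$ and, compatibly with $\mathcal{P}$ and the projection $H_2^R\to H_2^Q$, an isomorphism $\mathrm{Ker}(\iota_* )\cong H_2^Q(X;\mathbb{Z})$ (Eisermann). **The map $\mathcal{T}_*$.** Given a class in $\mathrm{Ker}(H_2^{\rm gr}(\mathrm{Inn}(X),\mathrm{Stab}(x_0))\to H_1^{\rm gr}(\mathrm{Stab}(x_0)))$, lift it to $H_2^{\rm gr}(\mathrm{Inn}(X);\mathbb{Z})$, apply $\delta:H_2^{\rm gr}(\mathrm{Inn}(X);\mathbb{Z})\to\mathrm{Ker}(\psi)$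 for the extension $0\to\mathrm{Ker}(\psi)\to\mathrm{As}(X)\to\mathrm{Inn}(X)\to0$, then the natural map $\mathrm{Ker}(\psi)\to H_1(\widetilde{\mathrm{Stab}}(x_0);\mathbb{Z})$, then $\mathcal{P}$, and finally the isomorphism $\mathrm{Ker}(\iota_* )\cong H_2^Q(X;\mathbb{Z})$. The result does not depend on the lift, because the image of $H_2^{\rm gr}(\mathrm{Stab}(x_0);\mathbb{Z})$ goes to zero in $H_1(\widetilde{\mathrm{Stab}}(x_0);\mathbb{Z})$. For an abelian group $M$, $M_{(\ell)}=M\otimes_{\mathbb Z}\mathbb{Z}_{(\ell)}$. When $H_1^{\rm gr}(\mathrm{Stab}(x_0);\mathbb{Z})_{(\ell)}=0$, the localized domain of $\mathcal{T}_*$ is $H_2^{\rm gr}(\mathrm{Inn}(X),\mathrm{Stab}(x_0);\mathbb{Z})_{(\ell)}$. *)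

theory Defs
  imports
    "HOL-Algebra.Free_Abelian_Groups"
    "HOL-Algebra.Bij"
    "HOL-Computational_Algebra.Primes"
    "HOL-Library.Extended_Nat"
begin

section \<open>Quotients of abelian groups, tensor product, localization\<close>

text \<open>The map between quotients \<open>A / M \<rightarrow> H / N\<close> induced by \<open>h\<close>: a coset \<open>c\<close> goes to the common
  value of the cosets \<open>N + h z\<close>, \<open>z \<in> c\<close>. (Meaningful when this value does not depend on \<open>z\<close>,
  as in all uses below.)\<close>

definition induced_map ::
  "('a \<Rightarrow> 'b) \<Rightarrow> ('b, 'n) monoid_scheme \<Rightarrow> 'b set \<Rightarrow> 'a set \<Rightarrow> 'b set" where
  "induced_map h H N c = the_elem ((\<lambda>z. N #>\<^bsub>H\<^esub> h z) ` c)"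

definition tensor_relations ::
  "('a, 'm) monoid_scheme \<Rightarrow> ('b, 'n) monoid_scheme \<Rightarrow> ('a \<times> 'b \<Rightarrow>\<^sub>0 int) set" where
  "tensor_relations A B =
     {frag_of (a \<otimes>\<^bsub>A\<^esub> a', b) - frag_of (a, b) - frag_of (a', b) | a a' b.
        a \<in> carrier A \<and> a' \<in> carrier A \<and> b \<in> carrier B} \<union>
     {frag_of (a, b \<otimes>\<^bsub>B\<^esub> b') - frag_of (a, b) - frag_of (a, b') | a b b'.
        a \<in> carrier A \<and> b \<in> carrier B \<and> b' \<in> carrier B}"

definition tensor_null ::
  "('a, 'm) monoid_scheme \<Rightarrow> ('b, 'n) monoid_scheme \<Rightarrow> ('a \<times> 'b \<Rightarrow>\<^sub>0 int) set" where
  "tensor_null A B =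
     generate (free_Abelian_group (carrier A \<times> carrier B)) (tensor_relations A B)"

text \<open>The tensor product over \<open>\<int>\<close> of two abelian groups (written multiplicatively, as everywhere in
  HOL-Algebra).\<close>

definition tensor_product ::
  "('a, 'm) monoid_scheme \<Rightarrow> ('b, 'n) monoid_scheme \<Rightarrow> ('a \<times> 'b \<Rightarrow>\<^sub>0 int) set monoid" where
  "tensor_product A B = free_Abelian_group (carrier A \<times> carrier B) Mod tensor_null A B"

text \<open>\<open>\<int>\<^sub>(\<^sub>l\<^sub>)\<close>, the rationals with denominator prime to \<open>l\<close>, as an additive group.\<close>

definition Z_loc :: "nat \<Rightarrow> rat monoid" where
  "Z_loc l = \<lparr>carrier = {of_int a / of_int s | a s. \<not> int l dvd s}, monoid.mult = (+), one = 0\<rparr>"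

definition localization ::
  "nat \<Rightarrow> ('a, 'm) monoid_scheme \<Rightarrow> ('a \<times> rat \<Rightarrow>\<^sub>0 int) set monoid" where
  "localization l M = tensor_product M (Z_loc l)"

text \<open>The localization \<open>f \<otimes> id\<close> of a homomorphism \<open>f\<close> with codomain \<open>N\<close>.\<close>

definition localization_map ::
  "nat \<Rightarrow> ('b, 'n) monoid_scheme \<Rightarrow> ('a \<Rightarrow> 'b) \<Rightarrow>
   ('a \<times> rat \<Rightarrow>\<^sub>0 int) set \<Rightarrow> ('b \<times> rat \<Rightarrow>\<^sub>0 int) set" where
  "localization_map l N f =
     induced_map (frag_extend (\<lambda>(m, q). frag_of (f m, q)))
       (free_Abelian_group (carrier N \<times> carrier (Z_loc l))) (tensor_null N (Z_loc l))"


section \<open>Group homology with integral coefficients\<close>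

subsection \<open>The bar complex\<close>

definition bar_chains :: "nat \<Rightarrow> ('g, 'm) monoid_scheme \<Rightarrow> ('g list \<Rightarrow>\<^sub>0 int) monoid" where
  "bar_chains n G = free_Abelian_group {gs. length gs = n \<and> set gs \<subseteq> carrier G}"

definition bar_face :: "('g, 'm) monoid_scheme \<Rightarrow> nat \<Rightarrow> 'g list \<Rightarrow> 'g list" where
  "bar_face G i gs =
     (if i = 0 then tl gs
      else if i = length gs then butlast gs
      else take (i - 1) gs @ (gs ! (i - 1) \<otimes>\<^bsub>G\<^esub> gs ! i) # drop (i + 1) gs)"

text \<open>The boundary in all degrees at once; it vanishes on the degree \<open>0\<close> generator \<open>[]\<close>.\<close>

definition bar_boundary ::
  "('g, 'm) monoid_scheme \<Rightarrow> ('g list \<Rightarrow>\<^sub>0 int) \<Rightarrow> ('g list \<Rightarrow>\<^sub>0 int)" where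
  "bar_boundary G = frag_extend (\<lambda>gs.
     if gs = [] then 0
     else \<Sum>i\<le>length gs. frag_cmul ((-1) ^ i) (frag_of (bar_face G i gs)))"

definition bar_boundaries :: "nat \<Rightarrow> ('g, 'm) monoid_scheme \<Rightarrow> ('g list \<Rightarrow>\<^sub>0 int) set" where
  "bar_boundaries n G = bar_boundary G ` carrier (bar_chains (Suc n) G)"

definition group_homology ::
  "nat \<Rightarrow> ('g, 'm) monoid_scheme \<Rightarrow> ('g list \<Rightarrow>\<^sub>0 int) set monoid" where
  "group_homology n G =
     (bar_chains n G)\<lparr>carrier := {c \<in> carrier (bar_chains n G). bar_boundary G c = 0}\<rparr>
       Mod bar_boundaries n G"

subsection \<open>Relative homology\<close>

text \<open>For a subgroup \<open>K\<close> of \<open>G\<close>, the mapping cone of the inclusion of bar complexes has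
  \<open>C\<^sub>n(G) \<oplus> C\<^sub>n\<^sub>-\<^sub>1(K)\<close> in degree \<open>n\<close> and boundary \<open>(a, b) \<mapsto> (\<partial>a - b, -\<partial>b)\<close>.\<close>

definition cone_chains ::
  "nat \<Rightarrow> ('g, 'm) monoid_scheme \<Rightarrow> 'g set \<Rightarrow> (('g list \<Rightarrow>\<^sub>0 int) \<times> ('g list \<Rightarrow>\<^sub>0 int)) monoid" where
  "cone_chains n G K =
     bar_chains n G \<times>\<times>
       (case n of 0 \<Rightarrow> singleton_group 0 | Suc m \<Rightarrow> bar_chains m (G\<lparr>carrier := K\<rparr>))"

definition cone_boundary ::
  "('g, 'm) monoid_scheme \<Rightarrow> ('g list \<Rightarrow>\<^sub>0 int) \<times> ('g list \<Rightarrow>\<^sub>0 int) \<Rightarrow>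
   ('g list \<Rightarrow>\<^sub>0 int) \<times> ('g list \<Rightarrow>\<^sub>0 int)" where
  "cone_boundary G = (\<lambda>(a, b). (bar_boundary G a - b, - bar_boundary G b))"

definition cone_boundaries ::
  "nat \<Rightarrow> ('g, 'm) monoid_scheme \<Rightarrow> 'g set \<Rightarrow> (('g list \<Rightarrow>\<^sub>0 int) \<times> ('g list \<Rightarrow>\<^sub>0 int)) set" where
  "cone_boundaries n G K = cone_boundary G ` carrier (cone_chains (Suc n) G K)"

definition relative_homology ::
  "nat \<Rightarrow> ('g, 'm) monoid_scheme \<Rightarrow> 'g set \<Rightarrow>
   (('g list \<Rightarrow>\<^sub>0 int) \<times> ('g list \<Rightarrow>\<^sub>0 int)) set monoid" where
  "relative_homology n G K =
     (cone_chains n G K)\<lparr>carrier :=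
         {c \<in> carrier (cone_chains n G K). cone_boundary G c = (0, 0)}\<rparr>
       Mod cone_boundaries n G K"

text \<open>The maps \<open>H\<^sub>n(K) \<rightarrow> H\<^sub>n(G) \<rightarrow> H\<^sub>n(G, K) \<rightarrow> H\<^sub>n\<^sub>-\<^sub>1(K)\<close> of the long exact sequence.\<close>

definition homology_incl ::
  "nat \<Rightarrow> ('g, 'm) monoid_scheme \<Rightarrow> ('g list \<Rightarrow>\<^sub>0 int) set \<Rightarrow> ('g list \<Rightarrow>\<^sub>0 int) set" where
  "homology_incl n G = induced_map (\<lambda>c. c) (bar_chains n G) (bar_boundaries n G)"

definition homology_to_relative ::
  "nat \<Rightarrow> ('g, 'm) monoid_scheme \<Rightarrow> 'g set \<Rightarrow>
   ('g list \<Rightarrow>\<^sub>0 int) set \<Rightarrow> (('g list \<Rightarrow>\<^sub>0 int) \<times> ('g list \<Rightarrow>\<^sub>0 int)) set" where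
  "homology_to_relative n G K =
     induced_map (\<lambda>a. (a, 0)) (cone_chains n G K) (cone_boundaries n G K)"

definition connecting_map ::
  "nat \<Rightarrow> ('g, 'm) monoid_scheme \<Rightarrow> 'g set \<Rightarrow>
   (('g list \<Rightarrow>\<^sub>0 int) \<times> ('g list \<Rightarrow>\<^sub>0 int)) set \<Rightarrow> ('g list \<Rightarrow>\<^sub>0 int) set" where
  "connecting_map n G K =
     induced_map snd (bar_chains (n - 1) (G\<lparr>carrier := K\<rparr>))
       (bar_boundaries (n - 1) (G\<lparr>carrier := K\<rparr>))"

subsection \<open>The map \<open>\<delta>\<close> of a central extension\<close>

text \<open>\<open>p : G \<rightarrow> Q\<close> is a surjective homomorphism with central kernel. The set-theoretic section used
  is \<open>inv_into (carrier G) p\<close>; on homology the map is the same for every section.\<close>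

definition extension_delta_chain ::
  "('g, 'm) monoid_scheme \<Rightarrow> ('q, 'n) monoid_scheme \<Rightarrow> ('g \<Rightarrow> 'q) \<Rightarrow> ('q list \<Rightarrow>\<^sub>0 int) \<Rightarrow> 'g" where
  "extension_delta_chain G Q p c =
     (let s = inv_into (carrier G) p in
      finprod (G\<lparr>carrier := kernel G Q p\<rparr>)
        (\<lambda>gs. (s (gs ! 0) \<otimes>\<^bsub>G\<^esub> s (gs ! 1) \<otimes>\<^bsub>G\<^esub> inv\<^bsub>G\<^esub> s (gs ! 0 \<otimes>\<^bsub>Q\<^esub> gs ! 1))
                [^]\<^bsub>G\<^esub> Poly_Mapping.lookup c gs)
        (Poly_Mapping.keys c))"

definition extension_delta ::
  "('g, 'm) monoid_scheme \<Rightarrow> ('q, 'n) monoid_scheme \<Rightarrow> ('g \<Rightarrow> 'q) \<Rightarrow>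
   ('q list \<Rightarrow>\<^sub>0 int) set \<Rightarrow> 'g" where
  "extension_delta G Q p c = the_elem (extension_delta_chain G Q p ` c)"


section \<open>Group presentations\<close>

text \<open>Words in the generators and their inverses: \<open>(x, True)\<close> stands for \<open>x\<close> and \<open>(x, False)\<close> for
  \<open>x\<^sup>-\<^sup>1\<close>. A relation is a pair of words that are to become equal.\<close>

type_synonym 's word = "('s \<times> bool) list"

inductive word_eq :: "'s set \<Rightarrow> ('s word \<times> 's word) set \<Rightarrow> 's word \<Rightarrow> 's word \<Rightarrow> bool"
  for S R where
  refl: "w \<in> lists (S \<times> UNIV) \<Longrightarrow> word_eq S R w w"
| sym: "word_eq S R u v \<Longrightarrow> word_eq S R v u"
| trans: "word_eq S R u v \<Longrightarrow> word_eq S R v w \<Longrightarrow> word_eq S R u w"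
| append: "word_eq S R u u' \<Longrightarrow> word_eq S R v v' \<Longrightarrow> word_eq S R (u @ v) (u' @ v')"
| cancel: "x \<in> S \<Longrightarrow> word_eq S R [(x, b), (x, \<not> b)] []"
| relation: "(u, v) \<in> R \<Longrightarrow> word_eq S R u v"

definition word_class :: "'s set \<Rightarrow> ('s word \<times> 's word) set \<Rightarrow> 's word \<Rightarrow> 's word set" where
  "word_class S R w = {v. word_eq S R w v}"

definition presented_group :: "'s set \<Rightarrow> ('s word \<times> 's word) set \<Rightarrow> 's word set monoid" where
  "presented_group S R =
     \<lparr>carrier = word_class S R ` lists (S \<times> UNIV),
      monoid.mult = (\<lambda>A B. \<Union>u\<in>A. \<Union>v\<in>B. word_class S R (u @ v)),
      one = word_class S R []\<rparr>"


section \<open>Quandles\<close>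

record 'a quandle = "'a partial_object" +
  qop :: "'a \<Rightarrow> 'a \<Rightarrow> 'a" (infixl "\<triangleright>\<index>" 70)

text \<open>Closure under the operation is contained in \<open>bij\<close>.\<close>

locale quandle = fixes Q (structure)
  assumes idem: "a \<in> carrier Q \<Longrightarrow> a \<triangleright> a = a"
    and bij: "b \<in> carrier Q \<Longrightarrow> bij_betw (\<lambda>x. x \<triangleright> b) (carrier Q) (carrier Q)"
    and distrib: "\<lbrakk>a \<in> carrier Q; b \<in> carrier Q; c \<in> carrier Q\<rbrakk> \<Longrightarrow>
       (a \<triangleright> b) \<triangleright> c = (a \<triangleright> c) \<triangleright> (b \<triangleright> c)"

definition qop_inv :: "('a, 'm) quandle_scheme \<Rightarrow> 'a \<Rightarrow> 'a \<Rightarrow> 'a" where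
  "qop_inv Q x b = inv_into (carrier Q) (\<lambda>y. y \<triangleright>\<^bsub>Q\<^esub> b) x"

definition quandle_type :: "('a, 'm) quandle_scheme \<Rightarrow> enat" where
  "quandle_type Q =
     Inf {enat n | n. 0 < n \<and>
       (\<forall>x\<in>carrier Q. \<forall>y\<in>carrier Q. ((\<lambda>z. z \<triangleright>\<^bsub>Q\<^esub> y) ^^ n) x = x)}"

subsection \<open>The inner automorphism group\<close>

text \<open>Groups act from the right, so the multiplication is opposite to that of \<^const>\<open>BijGroup\<close>.\<close>

definition right_BijGroup :: "'a set \<Rightarrow> ('a \<Rightarrow> 'a) monoid" where
  "right_BijGroup S = (BijGroup S)\<lparr>monoid.mult := (\<lambda>f g. g \<otimes>\<^bsub>BijGroup S\<^esub> f)\<rparr>"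

definition right_translation :: "('a, 'm) quandle_scheme \<Rightarrow> 'a \<Rightarrow> 'a \<Rightarrow> 'a" where
  "right_translation Q b = (\<lambda>x\<in>carrier Q. x \<triangleright>\<^bsub>Q\<^esub> b)"

definition Inn :: "('a, 'm) quandle_scheme \<Rightarrow> ('a \<Rightarrow> 'a) monoid" where
  "Inn Q = subgroup_generated (right_BijGroup (carrier Q)) (right_translation Q ` carrier Q)"

definition Inn_stab :: "('a, 'm) quandle_scheme \<Rightarrow> 'a \<Rightarrow> ('a \<Rightarrow> 'a) set" where
  "Inn_stab Q x0 = {f \<in> carrier (Inn Q). f x0 = x0}"

definition connected_quandle :: "('a, 'm) quandle_scheme \<Rightarrow> bool" where
  "connected_quandle Q \<longleftrightarrow>
     (\<forall>x\<in>carrier Q. \<forall>y\<in>carrier Q. \<exists>f\<in>carrier (Inn Q). f x = y)"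

subsection \<open>The associated group\<close>

definition As_relations :: "('a, 'm) quandle_scheme \<Rightarrow> ('a word \<times> 'a word) set" where
  "As_relations Q =
     {([(x, True), (y, True)], [(y, True), (x \<triangleright>\<^bsub>Q\<^esub> y, True)]) | x y.
        x \<in> carrier Q \<and> y \<in> carrier Q}"

definition As_class :: "('a, 'm) quandle_scheme \<Rightarrow> 'a word \<Rightarrow> 'a word set" where
  "As_class Q = word_class (carrier Q) (As_relations Q)"

definition As :: "('a, 'm) quandle_scheme \<Rightarrow> 'a word set monoid" where
  "As Q = presented_group (carrier Q) (As_relations Q)"

definition As_gen :: "('a, 'm) quandle_scheme \<Rightarrow> 'a \<Rightarrow> 'a word set" where
  "As_gen Q x = As_class Q [(x, True)]"

fun word_act :: "('a, 'm) quandle_scheme \<Rightarrow> 'a \<Rightarrow> 'a word \<Rightarrow> 'a" where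
  "word_act Q x [] = x"
| "word_act Q x ((y, b) # w) = word_act Q (if b then x \<triangleright>\<^bsub>Q\<^esub> y else qop_inv Q x y) w"

text \<open>Functions on \<^const>\<open>As\<close> are given on words; an element goes to the common value of the words
  representing it.\<close>

definition As_act :: "('a, 'm) quandle_scheme \<Rightarrow> 'a \<Rightarrow> 'a word set \<Rightarrow> 'a" where
  "As_act Q x g = the_elem (word_act Q x ` g)"

definition As_stab :: "('a, 'm) quandle_scheme \<Rightarrow> 'a \<Rightarrow> 'a word set set" where
  "As_stab Q x0 = {g \<in> carrier (As Q). As_act Q x0 g = x0}"

definition As_psi :: "('a, 'm) quandle_scheme \<Rightarrow> 'a word set \<Rightarrow> 'a \<Rightarrow> 'a" where
  "As_psi Q g = (\<lambda>x\<in>carrier Q. As_act Q x g)"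

definition As_degree :: "'a word set \<Rightarrow> int" where
  "As_degree g = the_elem ((\<lambda>w. \<Sum>(y, b)\<leftarrow>w. if b then 1 else -1) ` g)"

subsection \<open>Quandle homology\<close>

definition rack_boundary2 ::
  "('a, 'm) quandle_scheme \<Rightarrow> ('a \<times> 'a \<Rightarrow>\<^sub>0 int) \<Rightarrow> ('a \<Rightarrow>\<^sub>0 int)" where
  "rack_boundary2 Q = frag_extend (\<lambda>(x, y). frag_of x - frag_of (x \<triangleright>\<^bsub>Q\<^esub> y))"

definition rack_boundary3 ::
  "('a, 'm) quandle_scheme \<Rightarrow> ('a \<times> 'a \<times> 'a \<Rightarrow>\<^sub>0 int) \<Rightarrow> ('a \<times> 'a \<Rightarrow>\<^sub>0 int)" where
  "rack_boundary3 Q = frag_extend (\<lambda>(x, y, z).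
     frag_of (x, z) - frag_of (x \<triangleright>\<^bsub>Q\<^esub> y, z) - frag_of (x, y)
       + frag_of (x \<triangleright>\<^bsub>Q\<^esub> z, y \<triangleright>\<^bsub>Q\<^esub> z))"

definition rack_chains2 :: "('a, 'm) quandle_scheme \<Rightarrow> ('a \<times> 'a \<Rightarrow>\<^sub>0 int) monoid" where
  "rack_chains2 Q = free_Abelian_group (carrier Q \<times> carrier Q)"

definition quandle_null2 :: "('a, 'm) quandle_scheme \<Rightarrow> ('a \<times> 'a \<Rightarrow>\<^sub>0 int) set" where
  "quandle_null2 Q = generate (rack_chains2 Q)
     (rack_boundary3 Q ` carrier (free_Abelian_group (carrier Q \<times> carrier Q \<times> carrier Q))
        \<union> {frag_of (a, a) | a. a \<in> carrier Q})"

definition quandle_homology2 :: "('a, 'm) quandle_scheme \<Rightarrow> ('a \<times> 'a \<Rightarrow>\<^sub>0 int) set monoid" where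
  "quandle_homology2 Q =
     (rack_chains2 Q)\<lparr>carrier := {c \<in> carrier (rack_chains2 Q). rack_boundary2 Q c = 0}\<rparr>
       Mod quandle_null2 Q"


section \<open>The map \<open>\<T>\<^sub>*\<close>\<close>

text \<open>\<open>H\<^sub>1\<close> of the stabilizer of \<open>x\<^sub>0\<close> in \<open>As(Q)\<close>, and the class in it of one group element.\<close>

abbreviation H1_As_stab :: "('a, 'm) quandle_scheme \<Rightarrow> 'a \<Rightarrow> ('a word set list \<Rightarrow>\<^sub>0 int) set monoid"
  where "H1_As_stab Q x0 \<equiv> group_homology 1 ((As Q)\<lparr>carrier := As_stab Q x0\<rparr>)"

definition H1_As_stab_class ::
  "('a, 'm) quandle_scheme \<Rightarrow> 'a \<Rightarrow> 'a word set \<Rightarrow> ('a word set list \<Rightarrow>\<^sub>0 int) set" where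
  "H1_As_stab_class Q x0 g =
     bar_boundaries 1 ((As Q)\<lparr>carrier := As_stab Q x0\<rparr>)
       #>\<^bsub>bar_chains 1 ((As Q)\<lparr>carrier := As_stab Q x0\<rparr>)\<^esub> frag_of [g]"

definition H1_degree :: "('a word set list \<Rightarrow>\<^sub>0 int) set \<Rightarrow> int" where
  "H1_degree h = the_elem
     ((\<lambda>c. \<Sum>gs\<in>Poly_Mapping.keys c. Poly_Mapping.lookup c gs * As_degree (gs ! 0)) ` h)"

text \<open>The projection \<open>\<P>(h) = h - \<epsilon>(h) [e\<^sub>x\<^sub>0]\<close> onto the kernel of \<open>H\<^sub>1(Stab) \<rightarrow> H\<^sub>1(As(Q))\<close>.\<close>

definition proj_P ::
  "('a, 'm) quandle_scheme \<Rightarrow> 'a \<Rightarrow> ('a word set list \<Rightarrow>\<^sub>0 int) set \<Rightarrow>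
   ('a word set list \<Rightarrow>\<^sub>0 int) set" where
  "proj_P Q x0 h =
     h \<otimes>\<^bsub>H1_As_stab Q x0\<^esub> inv\<^bsub>H1_As_stab Q x0\<^esub>
       (H1_As_stab_class Q x0 (As_gen Q x0) [^]\<^bsub>H1_As_stab Q x0\<^esub> H1_degree h)"

definition ker_iota ::
  "('a, 'm) quandle_scheme \<Rightarrow> 'a \<Rightarrow> ('a word set list \<Rightarrow>\<^sub>0 int) set set" where
  "ker_iota Q x0 = kernel (H1_As_stab Q x0) (group_homology 1 (As Q)) (homology_incl 1 (As Q))"

text \<open>Eisermann's assignment, on words (the first argument is the current point) and on bar
  \<open>1\<close>-chains. Modulo the boundaries of rack \<open>3\<close>-chains the choice of a word for a group element
  does not matter.\<close>

fun eisermann_word :: "('a, 'm) quandle_scheme \<Rightarrow> 'a \<Rightarrow> 'a word \<Rightarrow> ('a \<times> 'a \<Rightarrow>\<^sub>0 int)" where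
  "eisermann_word Q x [] = 0"
| "eisermann_word Q x ((y, b) # w) =
     (if b then frag_of (x, y) + eisermann_word Q (x \<triangleright>\<^bsub>Q\<^esub> y) w
      else - frag_of (qop_inv Q x y, y) + eisermann_word Q (qop_inv Q x y) w)"

definition eisermann_chain ::
  "('a, 'm) quandle_scheme \<Rightarrow> 'a \<Rightarrow> ('a word set list \<Rightarrow>\<^sub>0 int) \<Rightarrow> ('a \<times> 'a \<Rightarrow>\<^sub>0 int)" where
  "eisermann_chain Q x0 = frag_extend (\<lambda>gs. eisermann_word Q x0 (SOME w. w \<in> gs ! 0))"

definition eisermann_map ::
  "('a, 'm) quandle_scheme \<Rightarrow> 'a \<Rightarrow> ('a word set list \<Rightarrow>\<^sub>0 int) set \<Rightarrow> ('a \<times> 'a \<Rightarrow>\<^sub>0 int) set" where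
  "eisermann_map Q x0 = restrict
     (induced_map (eisermann_chain Q x0) (rack_chains2 Q) (quandle_null2 Q)) (ker_iota Q x0)"

abbreviation H2_Inn :: "('a, 'm) quandle_scheme \<Rightarrow> (('a \<Rightarrow> 'a) list \<Rightarrow>\<^sub>0 int) set monoid"
  where "H2_Inn Q \<equiv> group_homology 2 (Inn Q)"

abbreviation H1_Inn_stab ::
  "('a, 'm) quandle_scheme \<Rightarrow> 'a \<Rightarrow> (('a \<Rightarrow> 'a) list \<Rightarrow>\<^sub>0 int) set monoid"
  where "H1_Inn_stab Q x0 \<equiv> group_homology 1 ((Inn Q)\<lparr>carrier := Inn_stab Q x0\<rparr>)"

abbreviation H2_Inn_rel ::
  "('a, 'm) quandle_scheme \<Rightarrow> 'a \<Rightarrow>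
   ((('a \<Rightarrow> 'a) list \<Rightarrow>\<^sub>0 int) \<times> (('a \<Rightarrow> 'a) list \<Rightarrow>\<^sub>0 int)) set monoid"
  where "H2_Inn_rel Q x0 \<equiv> relative_homology 2 (Inn Q) (Inn_stab Q x0)"

definition T_domain ::
  "('a, 'm) quandle_scheme \<Rightarrow> 'a \<Rightarrow>
   ((('a \<Rightarrow> 'a) list \<Rightarrow>\<^sub>0 int) \<times> (('a \<Rightarrow> 'a) list \<Rightarrow>\<^sub>0 int)) set monoid" where
  "T_domain Q x0 = (H2_Inn_rel Q x0)\<lparr>carrier :=
     kernel (H2_Inn_rel Q x0) (H1_Inn_stab Q x0) (connecting_map 2 (Inn Q) (Inn_stab Q x0))\<rparr>"

definition T_lifts ::
  "('a, 'm) quandle_scheme \<Rightarrow> 'a \<Rightarrow>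
   ((('a \<Rightarrow> 'a) list \<Rightarrow>\<^sub>0 int) \<times> (('a \<Rightarrow> 'a) list \<Rightarrow>\<^sub>0 int)) set \<Rightarrow>
   (('a \<Rightarrow> 'a) list \<Rightarrow>\<^sub>0 int) set set" where
  "T_lifts Q x0 c =
     {z \<in> carrier (H2_Inn Q). homology_to_relative 2 (Inn Q) (Inn_stab Q x0) z = c}"

definition T_on_lift ::
  "('a, 'm) quandle_scheme \<Rightarrow> 'a \<Rightarrow> (('a \<Rightarrow> 'a) list \<Rightarrow>\<^sub>0 int) set \<Rightarrow> ('a \<times> 'a \<Rightarrow>\<^sub>0 int) set" where
  "T_on_lift Q x0 z =
     eisermann_map Q x0 (proj_P Q x0
       (H1_As_stab_class Q x0 (extension_delta (As Q) (Inn Q) (As_psi Q) z)))"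

definition T_star ::
  "('a, 'm) quandle_scheme \<Rightarrow> 'a \<Rightarrow>
   ((('a \<Rightarrow> 'a) list \<Rightarrow>\<^sub>0 int) \<times> (('a \<Rightarrow> 'a) list \<Rightarrow>\<^sub>0 int)) set \<Rightarrow> ('a \<times> 'a \<Rightarrow>\<^sub>0 int) set" where
  "T_star Q x0 c = the_elem (T_on_lift Q x0 ` T_lifts Q x0 c)"

text \<open>The localized inclusion of the domain of \<open>\<T>\<^sub>*\<close> into the whole relative group. When it is
  bijective, the localized domain is identified along it with the localized relative group, and
  \<open>T_star_loc\<close> is the localization of \<open>\<T>\<^sub>*\<close> read on the latter.\<close>

definition T_domain_incl_loc ::
  "nat \<Rightarrow> ('a, 'm) quandle_scheme \<Rightarrow> 'a \<Rightarrow>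
   (((('a \<Rightarrow> 'a) list \<Rightarrow>\<^sub>0 int) \<times> (('a \<Rightarrow> 'a) list \<Rightarrow>\<^sub>0 int)) set \<times> rat \<Rightarrow>\<^sub>0 int) set \<Rightarrow>
   (((('a \<Rightarrow> 'a) list \<Rightarrow>\<^sub>0 int) \<times> (('a \<Rightarrow> 'a) list \<Rightarrow>\<^sub>0 int)) set \<times> rat \<Rightarrow>\<^sub>0 int) set" where
  "T_domain_incl_loc l Q x0 = localization_map l (H2_Inn_rel Q x0) (\<lambda>c. c)"

definition T_star_loc ::
  "nat \<Rightarrow> ('a, 'm) quandle_scheme \<Rightarrow> 'a \<Rightarrow>
   (((('a \<Rightarrow> 'a) list \<Rightarrow>\<^sub>0 int) \<times> (('a \<Rightarrow> 'a) list \<Rightarrow>\<^sub>0 int)) set \<times> rat \<Rightarrow>\<^sub>0 int) set \<Rightarrow>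
   (('a \<times> 'a \<Rightarrow>\<^sub>0 int) set \<times> rat \<Rightarrow>\<^sub>0 int) set" where
  "T_star_loc l Q x0 c =
     localization_map l (quandle_homology2 Q) (T_star Q x0)
       (inv_into (carrier (localization l (T_domain Q x0))) (T_domain_incl_loc l Q x0) c)"

end

theory Submission
  imports Defs "HOL-Library.Product_Plus"
begin

text \<open>Write \<open>t\<close> for the type of \<open>Q\<close>, \<open>P = Inn Q\<close>, \<open>\<psi> : As Q \<rightarrow> P\<close>, and let \<open>[p | q]\<close> be the universal
  \<open>2\<close>-cocycle of \<open>P\<close>, with values in bar \<open>2\<close>-chains modulo boundaries. The torus classes
  \<open>[\<rho> | s] - [s | \<rho>]\<close>, for \<open>\<rho>\<close> the translation by \<open>x\<^sub>0\<close> and \<open>s\<close> in its stabilizer, are additive in powers of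
  \<open>\<rho>\<close> and hence killed by \<open>t\<close>. Therefore the generators of \<open>As Q\<close> can be lifted by conjugation to the
  central extension of \<open>P\<close> with cocycle \<open>t [p | q]\<close> so that the defining relations hold. The
  resulting cochain \<open>\<phi>\<close> on \<open>As Q\<close> restricts, up to a constant, to a homomorphism on \<open>ker \<psi>\<close> which
  recovers \<open>t z\<close> from \<open>\<delta> z\<close>; it is also a homomorphism on the stabilizer modulo chains of \<open>Stab x\<^sub>0\<close>.
  So if \<open>\<delta> z\<close> vanishes in the abelianized stabilizer, then \<open>t z\<close> vanishes in relative homology, which
  bounds the kernel of \<open>\<T>\<^sub>*\<close> by \<open>t\<close>-torsion.

  For the cokernel, if \<open>H\<^sub>1(Stab x\<^sub>0)\<close> vanishes at \<open>l\<close>, a multiple prime to \<open>l\<close> of any class of degree \<open>0\<close>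
  in the abelianized stabilizer comes from some \<open>k \<in> ker \<psi>\<close> of degree \<open>0\<close>. As \<open>Q\<close> is connected, \<open>k\<close> is a
  product of commutators in \<open>As Q\<close>, hence in the image of \<open>\<delta>\<close>. Eisermann's isomorphism, with inverse
  \<open>(x, y) \<mapsto> p\<^sub>x e\<^sub>y p\<^sub>x\<^sub>*\<^sub>y\<^sup>-\<^sup>1\<close> for elements \<open>p\<^sub>x\<close> carrying \<open>x\<^sub>0\<close> to \<open>x\<close>, translates this to quandle homology.\<close>

text \<open>The difficulty is that \<delta> alone does not detect H_2(P): its kernel is the image of
  H_2(As Q). A trivialization over As Q of t times the universal cocycle says that t kills this
  image; the relative version needed here also discards chains of the stabilizer. To respect e_x e_y
  = e_y e_{x*y}, each translation \<rho>_y is lifted as the conjugate of one fixed lift of \<rho> by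
  some p with p x_0 = y, and the result must not depend on p. Two choices of p differ by an element
  s of the stabilizer, and the two lifts by the torus class of \<rho> and s. This is the only
  obstruction; it dies after multiplication by t because \<rho>^t = 1. The coefficients are bar
  chains modulo boundaries because the cocycle condition is then literally the boundary of a bar
  3-chain, so every identity is checked by naming a few 3-chains. At l, a multiple prime to l is as
  good as the element itself. Both halves are therefore integral statements: t kills the kernel, and
  each class of the target has a multiple prime to l in the image.\<close>

section \<open>Quotients of additive groups\<close>

text \<open>Subgroups are kept as bare sets of chains, so that computations are congruences
  \<open>a - b \<in> B\<close> solved by \<open>algebra_simps\<close>; cosets and group structures
  appear only at the end.\<close>

definition addsub :: "'a::ab_group_add set \<Rightarrow> bool" where
  "addsub B \<longleftrightarrow> 0 \<in> B \<and> (\<forall>a\<in>B. \<forall>b\<in>B. a - b \<in> B)"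

lemma addsub_zero: "addsub B \<Longrightarrow> 0 \<in> B"
  by (simp add: addsub_def)

lemma addsub_diff: "addsub B \<Longrightarrow> a \<in> B \<Longrightarrow> b \<in> B \<Longrightarrow> a - b \<in> B"
  by (simp add: addsub_def)

lemma addsub_minus: "addsub B \<Longrightarrow> a \<in> B \<Longrightarrow> - a \<in> B"
  using addsub_diff[of B 0 a] addsub_zero[of B] by simp

lemma addsub_add: "addsub B \<Longrightarrow> a \<in> B \<Longrightarrow> b \<in> B \<Longrightarrow> a + b \<in> B"
  using addsub_diff[of B a "- b"] addsub_minus[of B b] by simp

lemma addsub_minus_commute: "addsub B \<Longrightarrow> a - b \<in> B \<Longrightarrow> b - a \<in> B"
  using addsub_minus[of B "a - b"] by simp

lemma addsub_trans: "addsub B \<Longrightarrow> a - b \<in> B \<Longrightarrow> b - c \<in> B \<Longrightarrow> a - c \<in> B"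
  using addsub_add[of B "a - b" "b - c"] by simp

lemma addsub_frag_cmul:
  assumes "addsub B" "c \<in> B" shows "frag_cmul k c \<in> B"
  by (rule frag_closure_minus_cmul[where P = "\<lambda>x. x \<in> B"])
     (use assms in \<open>auto intro: addsub_zero addsub_diff\<close>)

lemma addsub_vimage:
  assumes "addsub B" and "\<And>a b. f (a - b) = f a - f b"
  shows "addsub {c. f c \<in> B}"
proof -
  have "f 0 = 0" using assms(2)[of 0 0] by simp
  then show ?thesis using assms by (auto simp: addsub_def)
qed

lemma addsub_image:
  assumes "addsub B" and "\<And>a b. f (a - b) = f a - f b"
  shows "addsub (f ` B)"
proof -
  have "f 0 = 0" using assms(2)[of 0 0] by simp
  moreover have "0 \<in> B" using assms(1) by (rule addsub_zero)
  ultimately have "0 \<in> f ` B" by (metis imageI)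
  moreover have "f a - f b \<in> f ` B" if "a \<in> B" "b \<in> B" for a b
    using assms addsub_diff[OF assms(1) that] by (metis imageI)
  ultimately show ?thesis by (auto simp: addsub_def)
qed

lemma addsub_keys: "addsub {c :: 'x \<Rightarrow>\<^sub>0 int. Poly_Mapping.keys c \<subseteq> S}"
  using keys_diff by (fastforce simp: addsub_def)

lemma frag_extend_in_addsub:
  assumes "Poly_Mapping.keys c \<subseteq> S" "addsub B" "\<And>x. x \<in> S \<Longrightarrow> f x \<in> B"
  shows "frag_extend f c \<in> B"
  using assms(1)
  by (induction c rule: frag_induction)
     (use assms in \<open>auto simp: frag_extend_diff intro: addsub_zero addsub_diff\<close>)

lemma generate_free_least:
  assumes R: "R \<subseteq> carrier (free_Abelian_group S)" and "addsub D" "R \<subseteq> D"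
  shows "generate (free_Abelian_group S) R \<subseteq> D"
proof
  fix x assume "x \<in> generate (free_Abelian_group S) R"
  then show "x \<in> D"
  proof induction
    case (inv h)
    then have "inv\<^bsub>free_Abelian_group S\<^esub> h = - h"
      using R by (intro inv_free_Abelian_group) (meson carrier_free_Abelian_group_iff subsetD)
    then show ?case using inv assms by (auto intro: addsub_minus)
  qed (use assms in \<open>auto intro: addsub_zero addsub_add\<close>)
qed

lemma addsub_generate_free:
  assumes R: "R \<subseteq> carrier (free_Abelian_group S)"
  shows "addsub (generate (free_Abelian_group S) R)"
    and "generate (free_Abelian_group S) R \<subseteq> {c. Poly_Mapping.keys c \<subseteq> S}"
proof -
  interpret group "free_Abelian_group S" by simp
  have sg: "subgroup (generate (free_Abelian_group S) R) (free_Abelian_group S)"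
    by (rule generate_is_subgroup[OF R])
  then show sub: "generate (free_Abelian_group S) R \<subseteq> {c. Poly_Mapping.keys c \<subseteq> S}"
    using subgroup.subset by fastforce
  show "addsub (generate (free_Abelian_group S) R)"
    unfolding addsub_def
  proof (intro conjI ballI)
    show "0 \<in> generate (free_Abelian_group S) R"
      using subgroup.one_closed[OF sg] by simp
    fix a b assume a: "a \<in> generate (free_Abelian_group S) R" and b: "b \<in> generate (free_Abelian_group S) R"
    then have "inv\<^bsub>free_Abelian_group S\<^esub> b = - b"
      using sub by (intro inv_free_Abelian_group) auto
    then show "a - b \<in> generate (free_Abelian_group S) R"
      using subgroup.m_closed[OF sg a subgroup.m_inv_closed[OF sg b]] by simp
  qed
qed

text \<open>The common form to which localization, group homology, relative homology and quandle
  homology are all rewritten, so that one set of coset rules serves every quotient.\<close>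

definition addgrp :: "'a::ab_group_add set \<Rightarrow> 'a monoid" where
  "addgrp Z = \<lparr>carrier = Z, monoid.mult = (+), one = 0\<rparr>"

definition acoset :: "'a::ab_group_add set \<Rightarrow> 'a \<Rightarrow> 'a set" where
  "acoset B z = (\<lambda>b. b + z) ` B"

lemma addgrp_simps [simp]:
  "carrier (addgrp Z) = Z" "x \<otimes>\<^bsub>addgrp Z\<^esub> y = x + y" "\<one>\<^bsub>addgrp Z\<^esub> = 0"
  by (simp_all add: addgrp_def)

lemma free_Abelian_group_addgrp:
  "free_Abelian_group S = addgrp {c. Poly_Mapping.keys c \<subseteq> S}"
  "(free_Abelian_group S)\<lparr>carrier := Z\<rparr> = addgrp Z"
  by (simp_all add: free_Abelian_group_def addgrp_def)

lemma comm_group_addgrp: "addsub Z \<Longrightarrow> comm_group (addgrp Z)"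
  by (rule comm_groupI) (auto simp: ac_simps intro: addsub_add addsub_zero
      intro!: bexI[where x = "- _"] addsub_minus)

lemma r_coset_plus:
  assumes "monoid.mult A = (+)" shows "N #>\<^bsub>A\<^esub> z = acoset N z"
  by (auto simp: r_coset_def acoset_def assms)

lemma mem_acoset_iff: "x \<in> acoset B z \<longleftrightarrow> x - z \<in> B"
  by (force simp: acoset_def image_iff)

lemma acoset_eq_iff:
  assumes "addsub B" shows "acoset B a = acoset B b \<longleftrightarrow> a - b \<in> B"
proof
  assume "acoset B a = acoset B b"
  moreover have "a \<in> acoset B a" using assms by (simp add: mem_acoset_iff addsub_zero)
  ultimately show "a - b \<in> B" by (simp add: mem_acoset_iff)
next
  assume ab: "a - b \<in> B"
  have "x - a \<in> B \<longleftrightarrow> x - b \<in> B" for x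
    using addsub_trans[OF assms _ ab, of x] addsub_trans[OF assms _ addsub_minus_commute[OF assms ab], of x]
    by blast
  then show "acoset B a = acoset B b" by (auto simp: mem_acoset_iff)
qed

lemma the_elem_acoset:
  assumes "addsub M" "\<And>m. m \<in> M \<Longrightarrow> f (m + z) = v"
  shows "the_elem (f ` acoset M z) = v"
  by (rule the_elem_image_unique) (use assms in \<open>auto simp: acoset_def dest: addsub_zero\<close>)

text \<open>Moving within a coset of \<open>M\<close> changes \<open>h\<close> only by elements of
  \<open>N\<close>, so all cosets in the image coincide and \<open>the_elem\<close> reads off their
  common value.\<close>

lemma induced_map_acoset:
  assumes "monoid.mult H = (+)" "addsub M" "addsub N"
    and "\<And>m. m \<in> M \<Longrightarrow> h (m + z) - h z \<in> N"
  shows "induced_map h H N (acoset M z) = acoset N (h z)"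
  unfolding induced_map_def
  by (rule the_elem_acoset) (use assms in \<open>auto simp: r_coset_plus acoset_eq_iff\<close>)

locale addquot =
  fixes Z B :: "'a::ab_group_add set"
  assumes Z: "addsub Z" and B: "addsub B" and BZ: "B \<subseteq> Z"
begin

lemma subgroup_B: "subgroup B (addgrp Z)"
proof -
  interpret comm_group "addgrp Z" by (rule comm_group_addgrp[OF Z])
  have inv: "inv\<^bsub>addgrp Z\<^esub> b = - b" if "b \<in> B" for b
    by (rule inv_equality) (use that BZ Z in \<open>auto intro: addsub_minus\<close>)
  show ?thesis
    by (rule subgroupI) (use BZ B inv in \<open>auto intro: addsub_minus addsub_add addsub_zero\<close>)
qed

lemma comm_group: "comm_group (addgrp Z Mod B)"
  by (rule comm_group.abelian_FactGroup[OF comm_group_addgrp[OF Z] subgroup_B])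

lemma carrier: "carrier (addgrp Z Mod B) = acoset B ` Z"
  by (simp add: carrier_FactGroup r_coset_plus addgrp_def)

lemma acoset_closed: "z \<in> Z \<Longrightarrow> acoset B z \<in> carrier (addgrp Z Mod B)"
  by (simp add: carrier)

lemma one: "\<one>\<^bsub>addgrp Z Mod B\<^esub> = acoset B 0"
  by (simp add: acoset_def)

lemma mult:
  "acoset B a \<otimes>\<^bsub>addgrp Z Mod B\<^esub> acoset B b = acoset B (a + b)"
proof -
  have "x - a - b \<in> B \<longleftrightarrow> (\<exists>h k. h - a \<in> B \<and> k - b \<in> B \<and> x = h + k)" for x
  proof
    assume "x - a - b \<in> B"
    then show "\<exists>h k. h - a \<in> B \<and> k - b \<in> B \<and> x = h + k"
      by (intro exI[of _ "x - b"] exI[of _ b]) (use B in \<open>auto simp: addsub_zero algebra_simps\<close>)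
  next
    assume "\<exists>h k. h - a \<in> B \<and> k - b \<in> B \<and> x = h + k"
    then obtain h k where "h - a \<in> B" "k - b \<in> B" "x = h + k" by blast
    then show "x - a - b \<in> B" using addsub_add[OF B, of "h - a" "k - b"] by (simp add: algebra_simps)
  qed
  then have "x \<in> acoset B (a + b) \<longleftrightarrow> (\<exists>h\<in>acoset B a. \<exists>k\<in>acoset B b. x = h + k)" for x
    unfolding mem_acoset_iff Bex_def diff_diff_eq by blast
  then show ?thesis
    by (auto simp: set_mult_def)
qed

lemma eq_one_iff: "acoset B a = \<one>\<^bsub>addgrp Z Mod B\<^esub> \<longleftrightarrow> a \<in> B"
  unfolding one by (simp add: acoset_eq_iff[OF B])

lemma homI:
  assumes "\<And>a. a \<in> Z \<Longrightarrow> f (acoset B a) \<in> carrier H"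
    and "\<And>a b. a \<in> Z \<Longrightarrow> b \<in> Z \<Longrightarrow> f (acoset B (a + b)) = f (acoset B a) \<otimes>\<^bsub>H\<^esub> f (acoset B b)"
  shows "f \<in> hom (addgrp Z Mod B) H"
  by (rule Group.homI) (use assms in \<open>auto simp: carrier mult simp del: mult_FactGroup\<close>)

end

locale frag_addquot = addquot Z B for Z B :: "('x \<Rightarrow>\<^sub>0 int) set"
begin

lemma nat_pow:
  "acoset B a [^]\<^bsub>addgrp Z Mod B\<^esub> (n::nat) = acoset B (frag_cmul (int n) a)"
proof (induction n)
  case 0
  show ?case using one by (simp add: nat_pow_def)
next
  case (Suc n)
  have "acoset B a [^]\<^bsub>addgrp Z Mod B\<^esub> Suc n =
      acoset B a [^]\<^bsub>addgrp Z Mod B\<^esub> n \<otimes>\<^bsub>addgrp Z Mod B\<^esub> acoset B a"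
    by (simp add: nat_pow_def)
  also have "\<dots> = acoset B (frag_cmul (int n) a + a)"
    unfolding Suc by (rule mult)
  also have "frag_cmul (int n) a + a = frag_cmul (int (Suc n)) a"
    by (simp add: frag_cmul_distrib)
  finally show ?case .
qed

end

section \<open>Localization\<close>

lemma Z_loc_simps [simp]: "x \<otimes>\<^bsub>Z_loc l\<^esub> y = x + y" "\<one>\<^bsub>Z_loc l\<^esub> = 0"
  by (simp_all add: Z_loc_def)

lemma Z_locI: "\<not> int l dvd s \<Longrightarrow> of_int a / of_int s \<in> carrier (Z_loc l)"
  unfolding Z_loc_def by auto

lemma Z_locE:
  assumes "q \<in> carrier (Z_loc l)"
  obtains a s where "q = of_int a / of_int s" "\<not> int l dvd s"
  using assms by (auto simp: Z_loc_def)

lemma Z_loc_one: "prime l \<Longrightarrow> 1 \<in> carrier (Z_loc l)"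
  using Z_locI[of l 1 1] by (auto simp: prime_nat_iff)

lemma Z_loc_add:
  assumes "prime l" "q \<in> carrier (Z_loc l)" "r \<in> carrier (Z_loc l)"
  shows "q + r \<in> carrier (Z_loc l)"
proof -
  obtain a s where q: "q = of_int a / of_int s" "\<not> int l dvd s" using assms(2) by (rule Z_locE)
  obtain b t where r: "r = of_int b / of_int t" "\<not> int l dvd t" using assms(3) by (rule Z_locE)
  have "s \<noteq> 0" "t \<noteq> 0" using q r by auto
  then have "q + r = of_int (a * t + b * s) / of_int (s * t)"
    by (simp add: q r add_frac_eq)
  moreover have "\<not> int l dvd s * t"
    using q r assms(1) by (simp add: prime_dvd_mult_iff)
  ultimately show ?thesis using Z_locI by metis
qed

lemma Z_loc_divide:
  assumes "prime l" "q \<in> carrier (Z_loc l)" "\<not> l dvd n"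
  shows "q / of_nat n \<in> carrier (Z_loc l)"
proof -
  obtain a s where q: "q = of_int a / of_int s" "\<not> int l dvd s" using assms(2) by (rule Z_locE)
  have "q / of_nat n = of_int a / of_int (s * int n)" by (simp add: q)
  moreover have "\<not> int l dvd s * int n"
    using q assms by (simp add: prime_dvd_mult_iff)
  ultimately show ?thesis using Z_locI by metis
qed

lemma Z_loc_of_nat_mult:
  assumes "q \<in> carrier (Z_loc l)" shows "of_nat n * q \<in> carrier (Z_loc l)"
proof -
  obtain a s where q: "q = of_int a / of_int s" "\<not> int l dvd s" using assms by (rule Z_locE)
  have "of_nat n * q = of_int (int n * a) / of_int s" by (simp add: q)
  then show ?thesis using Z_locI[OF q(2)] by metis
qed

lemma not_dvd_mult: "prime (l::nat) \<Longrightarrow> \<not> l dvd m \<Longrightarrow> \<not> l dvd n \<Longrightarrow> \<not> l dvd m * n"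
  by (simp add: prime_dvd_mult_iff)

section \<open>Scalars in the tensor product with \<open>Z_loc l\<close>\<close>

locale localized = comm_group M for M (structure) +
  fixes l :: nat
  assumes prime_l: "prime l"
begin

abbreviation chains where "chains \<equiv> {c. Poly_Mapping.keys c \<subseteq> carrier M \<times> carrier (Z_loc l)}"
abbreviation null where "null \<equiv> tensor_null M (Z_loc l)"

lemma tensor_relations_subset:
  "tensor_relations M (Z_loc l) \<subseteq> carrier (free_Abelian_group (carrier M \<times> carrier (Z_loc l)))"
  unfolding tensor_relations_def
  using Z_loc_add[OF prime_l] by (fastforce dest!: subsetD[OF keys_diff])

lemma null: "addsub null" "null \<subseteq> chains"
  unfolding tensor_null_def by (rule addsub_generate_free[OF tensor_relations_subset])+

lemma null_least: "addsub D \<Longrightarrow> tensor_relations M (Z_loc l) \<subseteq> D \<Longrightarrow> null \<subseteq> D"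
  unfolding tensor_null_def by (rule generate_free_least[OF tensor_relations_subset])

sublocale frag_addquot chains null
  by unfold_locales (auto simp: null addsub_keys subsetD[OF null(2)])

lemma localization_eq: "localization l M = addgrp chains Mod null"
  by (simp add: localization_def tensor_product_def free_Abelian_group_addgrp)

lemma add_left:
  "m \<in> carrier M \<Longrightarrow> m' \<in> carrier M \<Longrightarrow> q \<in> carrier (Z_loc l) \<Longrightarrow>
    frag_of (m \<otimes> m', q) - frag_of (m, q) - frag_of (m', q) \<in> null"
  unfolding tensor_null_def tensor_relations_def by (rule generate.incl) blast

lemma add_right:
  assumes "m \<in> carrier M" "q \<in> carrier (Z_loc l)" "r \<in> carrier (Z_loc l)"
  shows "frag_of (m, q + r) - frag_of (m, q) - frag_of (m, r) \<in> null"
proof -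
  have "frag_of (m, q \<otimes>\<^bsub>Z_loc l\<^esub> r) - frag_of (m, q) - frag_of (m, r) \<in> null"
    unfolding tensor_null_def tensor_relations_def using assms by (intro generate.incl) blast
  then show ?thesis by simp
qed

lemma pow_left:
  assumes m: "m \<in> carrier M" and q: "q \<in> carrier (Z_loc l)"
  shows "frag_of (m [^] (n::nat), q) - frag_cmul (int n) (frag_of (m, q)) \<in> null"
proof (induction n)
  case 0
  have "- (frag_of (\<one> \<otimes> \<one>, q) - frag_of (\<one>, q) - frag_of (\<one>, q)) \<in> null"
    by (intro addsub_minus null add_left q) auto
  then show ?case by simp
next
  case (Suc n)
  have "frag_of (m [^] Suc n, q) - frag_cmul (int (Suc n)) (frag_of (m, q)) =
     (frag_of (m [^] n, q) - frag_cmul (int n) (frag_of (m, q))) +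
     (frag_of (m [^] n \<otimes> m, q) - frag_of (m [^] n, q) - frag_of (m, q))"
    by (simp add: frag_cmul_distrib)
  also have "\<dots> \<in> null"
    by (intro addsub_add null Suc add_left) (use m q in auto)
  finally show ?case .
qed

lemma zero_right:
  assumes m: "m \<in> carrier M" shows "frag_of (m, 0) \<in> null"
proof -
  have "0 \<in> carrier (Z_loc l)"
    using Z_loc_of_nat_mult[OF Z_loc_one[OF prime_l], of 0] by simp
  then have "- (frag_of (m, 0 + 0) - frag_of (m, 0) - frag_of (m, 0)) \<in> null"
    by (intro addsub_minus null add_right m)
  then show ?thesis by simp
qed

lemma mult_right:
  assumes m: "m \<in> carrier M" and q: "q \<in> carrier (Z_loc l)"
  shows "frag_of (m, of_nat n * q) - frag_cmul (int n) (frag_of (m, q)) \<in> null"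
proof (induction n)
  case 0
  then show ?case using zero_right[OF m] by simp
next
  case (Suc n)
  have "frag_of (m, of_nat (Suc n) * q) - frag_cmul (int (Suc n)) (frag_of (m, q)) =
     (frag_of (m, of_nat n * q) - frag_cmul (int n) (frag_of (m, q))) +
     (frag_of (m, of_nat n * q + q) - frag_of (m, of_nat n * q) - frag_of (m, q))"
    by (simp add: frag_cmul_distrib algebra_simps)
  also have "\<dots> \<in> null"
    by (intro addsub_add null Suc add_right m q Z_loc_of_nat_mult)
  finally show ?case .
qed

text \<open>Put r = q / (a b). Since a r = q / b, both terms are congruent to a times the generator
  (m, r).\<close>

lemma move_scalar:
  assumes m: "m \<in> carrier M" and q: "q \<in> carrier (Z_loc l)" and "\<not> l dvd a" "\<not> l dvd b"
  shows "frag_of (m [^] a, q / of_nat (a * b)) - frag_of (m, q / of_nat b) \<in> null"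
proof -
  define r where "r = q / of_nat (a * b)"
  have r: "r \<in> carrier (Z_loc l)"
    unfolding r_def by (intro Z_loc_divide prime_l q not_dvd_mult assms)
  have "a \<noteq> 0" using assms by (metis dvd_0_right)
  then have "of_nat a * r = q / of_nat b" by (simp add: r_def)
  then show ?thesis
    using addsub_diff[OF null(1) pow_left[OF m r, of a] mult_right[OF m r, of a]]
    by (simp add: r_def)
qed

text \<open>The chain is evaluated after clearing denominators by a common multiple of them.\<close>

lemma trivial_imp_torsion:
  assumes triv: "trivial_group (localization l M)" and m: "m \<in> carrier M"
  shows "\<exists>n::nat. \<not> l dvd n \<and> m [^] n = \<one>"
proof -
  \<comment> \<open>The evaluation x \<otimes> q \<mapsto> x^(D q). The floor only makes it total:
    it is the intended exponent when D q is an integer, and only then is additivity in q to be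
    expected.\<close>
  have "\<exists>h. h \<in> hom (free_Abelian_group (carrier M \<times> carrier (Z_loc l))) M \<and>
      (\<forall>x\<in>carrier M \<times> carrier (Z_loc l). h (frag_of x) = fst x [^] \<lfloor>of_nat D * snd x\<rfloor>)" for D :: nat
    by (rule free_Abelian_group_universal[of "\<lambda>x. fst x [^] \<lfloor>of_nat D * snd x\<rfloor>"
          "carrier M \<times> carrier (Z_loc l)"]) auto
  then obtain V where V: "\<And>D::nat. V D \<in> hom (free_Abelian_group (carrier M \<times> carrier (Z_loc l))) M"
    and V1: "\<And>D x q. x \<in> carrier M \<Longrightarrow> q \<in> carrier (Z_loc l) \<Longrightarrow>
      V D (frag_of (x, q)) = x [^] \<lfloor>of_nat D * q\<rfloor>"
    by (metis SigmaI fst_conv snd_conv)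
  interpret V: group_hom "free_Abelian_group (carrier M \<times> carrier (Z_loc l))" M "V D" for D
    by (intro group_hom.intro group_hom_axioms.intro group_free_Abelian_group is_group V)
  have V_diff: "V D (a - b) = V D a \<otimes> inv V D b" if "a \<in> chains" "b \<in> chains" for D a b
    using V.hom_mult[of a "- b"] V.hom_inv[of b] that by simp
  have cancel: "x \<otimes> y \<otimes> inv x \<otimes> inv y = \<one>" if "x \<in> carrier M" "y \<in> carrier M" for x y
  proof -
    have "x \<otimes> y \<otimes> inv x = y" using that m_comm[of x y] by (simp add: m_assoc)
    then show ?thesis using that by simp
  qed
  \<comment> \<open>Asking for all multiples of \<open>D\<close> makes this set closed under
    differences: two chains with different \<open>D\<close> and \<open>D'\<close> are both killed by
    the multiples of \<open>D * D'\<close>.\<close>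
  define E where "E = {c \<in> chains. \<exists>D. \<not> l dvd D \<and> (\<forall>k. V (k * D) c = \<one>)}"
  have E: "addsub E"
    unfolding addsub_def
  proof (intro conjI ballI)
    show "0 \<in> E" using prime_l V.hom_one by (auto simp: E_def prime_nat_iff intro!: exI[of _ 1])
    fix a b assume "a \<in> E" "b \<in> E"
    then obtain D D' where D: "\<not> l dvd D" "\<And>k. V (k * D) a = \<one>" "a \<in> chains"
      and D': "\<not> l dvd D'" "\<And>k. V (k * D') b = \<one>" "b \<in> chains"
      by (auto simp: E_def)
    have "V (k * (D * D')) (a - b) = \<one>" for k
      using V_diff[OF D(3) D'(3), of "k * (D * D')"] D(2)[of "k * D'"] D'(2)[of "k * D"]
      by (simp add: ac_simps)
    then show "a - b \<in> E"
      using D D' not_dvd_mult[OF prime_l D(1) D'(1)]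
      by (auto simp: E_def intro!: exI[of _ "D * D'"] dest: subsetD[OF keys_diff])
  qed
  have int: "\<exists>D. \<not> l dvd D \<and> of_nat D * q \<in> \<int>" if q: "q \<in> carrier (Z_loc l)" for q
  proof -
    obtain a s where s: "q = of_int a / of_int s" "\<not> int l dvd s" using q by (rule Z_locE)
    then have "s \<noteq> 0" by auto
    then have "of_nat (nat \<bar>s\<bar>) * q = of_int (sgn s * a)"
      by (simp add: s of_nat_nat abs_if sgn_if)
    moreover have "\<not> l dvd nat \<bar>s\<bar>" using s by (simp add: nat_dvd_iff dvd_nat_abs_iff)
    ultimately show ?thesis by (metis Ints_of_int)
  qed
  have "tensor_relations M (Z_loc l) \<subseteq> E"
  proof
    fix c assume c: "c \<in> tensor_relations M (Z_loc l)"
    then have "c \<in> carrier (free_Abelian_group (carrier M \<times> carrier (Z_loc l)))"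
      using tensor_relations_subset by (rule subsetD[rotated])
    then have cc: "c \<in> chains" by simp
    from c consider (1) a a' b where "c = frag_of (a \<otimes> a', b) - frag_of (a, b) - frag_of (a', b)"
        "a \<in> carrier M" "a' \<in> carrier M" "b \<in> carrier (Z_loc l)"
      | (2) a b b' where "c = frag_of (a, b + b') - frag_of (a, b) - frag_of (a, b')"
        "a \<in> carrier M" "b \<in> carrier (Z_loc l)" "b' \<in> carrier (Z_loc l)"
      by (auto simp: tensor_relations_def)
    then show "c \<in> E"
    proof cases
      case 1
      have "V D c = \<one>" for D
        using 1 cancel by (simp add: V_diff V1 int_pow_distrib keys_diff[THEN order_trans])
      then show ?thesis using cc prime_l by (auto simp: E_def prime_nat_iff intro!: exI[of _ 1])
    next
      case 2
      obtain D D' where D: "\<not> l dvd D" "of_nat D * b \<in> \<int>" "\<not> l dvd D'" "of_nat D' * b' \<in> \<int>"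
        using int 2 by metis
      have "V (k * (D * D')) c = \<one>" for k
      proof -
        define K where "K = k * (D * D')"
        have "of_nat K * b = of_nat (k * D') * (of_nat D * b)" by (simp add: K_def)
        also have "\<dots> \<in> \<int>" by (intro Ints_mult D) auto
        finally have "of_nat K * b \<in> \<int>" .
        then have "\<lfloor>of_nat K * (b + b')\<rfloor> = \<lfloor>of_nat K * b\<rfloor> + \<lfloor>of_nat K * b'\<rfloor>"
          by (auto elim!: Ints_cases simp: algebra_simps)
        then have "V K c = \<one>"
          using 2 cancel by (simp add: V_diff V1 int_pow_mult[symmetric] Z_loc_add[OF prime_l]
              keys_diff[THEN order_trans]) (simp add: int_pow_mult)
        then show ?thesis by (simp add: K_def)
      qed
      then show ?thesis using cc D not_dvd_mult[OF prime_l D(1,3)] by (auto simp: E_def intro!: exI[of _ "D * D'"])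
    qed
  qed
  then have "null \<subseteq> E" by (rule null_least[OF E])
  moreover have "frag_of (m, 1) \<in> null"
  proof -
    have "frag_of (m, 1) \<in> chains" using m Z_loc_one[OF prime_l] by simp
    then have "acoset null (frag_of (m, 1)) \<in> carrier (localization l M)"
      unfolding localization_eq by (rule acoset_closed)
    then have "acoset null (frag_of (m, 1)) = \<one>\<^bsub>localization l M\<^esub>"
      using triv by (auto simp: trivial_group_def)
    then show ?thesis unfolding localization_eq eq_one_iff .
  qed
  ultimately obtain D where "\<not> l dvd D" "V (1 * D) (frag_of (m, 1)) = \<one>"
    unfolding E_def by blast
  then show ?thesis
    using m Z_loc_one[OF prime_l] by (auto simp: V1 int_pow_int)
qed

end

text \<open>The inverse sends \<open>y \<otimes> q\<close> to \<open>m \<otimes> q / n\<close> for any \<open>n\<close> prime to \<open>l\<close> with \<open>f m = n y\<close>.\<close>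

lemma localization_map_iso:
  assumes l: "prime l" and M: "comm_group M" and N: "comm_group N" and f: "f \<in> hom M N"
    and ker: "\<And>m. m \<in> carrier M \<Longrightarrow> f m = \<one>\<^bsub>N\<^esub> \<Longrightarrow> \<exists>n::nat. \<not> l dvd n \<and> m [^]\<^bsub>M\<^esub> n = \<one>\<^bsub>M\<^esub>"
    and coker: "\<And>y. y \<in> carrier N \<Longrightarrow> \<exists>n::nat. \<not> l dvd n \<and> (\<exists>m\<in>carrier M. f m = y [^]\<^bsub>N\<^esub> n)"
  shows "localization_map l N f \<in> iso (localization l M) (localization l N)"
proof -
  interpret M: localized M l by (intro localized.intro localized_axioms.intro l M)
  interpret N: localized N l by (intro localized.intro localized_axioms.intro l N)
  interpret f: group_hom M N f by unfold_locales (rule f)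
  let ?Z = "carrier (Z_loc l)"
  define F :: "('a \<times> rat \<Rightarrow>\<^sub>0 int) \<Rightarrow> ('c \<times> rat \<Rightarrow>\<^sub>0 int)"
    where "F = frag_extend (\<lambda>(m, q). frag_of (f m, q))"
  have F1: "F (frag_of (m, q)) = frag_of (f m, q)" for m q by (simp add: F_def)
  have F_diff: "F (a - b) = F a - F b" for a b by (simp add: F_def frag_extend_diff)
  have F_chains: "F c \<in> N.chains" if "c \<in> M.chains" for c
    unfolding F_def by (rule frag_extend_in_addsub[OF _ addsub_keys]) (use that in auto)
  have "M.null \<subseteq> {c. F c \<in> N.null}"
  proof (rule M.null_least)
    show "addsub {c. F c \<in> N.null}" by (intro addsub_vimage N.null F_diff)
    show "tensor_relations M (Z_loc l) \<subseteq> {c. F c \<in> N.null}"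
      by (auto simp: tensor_relations_def F_diff F1 intro!: N.add_left N.add_right)
  qed
  then have F_null: "F c \<in> N.null" if "c \<in> M.null" for c using that by blast
  obtain nn mm where nn: "\<And>y. y \<in> carrier N \<Longrightarrow> \<not> l dvd nn y"
    and mm: "\<And>y. y \<in> carrier N \<Longrightarrow> mm y \<in> carrier M"
    and fmm: "\<And>y. y \<in> carrier N \<Longrightarrow> f (mm y) = y [^]\<^bsub>N\<^esub> (nn y :: nat)"
    using coker by metis
  \<comment> \<open>Well-definedness of m \<otimes> q / n. The powers m^n' and m'^n have the same
    image under f, so they differ by an element of the kernel, which some k prime to l kills; the
    scalars n' k and n k can then be moved across.\<close>
  have W: "frag_of (m, q / of_nat n) - frag_of (m', q / of_nat n') \<in> M.null"
    if m: "m \<in> carrier M" "m' \<in> carrier M" and q: "q \<in> ?Z" and n: "\<not> l dvd n" "\<not> l dvd n'"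
      and w: "w \<in> carrier N" "f m = w [^]\<^bsub>N\<^esub> n" "f m' = w [^]\<^bsub>N\<^esub> n'" for m m' q n n' w
  proof -
    define d where "d = m [^]\<^bsub>M\<^esub> n' \<otimes>\<^bsub>M\<^esub> inv\<^bsub>M\<^esub> (m' [^]\<^bsub>M\<^esub> n)"
    have d: "d \<in> carrier M" using m by (simp add: d_def)
    have "f d = \<one>\<^bsub>N\<^esub>"
      using m w by (simp add: d_def f.hom_nat_pow N.nat_pow_pow mult.commute)
    then obtain k :: nat where k: "\<not> l dvd k" "d [^]\<^bsub>M\<^esub> k = \<one>\<^bsub>M\<^esub>" using ker d by blast
    have "(m [^]\<^bsub>M\<^esub> n') [^]\<^bsub>M\<^esub> k = (d \<otimes>\<^bsub>M\<^esub> (m' [^]\<^bsub>M\<^esub> n)) [^]\<^bsub>M\<^esub> k"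
      using m by (simp add: d_def M.m_assoc)
    also have "\<dots> = (m' [^]\<^bsub>M\<^esub> n) [^]\<^bsub>M\<^esub> k"
      using m d k by (subst M.pow_mult_distrib) (auto simp: M.m_comm)
    finally have eq: "m [^]\<^bsub>M\<^esub> (n' * k) = m' [^]\<^bsub>M\<^esub> (n * k)" using m by (simp add: M.nat_pow_pow)
    have "frag_of (m [^]\<^bsub>M\<^esub> (n' * k), q / of_nat ((n' * k) * n)) - frag_of (m, q / of_nat n) \<in> M.null"
      by (intro M.move_scalar m q n not_dvd_mult l k)
    moreover have "frag_of (m' [^]\<^bsub>M\<^esub> (n * k), q / of_nat ((n * k) * n')) - frag_of (m', q / of_nat n') \<in> M.null"
      by (intro M.move_scalar m q n not_dvd_mult l k)
    ultimately show ?thesis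
      using addsub_diff[OF M.null(1)] eq by (fastforce simp: ac_simps)
  qed
  define g :: "('c \<times> rat \<Rightarrow>\<^sub>0 int) \<Rightarrow> ('a \<times> rat \<Rightarrow>\<^sub>0 int)"
    where "g = frag_extend (\<lambda>(y, q). frag_of (mm y, q / of_nat (nn y)))"
  have g1: "g (frag_of (y, q)) = frag_of (mm y, q / of_nat (nn y))" for y q by (simp add: g_def)
  have g_diff: "g (a - b) = g a - g b" for a b by (simp add: g_def frag_extend_diff)
  have g_chains: "g c \<in> M.chains" if "c \<in> N.chains" for c
    unfolding g_def by (rule frag_extend_in_addsub[OF _ addsub_keys])
      (use that in \<open>auto simp: mm nn intro!: Z_loc_divide l\<close>)
  have "N.null \<subseteq> {c. g c \<in> M.null}"
  proof (rule N.null_least)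
    show "addsub {c. g c \<in> M.null}" by (intro addsub_vimage M.null g_diff)
    show "tensor_relations N (Z_loc l) \<subseteq> {c. g c \<in> M.null}"
    proof
      fix c assume "c \<in> tensor_relations N (Z_loc l)"
      then consider (1) a a' b where "c = frag_of (a \<otimes>\<^bsub>N\<^esub> a', b) - frag_of (a, b) - frag_of (a', b)"
          "a \<in> carrier N" "a' \<in> carrier N" "b \<in> ?Z"
        | (2) a b b' where "c = frag_of (a, b + b') - frag_of (a, b) - frag_of (a, b')"
          "a \<in> carrier N" "b \<in> ?Z" "b' \<in> ?Z"
        by (auto simp: tensor_relations_def)
      then show "c \<in> {c. g c \<in> M.null}"
      proof cases
        case 1
        \<comment> \<open>The preimages of the two factors are raised to powers so that both refer
          to the common denominator r r'.\<close>
        define r where "r = nn a" define r' where "r' = nn a'"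
        define m where "m = mm a [^]\<^bsub>M\<^esub> r'" define m' where "m' = mm a' [^]\<^bsub>M\<^esub> r"
        have in_M: "m \<in> carrier M" "m' \<in> carrier M" using 1 mm by (simp_all add: m_def m'_def)
        have r: "\<not> l dvd r" "\<not> l dvd r'" using 1 nn by (simp_all add: r_def r'_def)
        have "frag_of (mm (a \<otimes>\<^bsub>N\<^esub> a'), b / of_nat (nn (a \<otimes>\<^bsub>N\<^esub> a'))) -
            frag_of (m \<otimes>\<^bsub>M\<^esub> m', b / of_nat (r * r')) \<in> M.null"
        proof (rule W[of _ _ _ _ _ "a \<otimes>\<^bsub>N\<^esub> a'"])
          show "f (m \<otimes>\<^bsub>M\<^esub> m') = (a \<otimes>\<^bsub>N\<^esub> a') [^]\<^bsub>N\<^esub> (r * r')"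
            using 1 in_M mm by (simp add: m_def m'_def f.hom_nat_pow fmm N.nat_pow_pow r_def r'_def
                N.pow_mult_distrib N.m_comm mult.commute)
        qed (use 1 mm nn fmm in_M r not_dvd_mult[OF l] in auto)
        moreover have "frag_of (m \<otimes>\<^bsub>M\<^esub> m', b / of_nat (r * r')) - frag_of (m, b / of_nat (r * r'))
            - frag_of (m', b / of_nat (r * r')) \<in> M.null"
          by (intro M.add_left in_M Z_loc_divide l 1 not_dvd_mult r)
        moreover have "frag_of (m, b / of_nat (r' * r)) - frag_of (mm a, b / of_nat r) \<in> M.null"
          unfolding m_def by (intro M.move_scalar mm 1 r)
        moreover have "frag_of (m', b / of_nat (r * r')) - frag_of (mm a', b / of_nat r') \<in> M.null"
          unfolding m'_def by (intro M.move_scalar mm 1 r)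
        ultimately have "(frag_of (mm (a \<otimes>\<^bsub>N\<^esub> a'), b / of_nat (nn (a \<otimes>\<^bsub>N\<^esub> a'))) -
            frag_of (m \<otimes>\<^bsub>M\<^esub> m', b / of_nat (r * r'))) +
            (frag_of (m \<otimes>\<^bsub>M\<^esub> m', b / of_nat (r * r')) - frag_of (m, b / of_nat (r * r'))
            - frag_of (m', b / of_nat (r * r'))) +
            (frag_of (m, b / of_nat (r' * r)) - frag_of (mm a, b / of_nat r)) +
            (frag_of (m', b / of_nat (r * r')) - frag_of (mm a', b / of_nat r')) \<in> M.null"
          by (intro addsub_add M.null)
        then show ?thesis using 1 by (simp add: g_diff g1 r_def r'_def mult.commute)
      next
        case 2
        then show ?thesis
          using M.add_right[OF mm, of a "b / of_nat (nn a)" "b' / of_nat (nn a)"] nn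
          by (simp add: g_diff g1 add_divide_distrib Z_loc_divide[OF l])
      qed
    qed
  qed
  then have g_null: "g c \<in> M.null" if "c \<in> N.null" for c using that by blast
  have gF: "g (F c) - c \<in> M.null" if "Poly_Mapping.keys c \<subseteq> carrier M \<times> ?Z" for c
    using that
  proof (induction c rule: frag_induction)
    case zero then show ?case using M.null by (simp add: F_def g_def addsub_zero)
  next
    case (one x)
    obtain m q where x: "x = (m, q)" by (cases x)
    \<comment> \<open>The element m is itself a preimage of f m with denominator 1, so it may
      replace the chosen one.\<close>
    have "frag_of (mm (f m), q / of_nat (nn (f m))) - frag_of (m, q / of_nat 1) \<in> M.null"
      by (rule W[of _ _ _ _ _ "f m"]) (use one x l in \<open>auto simp: mm nn fmm prime_nat_iff\<close>)
    then show ?case by (simp add: x F1 g1)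
  next
    case (diff a b)
    then show ?case using addsub_diff[OF M.null(1), of "g (F a) - a" "g (F b) - b"]
      by (simp add: F_diff g_diff algebra_simps)
  qed
  have Fg: "F (g c) - c \<in> N.null" if "Poly_Mapping.keys c \<subseteq> carrier N \<times> ?Z" for c
    using that
  proof (induction c rule: frag_induction)
    case zero then show ?case using N.null by (simp add: F_def g_def addsub_zero)
  next
    case (one x)
    obtain y q where x: "x = (y, q)" by (cases x)
    have "frag_of (y [^]\<^bsub>N\<^esub> nn y, q / of_nat (nn y * 1)) - frag_of (y, q / of_nat 1) \<in> N.null"
      by (rule N.move_scalar) (use one x l in \<open>auto simp: nn prime_nat_iff\<close>)
    then show ?case using one x by (simp add: F1 g1 fmm)
  next
    case (diff a b)
    then show ?case using addsub_diff[OF N.null(1), of "F (g a) - a" "F (g b) - b"]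
      by (simp add: F_diff g_diff algebra_simps)
  qed
  have F_add: "F (a + b) = F a + F b" for a b by (simp add: F_def frag_extend_add)
  have map: "localization_map l N f (acoset M.null c) = acoset N.null (F c)" for c
    unfolding localization_map_def F_def[symmetric]
    by (rule induced_map_acoset) (auto simp: M.null N.null F_add F_null free_Abelian_group_def)
  have hom: "localization_map l N f \<in> hom (localization l M) (localization l N)"
    unfolding M.localization_eq N.localization_eq
  proof (rule M.homI)
    show "localization_map l N f (acoset M.null c) \<in> carrier (addgrp N.chains Mod N.null)"
      if "c \<in> M.chains" for c
      unfolding map by (intro N.acoset_closed F_chains that)
  qed (simp add: map F_add N.mult del: mult_FactGroup)
  moreover have "bij_betw (localization_map l N f) (carrier (localization l M)) (carrier (localization l N))"
    unfolding bij_betw_def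
  proof
    show "inj_on (localization_map l N f) (carrier (localization l M))"
    proof (rule inj_onI)
      fix x y assume "x \<in> carrier (localization l M)" "y \<in> carrier (localization l M)"
        and eq: "localization_map l N f x = localization_map l N f y"
      then obtain a b where a: "a \<in> M.chains" "x = acoset M.null a" and b: "b \<in> M.chains" "y = acoset M.null b"
        unfolding M.localization_eq M.carrier by blast
      have "F a - F b \<in> N.null" using eq a b by (simp add: map acoset_eq_iff[OF N.null(1)])
      then have "g (F (a - b)) \<in> M.null" by (simp add: F_diff g_null)
      moreover have "g (F (a - b)) - (a - b) \<in> M.null"
        using a b by (intro gF) (auto dest: subsetD[OF keys_diff])
      ultimately have "a - b \<in> M.null" using addsub_diff[OF M.null(1)] by fastforce
      then show "x = y" using a b by (simp add: acoset_eq_iff[OF M.null(1)])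
    qed
    show "localization_map l N f ` carrier (localization l M) = carrier (localization l N)"
    proof
      show "localization_map l N f ` carrier (localization l M) \<subseteq> carrier (localization l N)"
        using hom by (auto simp: hom_def)
      show "carrier (localization l N) \<subseteq> localization_map l N f ` carrier (localization l M)"
      proof
        fix y assume "y \<in> carrier (localization l N)"
        then obtain c where c: "c \<in> N.chains" "y = acoset N.null c"
          unfolding N.localization_eq N.carrier by blast
        have "localization_map l N f (acoset M.null (g c)) = y"
          using Fg[of c] c by (simp add: map acoset_eq_iff[OF N.null(1)])
        moreover have "acoset M.null (g c) \<in> carrier (localization l M)"
          unfolding M.localization_eq by (intro M.acoset_closed g_chains c)
        ultimately show "y \<in> localization_map l N f ` carrier (localization l M)" by blast
      qed
    qed
  qed
  ultimately show ?thesis by (simp add: iso_def)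
qed

section \<open>The bar complex in low degrees\<close>

definition bar_set :: "nat \<Rightarrow> ('g, 'm) monoid_scheme \<Rightarrow> ('g list \<Rightarrow>\<^sub>0 int) set" where
  "bar_set n G = {c. Poly_Mapping.keys c \<subseteq> {gs. length gs = n \<and> set gs \<subseteq> carrier G}}"

definition bar_cycles2 :: "('g, 'm) monoid_scheme \<Rightarrow> ('g list \<Rightarrow>\<^sub>0 int) set" where
  "bar_cycles2 G = {c \<in> bar_set 2 G. bar_boundary G c = 0}"

lemma bar_chains_eq: "bar_chains n G = addgrp (bar_set n G)"
  by (simp add: bar_chains_def free_Abelian_group_addgrp bar_set_def)

lemma addsub_bar_set: "addsub (bar_set n G)"
  unfolding bar_set_def by (rule addsub_keys)

lemma bar_set_0: "0 \<in> bar_set n G"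
  by (rule addsub_zero[OF addsub_bar_set])

lemma frag_of_bar_set [simp]: "frag_of gs \<in> bar_set n G \<longleftrightarrow> length gs = n \<and> set gs \<subseteq> carrier G"
  by (simp add: bar_set_def)

lemma bar_set_mono: "T \<subseteq> carrier G \<Longrightarrow> c \<in> bar_set n (G\<lparr>carrier := T\<rparr>) \<Longrightarrow> c \<in> bar_set n G"
  unfolding bar_set_def by fastforce

lemma bar_boundary_0 [simp]: "bar_boundary G 0 = 0"
  and bar_boundary_diff: "bar_boundary G (a - b) = bar_boundary G a - bar_boundary G b"
  and bar_boundary_add: "bar_boundary G (a + b) = bar_boundary G a + bar_boundary G b"
  and bar_boundary_minus: "bar_boundary G (- a) = - bar_boundary G a"
  and bar_boundary_cmul: "bar_boundary G (frag_cmul k a) = frag_cmul k (bar_boundary G a)"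
  by (simp_all add: bar_boundary_def frag_extend_diff frag_extend_add frag_extend_minus frag_extend_cmul)

lemma bar_boundary_frag_of:
  "bar_boundary G (frag_of [g]) = 0"
  "bar_boundary G (frag_of [g, h]) = frag_of [h] - frag_of [g \<otimes>\<^bsub>G\<^esub> h] + frag_of [g]"
  "bar_boundary G (frag_of [a, b, c]) =
     frag_of [b, c] - frag_of [a \<otimes>\<^bsub>G\<^esub> b, c] + frag_of [a, b \<otimes>\<^bsub>G\<^esub> c] - frag_of [a, b]"
  by (simp_all add: bar_boundary_def bar_face_def atMost_Suc numeral_2_eq_2 numeral_3_eq_3)

lemma bar_boundary_carrier [simp]: "bar_boundary (G\<lparr>carrier := T\<rparr>) = bar_boundary G"
proof -
  have "bar_face (G\<lparr>carrier := T\<rparr>) = bar_face G" by (intro ext) (simp add: bar_face_def)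
  then show ?thesis by (simp add: bar_boundary_def cong: if_cong)
qed

lemma bar_set_induct1 [consumes 1, case_names zero one diff]:
  assumes "c \<in> bar_set 1 G" "P 0" "\<And>g. g \<in> carrier G \<Longrightarrow> P (frag_of [g])"
    and "\<And>a b. P a \<Longrightarrow> P b \<Longrightarrow> P (a - b)"
  shows "P c"
  by (rule frag_induction[of c "{gs. length gs = 1 \<and> set gs \<subseteq> carrier G}"])
     (use assms in \<open>auto simp: bar_set_def length_Suc_conv\<close>)

lemma bar_set_induct2 [consumes 1, case_names zero one diff]:
  assumes "c \<in> bar_set 2 G" "P 0"
    and "\<And>g h. g \<in> carrier G \<Longrightarrow> h \<in> carrier G \<Longrightarrow> P (frag_of [g, h])"
    and "\<And>a b. a \<in> bar_set 2 G \<Longrightarrow> b \<in> bar_set 2 G \<Longrightarrow> P a \<Longrightarrow> P b \<Longrightarrow> P (a - b)"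
  shows "P c"
proof -
  have "c \<in> bar_set 2 G \<and> P c"
    by (rule frag_induction[of c "{gs. length gs = 2 \<and> set gs \<subseteq> carrier G}"])
       (use assms in \<open>auto simp: bar_set_0 numeral_2_eq_2 length_Suc_conv intro: addsub_diff[OF addsub_bar_set]\<close>,
        use assms(1) in \<open>auto simp: bar_set_def numeral_2_eq_2 length_Suc_conv\<close>)
  then show ?thesis ..
qed

lemma bar_boundaries_eq: "bar_boundaries n G = bar_boundary G ` bar_set (Suc n) G"
  by (simp add: bar_boundaries_def bar_chains_eq)

lemma addsub_bar_boundaries: "addsub (bar_boundaries n G)"
  unfolding bar_boundaries_eq by (intro addsub_image addsub_bar_set bar_boundary_diff)

text \<open>The induction rule by which a function additive on products descends to first
  homology.\<close>

lemma bar_boundaries1_least: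
  assumes "addsub D"
    and "\<And>g h. g \<in> carrier G \<Longrightarrow> h \<in> carrier G \<Longrightarrow> frag_of [h] - frag_of [g \<otimes>\<^bsub>G\<^esub> h] + frag_of [g] \<in> D"
    and b: "b \<in> bar_boundaries 1 G"
  shows "b \<in> D"
proof -
  obtain c where c: "c \<in> bar_set 2 G" and b: "b = bar_boundary G c"
    using b by (auto simp: bar_boundaries_eq numeral_2_eq_2)
  from c have "bar_boundary G c \<in> D"
    by (induction c rule: bar_set_induct2)
       (use assms(1,2) in \<open>auto simp: bar_boundary_frag_of bar_boundary_diff intro: addsub_zero addsub_diff\<close>)
  then show ?thesis by (simp add: b)
qed

text \<open>The condition on generators is the 2-cocycle identity, so evaluation of a 2-cocycle
  descends to chains modulo boundaries.\<close>

lemma bar_boundaries2_least: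
  assumes "addsub D"
    and "\<And>x y z. x \<in> carrier G \<Longrightarrow> y \<in> carrier G \<Longrightarrow> z \<in> carrier G \<Longrightarrow>
      frag_of [y, z] - frag_of [x \<otimes>\<^bsub>G\<^esub> y, z] + frag_of [x, y \<otimes>\<^bsub>G\<^esub> z] - frag_of [x, y] \<in> D"
    and b: "b \<in> bar_boundaries 2 G"
  shows "b \<in> D"
proof -
  obtain c where c: "c \<in> bar_set 3 G" and b: "b = bar_boundary G c"
    using b by (auto simp: bar_boundaries_eq numeral_2_eq_2 numeral_3_eq_3)
  have "bar_boundary G c \<in> D"
    by (rule frag_induction[of c "{gs. length gs = 3 \<and> set gs \<subseteq> carrier G}"])
       (use assms c in \<open>auto simp: bar_set_def bar_boundary_frag_of bar_boundary_diff numeral_3_eq_3 length_Suc_conv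
          intro: addsub_zero addsub_diff\<close>)
  then show ?thesis by (simp add: b)
qed

lemma bar_boundaries1I:
  "g \<in> carrier G \<Longrightarrow> h \<in> carrier G \<Longrightarrow> frag_of [h] - frag_of [g \<otimes>\<^bsub>G\<^esub> h] + frag_of [g] \<in> bar_boundaries 1 G"
  unfolding bar_boundaries_eq
  by (rule image_eqI[of _ _ "frag_of [g, h]"]) (auto simp: bar_boundary_frag_of)

lemma bar_boundaries2I:
  "x \<in> carrier G \<Longrightarrow> y \<in> carrier G \<Longrightarrow> z \<in> carrier G \<Longrightarrow>
    frag_of [y, z] - frag_of [x \<otimes>\<^bsub>G\<^esub> y, z] + frag_of [x, y \<otimes>\<^bsub>G\<^esub> z] - frag_of [x, y] \<in> bar_boundaries 2 G"
  unfolding bar_boundaries_eq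
  by (rule image_eqI[of _ _ "frag_of [x, y, z]"]) (auto simp: bar_boundary_frag_of)

lemma bar_boundary_frag_extend1:
  assumes "c \<in> bar_set 2 G" "\<And>g h. g \<in> carrier G \<Longrightarrow> h \<in> carrier G \<Longrightarrow> f (g \<otimes>\<^bsub>G\<^esub> h) = f g \<otimes>\<^bsub>H\<^esub> f h"
  shows "bar_boundary H (frag_extend (\<lambda>gs. frag_of (map f gs)) c) =
    frag_extend (\<lambda>gs. frag_of (map f gs)) (bar_boundary G c)"
  using assms(1)
  by (induction c rule: bar_set_induct2)
     (auto simp: bar_boundary_frag_of bar_boundary_diff frag_extend_diff frag_extend_add assms(2))

lemma frag_extend_map_bar_set:
  assumes "c \<in> bar_set n G" "f ` carrier G \<subseteq> carrier H"
  shows "frag_extend (\<lambda>gs. frag_of (map f gs)) c \<in> bar_set n H"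
  by (rule frag_extend_in_addsub[OF _ addsub_bar_set, where S = "{gs. length gs = n \<and> set gs \<subseteq> carrier G}"])
     (use assms in \<open>auto simp: bar_set_def\<close>)

context group
begin

lemma bar_boundaries1_subset: "bar_boundaries 1 G \<subseteq> bar_set 1 G"
proof
  fix b assume "b \<in> bar_boundaries 1 G"
  then show "b \<in> bar_set 1 G"
    by (rule bar_boundaries1_least[OF addsub_bar_set, rotated])
       (intro addsub_diff addsub_add addsub_bar_set, auto)
qed

lemma addsub_bar_cycles2: "addsub (bar_cycles2 G)"
  unfolding bar_cycles2_def
  by (auto simp: addsub_def bar_set_0 bar_boundary_diff intro: addsub_diff[OF addsub_bar_set])

lemma bar_boundaries2_subset: "bar_boundaries 2 G \<subseteq> bar_cycles2 G"
proof
  fix b assume "b \<in> bar_boundaries 2 G"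
  then show "b \<in> bar_cycles2 G"
  proof (rule bar_boundaries2_least[OF addsub_bar_cycles2, rotated])
    fix x y z assume "x \<in> carrier G" "y \<in> carrier G" "z \<in> carrier G"
    then have "frag_of [y, z] - frag_of [x \<otimes> y, z] + frag_of [x, y \<otimes> z] - frag_of [x, y] \<in> bar_set 2 G"
      by (intro addsub_diff addsub_add addsub_bar_set) auto
    then show "frag_of [y, z] - frag_of [x \<otimes> y, z] + frag_of [x, y \<otimes> z] - frag_of [x, y] \<in> bar_cycles2 G"
      using \<open>x \<in> carrier G\<close> \<open>y \<in> carrier G\<close> \<open>z \<in> carrier G\<close>
      by (simp add: bar_cycles2_def bar_boundary_diff bar_boundary_add bar_boundary_frag_of m_assoc)
  qed
qed

sublocale H1: frag_addquot "bar_set 1 G" "bar_boundaries 1 G"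
  by unfold_locales (auto simp: addsub_bar_set addsub_bar_boundaries subsetD[OF bar_boundaries1_subset, simplified])

sublocale H2: frag_addquot "bar_cycles2 G" "bar_boundaries 2 G"
  by unfold_locales (auto simp: addsub_bar_cycles2 addsub_bar_boundaries subsetD[OF bar_boundaries2_subset])

lemma bar_boundary_bar_set1: "c \<in> bar_set 1 G \<Longrightarrow> bar_boundary G c = 0"
  by (induction c rule: bar_set_induct1) (auto simp: bar_boundary_frag_of bar_boundary_diff)

lemma group_homology1_eq: "group_homology 1 G = addgrp (bar_set 1 G) Mod bar_boundaries 1 G"
proof -
  have "{c \<in> bar_set 1 G. bar_boundary G c = 0} = bar_set 1 G"
    using bar_boundary_bar_set1 by blast
  then show ?thesis
    by (simp add: group_homology_def bar_chains_eq addgrp_def)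
qed

lemma group_homology2_eq: "group_homology 2 G = addgrp (bar_cycles2 G) Mod bar_boundaries 2 G"
  by (simp add: group_homology_def bar_chains_eq bar_cycles2_def addgrp_def)

lemma H1_mult:
  "g \<in> carrier G \<Longrightarrow> h \<in> carrier G \<Longrightarrow> frag_of [g \<otimes> h] - frag_of [g] - frag_of [h] \<in> bar_boundaries 1 G"
  using addsub_minus[OF addsub_bar_boundaries bar_boundaries1I[of g G h]] by (simp add: algebra_simps)

lemma H1_one: "frag_of [\<one>] \<in> bar_boundaries 1 G"
  using addsub_minus[OF addsub_bar_boundaries H1_mult[of \<one> \<one>]] by simp

lemma H1_inv:
  assumes "g \<in> carrier G" shows "frag_of [inv g] + frag_of [g] \<in> bar_boundaries 1 G"
  using addsub_diff[OF addsub_bar_boundaries H1_one H1_mult[of "inv g" g]] assms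
  by (simp add: add.commute)

end

section \<open>Products over free abelian groups\<close>

text \<open>The counterpart of \<open>frag_extend\<close> for values in a multiplicative group;
  \<open>extension_delta_chain\<close> has this shape, with the cocycle of the section as
  \<open>f\<close>.\<close>

definition frag_prod :: "('b, 'm) monoid_scheme \<Rightarrow> ('x \<Rightarrow> 'b) \<Rightarrow> ('x \<Rightarrow>\<^sub>0 int) \<Rightarrow> 'b" where
  "frag_prod K f c = finprod K (\<lambda>x. f x [^]\<^bsub>K\<^esub> Poly_Mapping.lookup c x) (Poly_Mapping.keys c)"

context comm_group
begin

lemma frag_prod_superset:
  assumes "f ` S \<subseteq> carrier G" "finite A" "Poly_Mapping.keys c \<subseteq> A" "A \<subseteq> S"
  shows "frag_prod G f c = finprod G (\<lambda>x. f x [^] Poly_Mapping.lookup c x) A"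
  unfolding frag_prod_def
  by (rule finprod_mono_neutral_cong_left) (use assms in \<open>auto simp: in_keys_iff intro!: int_pow_closed\<close>)

lemma frag_prod_closed:
  "f ` S \<subseteq> carrier G \<Longrightarrow> Poly_Mapping.keys c \<subseteq> S \<Longrightarrow> frag_prod G f c \<in> carrier G"
  unfolding frag_prod_def by (rule finprod_closed) (auto simp: image_subset_iff subset_iff)

lemma frag_prod_0: "frag_prod G f 0 = \<one>"
  by (simp add: frag_prod_def)

lemma frag_prod_frag_of: "f x \<in> carrier G \<Longrightarrow> frag_prod G f (frag_of x) = f x"
  by (simp add: frag_prod_def)

lemma frag_prod_add:
  assumes f: "f ` S \<subseteq> carrier G" and "Poly_Mapping.keys a \<subseteq> S" "Poly_Mapping.keys b \<subseteq> S"
  shows "frag_prod G f (a + b) = frag_prod G f a \<otimes> frag_prod G f b"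
proof -
  let ?A = "Poly_Mapping.keys a \<union> Poly_Mapping.keys b"
  have A: "finite ?A" "?A \<subseteq> S" using assms by auto
  have "frag_prod G f (a + b) = finprod G (\<lambda>x. f x [^] Poly_Mapping.lookup (a + b) x) ?A"
    by (rule frag_prod_superset[OF f A(1) keys_add A(2)])
  also have "\<dots> = finprod G (\<lambda>x. f x [^] Poly_Mapping.lookup a x \<otimes> f x [^] Poly_Mapping.lookup b x) ?A"
    by (rule finprod_cong) (use A f in \<open>auto simp: lookup_add image_subset_iff subset_iff simp_implies_def intro!: int_pow_mult int_pow_closed\<close>)
  also have "\<dots> = finprod G (\<lambda>x. f x [^] Poly_Mapping.lookup a x) ?A \<otimes>
      finprod G (\<lambda>x. f x [^] Poly_Mapping.lookup b x) ?A"
    by (rule finprod_multf) (use A f in \<open>auto simp: image_subset_iff subset_iff intro!: int_pow_closed\<close>)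
  also have "\<dots> = frag_prod G f a \<otimes> frag_prod G f b"
    using frag_prod_superset[OF f A(1) _ A(2)] by simp
  finally show ?thesis .
qed

lemma frag_prod_diff:
  assumes f: "f ` S \<subseteq> carrier G" and a: "Poly_Mapping.keys a \<subseteq> S" and b: "Poly_Mapping.keys b \<subseteq> S"
  shows "frag_prod G f (a - b) = frag_prod G f a \<otimes> inv frag_prod G f b"
proof -
  have ab: "Poly_Mapping.keys (a - b) \<subseteq> S" using a b keys_diff[of a b] by blast
  have "frag_prod G f a = frag_prod G f (a - b) \<otimes> frag_prod G f b"
    using frag_prod_add[OF f ab b] by simp
  then show ?thesis
    using frag_prod_closed[OF f] a b ab by (simp add: m_assoc)
qed

end

section \<open>Central extensions\<close>

lemma (in group) mult_swap:
  assumes "a \<in> carrier G" "s \<in> carrier G" "b \<in> carrier G" "r \<in> carrier G" "b \<otimes> s = s \<otimes> b"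
  shows "(a \<otimes> s) \<otimes> (b \<otimes> r) = a \<otimes> b \<otimes> (s \<otimes> r)"
proof -
  have "(a \<otimes> s) \<otimes> (b \<otimes> r) = a \<otimes> ((s \<otimes> b) \<otimes> r)" using assms by (simp add: m_assoc)
  also have "\<dots> = a \<otimes> b \<otimes> (s \<otimes> r)" using assms by (simp only: assms(5)[symmetric]) (simp add: m_assoc)
  finally show ?thesis .
qed

lemma (in comm_group) cancel_three:
  assumes "a \<in> carrier G" "b \<in> carrier G" "c \<in> carrier G"
  shows "c \<otimes> (b \<otimes> inv (a \<otimes> b \<otimes> c) \<otimes> a) = \<one>"
proof -
  have "c \<otimes> (b \<otimes> i \<otimes> a) = (a \<otimes> b \<otimes> c) \<otimes> i" if "i \<in> carrier G" for i
    using assms that by (simp add: m_ac)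
  then show ?thesis using assms by simp
qed

lemma (in comm_group) mult_inv_eq_one:
  assumes "x \<in> carrier G" "y \<in> carrier G" "u \<in> carrier G" "v \<in> carrier G"
    and "x \<otimes> u = \<one>" "y \<otimes> v = \<one>"
  shows "x \<otimes> inv y \<otimes> (u \<otimes> inv v) = \<one>"
proof -
  have "x \<otimes> inv y \<otimes> (u \<otimes> inv v) = (x \<otimes> u) \<otimes> inv (y \<otimes> v)"
    using assms(1-4) by (simp add: m_ac inv_mult)
  then show ?thesis using assms by simp
qed

lemma frag_cmul_diff2: "frag_cmul k (a - b) = frag_cmul k a - frag_cmul k b"
  by (rule poly_mapping_eqI) (simp add: lookup_minus algebra_simps)

locale central_extension = G: group G + P: group P for G (structure) and P (structure) +
  fixes \<psi>
  assumes hom: "\<psi> \<in> hom G P" and surj: "\<psi> ` carrier G = carrier P"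
    and central: "\<And>k g. k \<in> carrier G \<Longrightarrow> \<psi> k = \<one>\<^bsub>P\<^esub> \<Longrightarrow> g \<in> carrier G \<Longrightarrow> k \<otimes>\<^bsub>G\<^esub> g = g \<otimes>\<^bsub>G\<^esub> k"
begin

sublocale \<psi>: group_hom G P \<psi>
  by unfold_locales (rule hom)

abbreviation K where "K \<equiv> kernel G P \<psi>"
abbreviation GK where "GK \<equiv> G\<lparr>carrier := K\<rparr>"

definition sec where "sec = inv_into (carrier G) \<psi>"
definition cocycle where "cocycle p q = sec p \<otimes>\<^bsub>G\<^esub> sec q \<otimes>\<^bsub>G\<^esub> inv\<^bsub>G\<^esub> sec (p \<otimes>\<^bsub>P\<^esub> q)"

lemma sec: "p \<in> carrier P \<Longrightarrow> sec p \<in> carrier G" "p \<in> carrier P \<Longrightarrow> \<psi> (sec p) = p"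
  unfolding sec_def using surj by (auto intro: inv_into_into f_inv_into_f)

lemma K_iff: "k \<in> K \<longleftrightarrow> k \<in> carrier G \<and> \<psi> k = \<one>\<^bsub>P\<^esub>"
  by (simp add: kernel_def)

lemma subgroup_K: "subgroup K G"
  by (rule \<psi>.subgroup_kernel)

lemma comm_group_K: "comm_group GK"
  by (rule group.group_comm_groupI[OF G.subgroup_imp_group[OF subgroup_K]])
     (auto simp: K_iff intro: central)

sublocale K: comm_group GK
  by (rule comm_group_K)

lemma inv_K: "k \<in> K \<Longrightarrow> inv\<^bsub>GK\<^esub> k = inv\<^bsub>G\<^esub> k"
  by (rule G.m_inv_consistent[OF subgroup_K])

lemma cocycle: "p \<in> carrier P \<Longrightarrow> q \<in> carrier P \<Longrightarrow> cocycle p q \<in> K"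
  by (simp add: K_iff cocycle_def sec \<psi>.hom_inv)

lemma sec_mult:
  assumes "p \<in> carrier P" "q \<in> carrier P"
  shows "sec p \<otimes>\<^bsub>G\<^esub> sec q = cocycle p q \<otimes>\<^bsub>G\<^esub> sec (p \<otimes>\<^bsub>P\<^esub> q)"
  using assms by (simp add: cocycle_def sec G.m_assoc)

text \<open>Both sides are the central factor obtained by collecting s(p) s(q) s(r) into a multiple
  of s(p q r), once for each bracketing. Centrality moves \<open>cocycle q r\<close> past
  s(p).\<close>

lemma cocycle_assoc:
  assumes p: "p \<in> carrier P" and q: "q \<in> carrier P" and r: "r \<in> carrier P"
  shows "cocycle p q \<otimes>\<^bsub>G\<^esub> cocycle (p \<otimes>\<^bsub>P\<^esub> q) r = cocycle q r \<otimes>\<^bsub>G\<^esub> cocycle p (q \<otimes>\<^bsub>P\<^esub> r)"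
proof -
  have c: "cocycle x y \<in> carrier G" "\<psi> (cocycle x y) = \<one>\<^bsub>P\<^esub>"
    if "x \<in> carrier P" "y \<in> carrier P" for x y
    using cocycle[OF that] by (simp_all add: K_iff)
  let ?s = "sec (p \<otimes>\<^bsub>P\<^esub> q \<otimes>\<^bsub>P\<^esub> r)"
  have s: "?s \<in> carrier G" using p q r by (simp add: sec)
  have "(cocycle p q \<otimes>\<^bsub>G\<^esub> cocycle (p \<otimes>\<^bsub>P\<^esub> q) r) \<otimes>\<^bsub>G\<^esub> ?s = (sec p \<otimes>\<^bsub>G\<^esub> sec q) \<otimes>\<^bsub>G\<^esub> sec r"
    using p q r by (simp add: sec_mult G.m_assoc sec c)
  also have "\<dots> = sec p \<otimes>\<^bsub>G\<^esub> (cocycle q r \<otimes>\<^bsub>G\<^esub> sec (q \<otimes>\<^bsub>P\<^esub> r))"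
    using p q r by (simp add: sec_mult[symmetric] G.m_assoc sec)
  also have "\<dots> = cocycle q r \<otimes>\<^bsub>G\<^esub> (sec p \<otimes>\<^bsub>G\<^esub> sec (q \<otimes>\<^bsub>P\<^esub> r))"
    using p q r central[of "cocycle q r" "sec p"] by (simp add: G.m_assoc[symmetric] sec c)
  also have "\<dots> = (cocycle q r \<otimes>\<^bsub>G\<^esub> cocycle p (q \<otimes>\<^bsub>P\<^esub> r)) \<otimes>\<^bsub>G\<^esub> ?s"
    using p q r by (simp add: sec_mult[of p "q \<otimes>\<^bsub>P\<^esub> r"] G.m_assoc P.m_assoc sec c)
  finally show ?thesis using s p q r by (simp add: c)
qed

section \<open>The map \<delta> on bar 2-chains and on homology classes\<close>

abbreviation \<delta> where "\<delta> \<equiv> extension_delta_chain G P \<psi>"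

abbreviation cocycle_fun where "cocycle_fun \<equiv> (\<lambda>gs. cocycle (gs ! 0) (gs ! 1))"
abbreviation pairs where "pairs \<equiv> {gs. length gs = 2 \<and> set gs \<subseteq> carrier P}"

lemma pairsD: "gs \<in> pairs \<Longrightarrow> gs ! 0 \<in> carrier P \<and> gs ! 1 \<in> carrier P"
  by (auto simp: numeral_2_eq_2 length_Suc_conv)

lemma cocycle_fun: "cocycle_fun ` pairs \<subseteq> carrier GK"
  using pairsD cocycle by auto

lemma delta_eq:
  assumes "c \<in> bar_set 2 P" shows "\<delta> c = frag_prod GK cocycle_fun c"
  unfolding extension_delta_chain_def frag_prod_def Let_def sec_def[symmetric]
  by (rule K.finprod_cong)
     (use assms pairsD cocycle in \<open>auto simp: bar_set_def cocycle_def[symmetric] simp_implies_def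
       G.int_pow_consistent[OF subgroup_K] subset_iff intro!: K.int_pow_closed[simplified]\<close>)

lemma delta_closed: "c \<in> bar_set 2 P \<Longrightarrow> \<delta> c \<in> K"
  using K.frag_prod_closed[OF cocycle_fun, of c] by (simp add: delta_eq) (simp add: bar_set_def)

lemma delta_carrier: "c \<in> bar_set 2 P \<Longrightarrow> \<delta> c \<in> carrier G"
  using delta_closed by (auto simp: K_iff)

lemma delta_0: "\<delta> 0 = \<one>\<^bsub>G\<^esub>"
  by (simp add: delta_eq bar_set_0 K.frag_prod_0)

lemma delta_frag_of:
  "p \<in> carrier P \<Longrightarrow> q \<in> carrier P \<Longrightarrow> \<delta> (frag_of [p, q]) = cocycle p q"
  by (simp add: delta_eq K.frag_prod_frag_of cocycle)

lemma delta_diff: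
  assumes "a \<in> bar_set 2 P" "b \<in> bar_set 2 P"
  shows "\<delta> (a - b) = \<delta> a \<otimes>\<^bsub>G\<^esub> inv\<^bsub>G\<^esub> \<delta> b"
proof -
  have "\<delta> (a - b) = \<delta> a \<otimes>\<^bsub>GK\<^esub> inv\<^bsub>GK\<^esub> \<delta> b"
    using K.frag_prod_diff[OF cocycle_fun, of a b] assms addsub_diff[OF addsub_bar_set assms]
    by (simp add: delta_eq) (simp add: bar_set_def)
  then show ?thesis using inv_K delta_closed[OF assms(2)] by simp
qed

lemma delta_minus:
  assumes "a \<in> bar_set 2 P" shows "\<delta> (- a) = inv\<^bsub>G\<^esub> \<delta> a"
  using delta_diff[OF bar_set_0 assms] delta_carrier[OF assms] by (simp add: delta_0)

lemma delta_add:
  assumes "a \<in> bar_set 2 P" "b \<in> bar_set 2 P"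
  shows "\<delta> (a + b) = \<delta> a \<otimes>\<^bsub>G\<^esub> \<delta> b"
  using delta_diff[OF assms(1) addsub_minus[OF addsub_bar_set assms(2)]] assms
  by (simp add: delta_minus delta_carrier)

lemma delta_boundary:
  assumes "b \<in> bar_boundaries 2 P" shows "b \<in> bar_set 2 P" "\<delta> b = \<one>\<^bsub>G\<^esub>"
proof -
  have "addsub {c \<in> bar_set 2 P. \<delta> c = \<one>\<^bsub>G\<^esub>}"
    unfolding addsub_def by (auto simp: bar_set_0 delta_0 delta_diff intro: addsub_diff[OF addsub_bar_set])
  then have "b \<in> {c \<in> bar_set 2 P. \<delta> c = \<one>\<^bsub>G\<^esub>}"
  proof (rule bar_boundaries2_least[OF _ _ assms])
    fix x y z assume x: "x \<in> carrier P" and y: "y \<in> carrier P" and z: "z \<in> carrier P"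
    let ?c = "frag_of [y, z] - frag_of [x \<otimes>\<^bsub>P\<^esub> y, z] + frag_of [x, y \<otimes>\<^bsub>P\<^esub> z] - frag_of [x, y]"
    have mem: "frag_of [y, z] - frag_of [x \<otimes>\<^bsub>P\<^esub> y, z] \<in> bar_set 2 P"
      "frag_of [y, z] - frag_of [x \<otimes>\<^bsub>P\<^esub> y, z] + frag_of [x, y \<otimes>\<^bsub>P\<^esub> z] \<in> bar_set 2 P"
      "?c \<in> bar_set 2 P"
      using x y z by (auto intro!: addsub_diff addsub_add addsub_bar_set)
    have cc: "cocycle a b \<in> carrier G" "cocycle a b \<in> K" if "a \<in> carrier P" "b \<in> carrier P" for a b
      using cocycle[OF that] by (simp_all add: K_iff)
    have "\<delta> ?c = cocycle y z \<otimes>\<^bsub>G\<^esub> inv\<^bsub>G\<^esub> cocycle (x \<otimes>\<^bsub>P\<^esub> y) z \<otimes>\<^bsub>G\<^esub> cocycle x (y \<otimes>\<^bsub>P\<^esub> z) \<otimes>\<^bsub>G\<^esub> inv\<^bsub>G\<^esub> cocycle x y"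
      using mem x y z by (simp add: delta_diff delta_add delta_frag_of)
    also have "\<dots> = (cocycle y z \<otimes>\<^bsub>G\<^esub> cocycle x (y \<otimes>\<^bsub>P\<^esub> z)) \<otimes>\<^bsub>G\<^esub> inv\<^bsub>G\<^esub> (cocycle x y \<otimes>\<^bsub>G\<^esub> cocycle (x \<otimes>\<^bsub>P\<^esub> y) z)"
      using x y z central[of "inv\<^bsub>G\<^esub> cocycle (x \<otimes>\<^bsub>P\<^esub> y) z" "cocycle x (y \<otimes>\<^bsub>P\<^esub> z)"] cc(2)
      by (simp add: G.inv_mult_group G.m_assoc cc(1) K_iff \<psi>.hom_inv)
    also have "\<dots> = \<one>\<^bsub>G\<^esub>"
      using cocycle_assoc[OF x y z] x y z by (simp add: cc)
    finally show "?c \<in> {c \<in> bar_set 2 P. \<delta> c = \<one>\<^bsub>G\<^esub>}" using mem by simp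
  qed
  then show "b \<in> bar_set 2 P" "\<delta> b = \<one>\<^bsub>G\<^esub>" by simp_all
qed

lemma extension_delta:
  assumes "z \<in> bar_set 2 P"
  shows "extension_delta G P \<psi> (acoset (bar_boundaries 2 P) z) = \<delta> z"
  unfolding extension_delta_def
  by (rule the_elem_acoset)
     (use assms in \<open>auto simp: delta_add delta_boundary delta_carrier addsub_bar_boundaries\<close>)

subsection \<open>Restriction to a subgroup of the quotient\<close>

context
  fixes T
  assumes T: "subgroup T P"
begin

abbreviation T' where "T' \<equiv> {g \<in> carrier G. \<psi> g \<in> T}"
abbreviation GT where "GT \<equiv> G\<lparr>carrier := T'\<rparr>"
abbreviation PT where "PT \<equiv> P\<lparr>carrier := T\<rparr>"

lemma T_carrier: "p \<in> T \<Longrightarrow> p \<in> carrier P"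
  using subgroup.subset[OF T] by blast

lemma K_subset_T': "k \<in> K \<Longrightarrow> k \<in> T'"
  using subgroup.one_closed[OF T] by (simp add: K_iff)

lemma subgroup_T': "subgroup T' G"
  by (rule G.subgroupI)
     (use subgroup.m_closed[OF T] subgroup.m_inv_closed[OF T] subgroup.one_closed[OF T]
       in \<open>auto simp: \<psi>.hom_inv intro!: exI[of _ "\<one>\<^bsub>G\<^esub>"]\<close>)

interpretation GT: group GT
  by (rule G.subgroup_imp_group[OF subgroup_T'])

interpretation PT: group PT
  by (rule P.subgroup_imp_group[OF T])

abbreviation B1T where "B1T \<equiv> bar_boundaries 1 GT"

lemma B1T: "addsub B1T"
  by (rule addsub_bar_boundaries)

lemma GT_mult: "g \<in> T' \<Longrightarrow> h \<in> T' \<Longrightarrow> frag_of [g \<otimes>\<^bsub>G\<^esub> h] - frag_of [g] - frag_of [h] \<in> B1T"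
  using GT.H1_mult[of g h] by simp

lemma GT_inv: "g \<in> T' \<Longrightarrow> frag_of [inv\<^bsub>G\<^esub> g] + frag_of [g] \<in> B1T"
  using GT.H1_inv[of g] G.m_inv_consistent[OF subgroup_T', of g] by simp

lemma sec_T: "p \<in> T \<Longrightarrow> sec p \<in> T'"
  using T_carrier sec by simp

abbreviation sec_chain where "sec_chain \<equiv> frag_extend (\<lambda>gs. frag_of (map sec gs))"
abbreviation psi_chain where "psi_chain \<equiv> frag_extend (\<lambda>gs. frag_of (map \<psi> gs))"

lemma delta_class_diff:
  assumes "a \<in> bar_set 2 P" "b \<in> bar_set 2 P"
  shows "frag_of [\<delta> (a - b)] - (frag_of [\<delta> a] - frag_of [\<delta> b]) \<in> B1T"
proof -
  have d: "\<delta> a \<in> T'" "\<delta> b \<in> T'" "inv\<^bsub>G\<^esub> \<delta> b \<in> T'"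
    using delta_closed[OF assms(1)] delta_closed[OF assms(2)] K_subset_T'
      subgroup.m_inv_closed[OF subgroup_T'] by blast+
  have "frag_of [\<delta> (a - b)] - (frag_of [\<delta> a] - frag_of [\<delta> b]) =
     (frag_of [\<delta> a \<otimes>\<^bsub>G\<^esub> inv\<^bsub>G\<^esub> \<delta> b] - frag_of [\<delta> a] - frag_of [inv\<^bsub>G\<^esub> \<delta> b])
     + (frag_of [inv\<^bsub>G\<^esub> \<delta> b] + frag_of [\<delta> b])"
    using assms by (simp add: delta_diff)
  also have "\<dots> \<in> B1T"
    by (intro addsub_add B1T GT_mult GT_inv d)
  finally show ?thesis .
qed

text \<open>In the abelianized preimage of T, the factor s(p) s(q) s(p q)^-1 becomes [s(p)] + [s(q)]
  - [s(p q)], which is the section applied to the boundary of [p | q].\<close>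

lemma delta_class:
  assumes "c \<in> bar_set 2 PT"
  shows "frag_of [\<delta> c] - sec_chain (bar_boundary P c) \<in> B1T"
  using assms
proof (induction c rule: bar_set_induct2)
  case zero
  then show ?case using GT.H1_one by (simp add: delta_0)
next
  case (one p q)
  then have p: "p \<in> carrier P" "q \<in> carrier P" "p \<in> T" "q \<in> T" "p \<otimes>\<^bsub>P\<^esub> q \<in> T"
    using T_carrier subgroup.m_closed[OF T] by auto
  have k: "cocycle p q \<in> T'" using cocycle[of p q] p K_subset_T' by blast
  have s: "sec p \<in> T'" "sec q \<in> T'" "sec (p \<otimes>\<^bsub>P\<^esub> q) \<in> T'" using p sec_T by blast+
  have "frag_of [\<delta> (frag_of [p, q])] - sec_chain (bar_boundary P (frag_of [p, q])) =
     (frag_of [sec p \<otimes>\<^bsub>G\<^esub> sec q] - frag_of [sec p] - frag_of [sec q]) -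
     (frag_of [cocycle p q \<otimes>\<^bsub>G\<^esub> sec (p \<otimes>\<^bsub>P\<^esub> q)] - frag_of [cocycle p q] - frag_of [sec (p \<otimes>\<^bsub>P\<^esub> q)])"
    using p by (simp add: delta_frag_of sec_mult bar_boundary_frag_of frag_extend_diff frag_extend_add)
  also have "\<dots> \<in> B1T"
    by (intro addsub_diff B1T GT_mult k s)
  finally show ?case .
next
  case (diff a b)
  have "a \<in> bar_set 2 P" "b \<in> bar_set 2 P"
    using diff bar_set_mono[OF subgroup.subset[OF T]] by blast+
  note ab = delta_class_diff[OF this]
  have "(frag_of [\<delta> (a - b)] - (frag_of [\<delta> a] - frag_of [\<delta> b])) +
     ((frag_of [\<delta> a] - sec_chain (bar_boundary P a)) - (frag_of [\<delta> b] - sec_chain (bar_boundary P b))) \<in> B1T"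
    by (rule addsub_add[OF B1T ab addsub_diff[OF B1T]]) (use diff in auto)
  then show ?case by (simp add: bar_boundary_diff frag_extend_diff algebra_simps)
qed

text \<open>Used twice: for the stabilizer it makes the value of \<open>T_star\<close> independent
  of the lift, and for T the whole group it puts \<delta> of every cycle into the commutator
  subgroup.\<close>

lemma delta_class_cycle:
  assumes "c \<in> bar_set 2 PT" "bar_boundary P c = 0"
  shows "frag_of [\<delta> c] \<in> B1T"
  using delta_class[OF assms(1)] assms(2) by simp

text \<open>Each g factors as k s(\<psi> g) with k in the kernel; modulo boundaries the kernel
  factors of a whole chain multiply up to a single k.\<close>

lemma chain_split:
  assumes "c \<in> bar_set 1 GT"
  shows "\<exists>k\<in>K. c - sec_chain (psi_chain c) - frag_of [k] \<in> B1T"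
  using assms
proof (induction c rule: bar_set_induct1)
  case zero
  have "0 - sec_chain (psi_chain 0) - frag_of [\<one>\<^bsub>G\<^esub>] \<in> B1T"
    using addsub_minus[OF B1T GT.H1_one] by simp
  then show ?case using subgroup.one_closed[OF subgroup_K] by blast
next
  case (one g)
  then have g: "g \<in> carrier G" "\<psi> g \<in> T" "\<psi> g \<in> carrier P" using T_carrier by auto
  define k where "k = g \<otimes>\<^bsub>G\<^esub> inv\<^bsub>G\<^esub> sec (\<psi> g)"
  have k: "k \<in> K" using g by (simp add: k_def K_iff sec \<psi>.hom_inv)
  have "k \<otimes>\<^bsub>G\<^esub> sec (\<psi> g) = g" using g by (simp add: k_def G.m_assoc sec)
  then have "frag_of [g] - sec_chain (psi_chain (frag_of [g])) - frag_of [k] \<in> B1T"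
    using GT_mult[OF K_subset_T'[OF k] sec_T[OF g(2)]] by (simp add: algebra_simps)
  then show ?case using k by blast
next
  case (diff a b)
  then obtain k k' where k: "k \<in> K" "a - sec_chain (psi_chain a) - frag_of [k] \<in> B1T"
    and k': "k' \<in> K" "b - sec_chain (psi_chain b) - frag_of [k'] \<in> B1T" by blast
  have i: "inv\<^bsub>G\<^esub> k' \<in> K" by (rule subgroup.m_inv_closed[OF subgroup_K k'(1)])
  have "(a - sec_chain (psi_chain a) - frag_of [k]) - (b - sec_chain (psi_chain b) - frag_of [k'])
     - (frag_of [k \<otimes>\<^bsub>G\<^esub> inv\<^bsub>G\<^esub> k'] - frag_of [k] - frag_of [inv\<^bsub>G\<^esub> k'])
     - (frag_of [inv\<^bsub>G\<^esub> k'] + frag_of [k']) \<in> B1T"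
    by (intro addsub_diff B1T k k' GT_mult GT_inv K_subset_T' i)
  then have "a - b - sec_chain (psi_chain (a - b)) - frag_of [k \<otimes>\<^bsub>G\<^esub> inv\<^bsub>G\<^esub> k'] \<in> B1T"
    by (simp add: frag_extend_diff algebra_simps)
  then show ?case using subgroup.m_closed[OF subgroup_K k(1) i] by blast
qed

text \<open>Exactness of K \<rightarrow> H_1(GT) \<rightarrow> H_1(PT) in the middle. If the image
  of c bounds w, then by \<open>delta_class\<close> the section part of c is also the class of an
  element of the kernel, namely \<delta> w.\<close>

lemma chain_in_K:
  assumes c: "c \<in> bar_set 1 GT" and "psi_chain c \<in> bar_boundaries 1 PT"
  shows "\<exists>k\<in>K. c - frag_of [k] \<in> B1T"
proof -
  obtain w where w: "w \<in> bar_set 2 PT" "psi_chain c = bar_boundary P w"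
    using assms(2) by (auto simp: bar_boundaries_eq numeral_2_eq_2)
  obtain k where k: "k \<in> K" "c - sec_chain (psi_chain c) - frag_of [k] \<in> B1T"
    using chain_split[OF c] by blast
  have d: "\<delta> w \<in> K" using w bar_set_mono[OF subgroup.subset[OF T]] delta_closed by blast
  have "(c - sec_chain (psi_chain c) - frag_of [k]) - (frag_of [\<delta> w] - sec_chain (bar_boundary P w))
      - (frag_of [k \<otimes>\<^bsub>G\<^esub> \<delta> w] - frag_of [k] - frag_of [\<delta> w]) \<in> B1T"
    by (intro addsub_diff B1T k GT_mult K_subset_T' d delta_class w)
  then have "c - frag_of [k \<otimes>\<^bsub>G\<^esub> \<delta> w] \<in> B1T"
    using w by (simp add: algebra_simps)
  then show ?thesis using subgroup.m_closed[OF subgroup_K k(1) d] by blast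
qed

end

subsection \<open>Exactness at the kernel\<close>

abbreviation kpart where "kpart g \<equiv> g \<otimes>\<^bsub>G\<^esub> inv\<^bsub>G\<^esub> sec (\<psi> g)"
abbreviation kpart_prod where "kpart_prod \<equiv> frag_prod GK (\<lambda>gs. kpart (gs ! 0))"

lemma kpart: "g \<in> carrier G \<Longrightarrow> kpart g \<in> K"
  by (simp add: K_iff sec \<psi>.hom_inv)

text \<open>\<open>kpart\<close> is a 1-cochain on G with values in the kernel, and its coboundary
  is, up to sign, the pullback of the cocycle along \<psi>.\<close>

lemma kpart_mult:
  assumes g: "g \<in> carrier G" and h: "h \<in> carrier G"
  shows "kpart (g \<otimes>\<^bsub>G\<^esub> h) = kpart g \<otimes>\<^bsub>G\<^esub> kpart h \<otimes>\<^bsub>G\<^esub> cocycle (\<psi> g) (\<psi> h)"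
proof -
  have s: "sec (\<psi> g) \<in> carrier G" "sec (\<psi> h) \<in> carrier G" using g h by (simp_all add: sec)
  have k: "kpart h \<in> carrier G" "\<psi> (kpart h) = \<one>\<^bsub>P\<^esub>" using kpart[OF h] by (simp_all add: K_iff)
  have eq: "kpart x \<otimes>\<^bsub>G\<^esub> sec (\<psi> x) = x" if "x \<in> carrier G" for x
    using that by (simp add: G.m_assoc sec)
  have "(kpart g \<otimes>\<^bsub>G\<^esub> sec (\<psi> g)) \<otimes>\<^bsub>G\<^esub> (kpart h \<otimes>\<^bsub>G\<^esub> sec (\<psi> h)) =
      kpart g \<otimes>\<^bsub>G\<^esub> kpart h \<otimes>\<^bsub>G\<^esub> (sec (\<psi> g) \<otimes>\<^bsub>G\<^esub> sec (\<psi> h))"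
    by (rule G.mult_swap) (use g h s k central[OF k s(1)] in simp_all)
  then have "g \<otimes>\<^bsub>G\<^esub> h = kpart g \<otimes>\<^bsub>G\<^esub> kpart h \<otimes>\<^bsub>G\<^esub> (sec (\<psi> g) \<otimes>\<^bsub>G\<^esub> sec (\<psi> h))"
    using eq g h by simp
  then have "kpart (g \<otimes>\<^bsub>G\<^esub> h) = kpart g \<otimes>\<^bsub>G\<^esub> kpart h \<otimes>\<^bsub>G\<^esub> (sec (\<psi> g) \<otimes>\<^bsub>G\<^esub> sec (\<psi> h)) \<otimes>\<^bsub>G\<^esub> inv\<^bsub>G\<^esub> sec (\<psi> (g \<otimes>\<^bsub>G\<^esub> h))"
    by (rule arg_cong)
  also have "\<dots> = kpart g \<otimes>\<^bsub>G\<^esub> kpart h \<otimes>\<^bsub>G\<^esub> cocycle (\<psi> g) (\<psi> h)"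
    unfolding cocycle_def using g h s by (subst G.m_assoc) (simp_all add: sec)
  finally show ?thesis .
qed

lemma kpart_prod_in: "(\<lambda>gs. kpart (gs ! 0)) ` {gs. length gs = 1 \<and> set gs \<subseteq> carrier G} \<subseteq> carrier GK"
  using kpart by (auto simp: length_Suc_conv)

lemma kpart_prod_diff:
  assumes "a \<in> bar_set 1 G" "b \<in> bar_set 1 G"
  shows "kpart_prod (a - b) = kpart_prod a \<otimes>\<^bsub>GK\<^esub> inv\<^bsub>GK\<^esub> kpart_prod b"
    and "kpart_prod (a + b) = kpart_prod a \<otimes>\<^bsub>GK\<^esub> kpart_prod b"
    and "kpart_prod a \<in> K"
  using K.frag_prod_diff[OF kpart_prod_in, of a b] K.frag_prod_add[OF kpart_prod_in, of a b]
    K.frag_prod_closed[OF kpart_prod_in, of a] assms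
  by (simp_all add: bar_set_def)

lemma kpart_prod_frag_of: "g \<in> carrier G \<Longrightarrow> kpart_prod (frag_of [g]) = kpart g"
  using K.frag_prod_frag_of[of "\<lambda>gs. kpart (gs ! 0)" "[g]"] kpart[of g] by simp

text \<open>Since the pulled back cocycle is a coboundary, evaluating it on a chain of G amounts to
  evaluating \<open>kpart\<close> on the boundary of that chain.\<close>

lemma delta_psi_chain:
  assumes "w \<in> bar_set 2 G"
  shows "\<delta> (psi_chain w) \<otimes>\<^bsub>GK\<^esub> kpart_prod (bar_boundary G w) = \<one>\<^bsub>GK\<^esub>"
  using assms
proof (induction w rule: bar_set_induct2)
  case zero
  then show ?case by (simp add: delta_0 K.frag_prod_0)
next
  case (one g h)
  have k: "kpart g \<in> carrier GK" "kpart h \<in> carrier GK" "cocycle (\<psi> g) (\<psi> h) \<in> carrier GK"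
    using one kpart cocycle by simp_all
  have "kpart_prod (bar_boundary G (frag_of [g, h])) =
      kpart h \<otimes>\<^bsub>GK\<^esub> inv\<^bsub>GK\<^esub> kpart (g \<otimes>\<^bsub>G\<^esub> h) \<otimes>\<^bsub>GK\<^esub> kpart g"
    using one by (simp only: bar_boundary_frag_of) (simp add: kpart_prod_diff addsub_diff[OF addsub_bar_set] kpart_prod_frag_of)
  also have "kpart (g \<otimes>\<^bsub>G\<^esub> h) = kpart g \<otimes>\<^bsub>GK\<^esub> kpart h \<otimes>\<^bsub>GK\<^esub> cocycle (\<psi> g) (\<psi> h)"
    using kpart_mult[OF one] by simp
  finally have eq: "kpart_prod (bar_boundary G (frag_of [g, h])) = kpart h \<otimes>\<^bsub>GK\<^esub>
     inv\<^bsub>GK\<^esub> (kpart g \<otimes>\<^bsub>GK\<^esub> kpart h \<otimes>\<^bsub>GK\<^esub> cocycle (\<psi> g) (\<psi> h)) \<otimes>\<^bsub>GK\<^esub> kpart g" .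
  have d: "\<delta> (psi_chain (frag_of [g, h])) = cocycle (\<psi> g) (\<psi> h)" using one by (simp add: delta_frag_of)
  show ?case unfolding d eq by (rule K.cancel_three[OF k])
next
  case (diff a b)
  have mem: "psi_chain a \<in> bar_set 2 P" "psi_chain b \<in> bar_set 2 P"
    using diff by (auto intro!: frag_extend_map_bar_set)
  have bm: "bar_boundary G a \<in> bar_set 1 G" "bar_boundary G b \<in> bar_set 1 G"
    using diff G.bar_boundaries1_subset by (auto simp: bar_boundaries_eq numeral_2_eq_2)
  have k: "\<delta> (psi_chain a) \<in> carrier GK" "\<delta> (psi_chain b) \<in> carrier GK"
    "kpart_prod (bar_boundary G a) \<in> carrier GK" "kpart_prod (bar_boundary G b) \<in> carrier GK"
    using mem bm delta_closed kpart_prod_diff(3) by simp_all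
  have d: "\<delta> (psi_chain (a - b)) = \<delta> (psi_chain a) \<otimes>\<^bsub>GK\<^esub> inv\<^bsub>GK\<^esub> \<delta> (psi_chain b)"
    using mem inv_K[OF delta_closed[OF mem(2)]] by (simp add: frag_extend_diff delta_diff)
  have e: "kpart_prod (bar_boundary G (a - b)) =
      kpart_prod (bar_boundary G a) \<otimes>\<^bsub>GK\<^esub> inv\<^bsub>GK\<^esub> kpart_prod (bar_boundary G b)"
    unfolding bar_boundary_diff by (rule kpart_prod_diff[OF bm])
  show ?case unfolding d e using diff by (intro K.mult_inv_eq_one k)
qed

text \<open>Exactness of the 5-term sequence at the kernel: a 2-chain of G bounding [k] is pushed
  down to P, where it is almost a cycle.\<close>

lemma delta_surj_on_boundaries:
  assumes k: "k \<in> K" and "frag_of [k] \<in> bar_boundaries 1 G"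
  shows "\<exists>z\<in>bar_cycles2 P. \<delta> z = k"
proof -
  obtain w where w: "w \<in> bar_set 2 G" "frag_of [k] = bar_boundary G w"
    using assms(2) by (auto simp: bar_boundaries_eq numeral_2_eq_2)
  have kG: "k \<in> carrier G" "\<psi> k = \<one>\<^bsub>P\<^esub>" using k by (simp_all add: K_iff)
  have mem: "psi_chain w \<in> bar_set 2 P" "frag_of [\<one>\<^bsub>P\<^esub>, \<one>\<^bsub>P\<^esub>] \<in> bar_set 2 P"
    using w by (auto intro!: frag_extend_map_bar_set)
  \<comment> \<open>The image of w in P has boundary [1], and so has [1 | 1]. The correction matters
    for \<delta> as well, because the section need not send 1 to 1: the cocycle at (1, 1) is s(1),
    which cancels the s(1)^-1 in \<open>kpart k\<close>.\<close>
  let ?z = "frag_of [\<one>\<^bsub>P\<^esub>, \<one>\<^bsub>P\<^esub>] - psi_chain w" and ?s = "sec \<one>\<^bsub>P\<^esub>"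
  have "bar_boundary P (psi_chain w) = psi_chain (bar_boundary G w)"
    by (rule bar_boundary_frag_extend1[OF w(1)]) simp
  also have "\<dots> = frag_of [\<one>\<^bsub>P\<^esub>]" by (simp add: w(2)[symmetric] kG)
  finally have z: "?z \<in> bar_cycles2 P"
    using mem by (simp add: bar_cycles2_def bar_boundary_diff bar_boundary_frag_of addsub_diff[OF addsub_bar_set])
  have s: "?s \<in> carrier G" by (simp add: sec)
  have mem_K: "\<delta> (psi_chain w) \<in> carrier GK" "kpart k \<in> carrier GK"
    using kpart[OF kG(1)] delta_closed[OF mem(1)] by simp_all
  have prod: "\<delta> (psi_chain w) \<otimes>\<^bsub>GK\<^esub> kpart k = \<one>\<^bsub>GK\<^esub>"
    using delta_psi_chain[OF w(1)] kpart_prod_frag_of[OF kG(1)] w(2) by simp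
  have "inv\<^bsub>GK\<^esub> \<delta> (psi_chain w) = kpart k"
    by (rule K.inv_equality[OF HOL.trans[OF K.m_comm[OF mem_K(2,1)] prod] mem_K])
  then have "inv\<^bsub>G\<^esub> \<delta> (psi_chain w) = kpart k"
    using inv_K[OF delta_closed[OF mem(1)]] by simp
  then have "\<delta> ?z = cocycle \<one>\<^bsub>P\<^esub> \<one>\<^bsub>P\<^esub> \<otimes>\<^bsub>G\<^esub> kpart k"
    using mem by (simp add: delta_diff delta_frag_of)
  also have "\<dots> = ?s \<otimes>\<^bsub>G\<^esub> (k \<otimes>\<^bsub>G\<^esub> inv\<^bsub>G\<^esub> ?s)"
    using s kG by (simp add: cocycle_def G.m_assoc)
  also have "\<dots> = (k \<otimes>\<^bsub>G\<^esub> ?s) \<otimes>\<^bsub>G\<^esub> inv\<^bsub>G\<^esub> ?s"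
    by (simp only: central[OF kG s] G.m_assoc s kG G.inv_closed)
  also have "\<dots> = k"
    using s kG by (simp add: G.m_assoc)
  finally show ?thesis using z by blast
qed

subsection \<open>Bounding the kernel of \<open>\<delta>\<close>\<close>

text \<open>Such a \<open>\<phi>\<close> trivializes the pullback to \<open>G\<close> of \<open>t\<close> times the universal \<open>2\<close>-cocycle
  \<open>(p, q) \<mapsto> [p | q]\<close> of \<open>P\<close>.\<close>

context
  fixes t :: int and \<phi>
  assumes \<phi>: "\<And>g h. g \<in> carrier G \<Longrightarrow> h \<in> carrier G \<Longrightarrow>
    \<phi> (g \<otimes>\<^bsub>G\<^esub> h) - \<phi> g - \<phi> h - frag_cmul t (frag_of [\<psi> g, \<psi> h]) \<in> bar_boundaries 2 P"
begin

abbreviation B2 where "B2 \<equiv> bar_boundaries 2 P"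
abbreviation unit_chain where "unit_chain \<equiv> frag_of [\<one>\<^bsub>P\<^esub>, \<one>\<^bsub>P\<^esub>]"

lemma B2: "addsub B2"
  by (rule addsub_bar_boundaries)

lemma unit_left: "p \<in> carrier P \<Longrightarrow> frag_of [\<one>\<^bsub>P\<^esub>, p] - unit_chain \<in> B2"
  using bar_boundaries2I[of "\<one>\<^bsub>P\<^esub>" P "\<one>\<^bsub>P\<^esub>" p] by simp

lemma phi_K:
  assumes k: "k \<in> K" and g: "g \<in> carrier G"
  shows "\<phi> (k \<otimes>\<^bsub>G\<^esub> g) - \<phi> k - \<phi> g - frag_cmul t unit_chain \<in> B2"
proof -
  have kG: "k \<in> carrier G" "\<psi> k = \<one>\<^bsub>P\<^esub>" using k by (simp_all add: K_iff)
  have "(\<phi> (k \<otimes>\<^bsub>G\<^esub> g) - \<phi> k - \<phi> g - frag_cmul t (frag_of [\<psi> k, \<psi> g]))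
     + frag_cmul t (frag_of [\<one>\<^bsub>P\<^esub>, \<psi> g] - unit_chain) \<in> B2"
    by (intro addsub_add B2 \<phi> kG g addsub_frag_cmul unit_left) (use g in simp)
  then show ?thesis using kG by (simp add: frag_cmul_diff2 del: minus_frag_cmul)
qed

text \<open>The bar complex is not normalized: [1 | 1] has boundary [1] and hence is not in
  \<open>B2\<close>. The shift by t [1 | 1] turns \<phi> on the kernel into a genuine homomorphism
  modulo \<open>B2\<close>.\<close>

definition phi_unit where "phi_unit k = \<phi> k + frag_cmul t unit_chain"

lemma phi_unit_mult: "k \<in> K \<Longrightarrow> k' \<in> K \<Longrightarrow> phi_unit (k \<otimes>\<^bsub>G\<^esub> k') - (phi_unit k + phi_unit k') \<in> B2"
  using phi_K[of k k'] by (simp add: phi_unit_def K_iff algebra_simps)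

lemma phi_unit_one: "phi_unit \<one>\<^bsub>G\<^esub> \<in> B2"
  using addsub_minus[OF B2 phi_unit_mult[of "\<one>\<^bsub>G\<^esub>" "\<one>\<^bsub>G\<^esub>"]] by (simp add: K_iff)

lemma phi_unit_diff:
  assumes a: "a \<in> K" and b: "b \<in> K"
  shows "phi_unit (a \<otimes>\<^bsub>G\<^esub> inv\<^bsub>G\<^esub> b) - (phi_unit a - phi_unit b) \<in> B2"
proof -
  have "a \<otimes>\<^bsub>G\<^esub> inv\<^bsub>G\<^esub> b \<in> K"
    by (intro subgroup.m_closed[OF subgroup_K] subgroup.m_inv_closed[OF subgroup_K] a b)
  moreover have "a \<otimes>\<^bsub>G\<^esub> inv\<^bsub>G\<^esub> b \<otimes>\<^bsub>G\<^esub> b = a" using a b by (simp add: K_iff G.m_assoc)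
  ultimately have "phi_unit a - (phi_unit (a \<otimes>\<^bsub>G\<^esub> inv\<^bsub>G\<^esub> b) + phi_unit b) \<in> B2"
    using phi_unit_mult[OF _ b] by metis
  then show ?thesis using addsub_minus[OF B2] by (fastforce simp: algebra_simps)
qed

text \<open>Apply \<phi> to the two sides of s(p) s(q) = c(p, q) s(p q) and compare. The values of
  \<phi> on the section collect into a function of the boundary, so on cycles t c is recovered from
  \<delta> c alone.\<close>

lemma t_times_chain:
  assumes "c \<in> bar_set 2 P"
  shows "frag_cmul t c - phi_unit (\<delta> c) + frag_extend (\<lambda>gs. \<phi> (sec (gs ! 0))) (bar_boundary P c) \<in> B2"
  using assms
proof (induction c rule: bar_set_induct2)
  case zero
  show ?case using addsub_minus[OF B2 phi_unit_one] by (simp add: delta_0)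
next
  case (one p q)
  note s = sec(1)[OF one(1)] sec(1)[OF one(2)]
  have "(\<phi> (cocycle p q \<otimes>\<^bsub>G\<^esub> sec (p \<otimes>\<^bsub>P\<^esub> q)) - \<phi> (cocycle p q) - \<phi> (sec (p \<otimes>\<^bsub>P\<^esub> q)) - frag_cmul t unit_chain)
     - (\<phi> (sec p \<otimes>\<^bsub>G\<^esub> sec q) - \<phi> (sec p) - \<phi> (sec q) - frag_cmul t (frag_of [\<psi> (sec p), \<psi> (sec q)])) \<in> B2"
    by (intro addsub_diff B2 \<phi> phi_K cocycle s one) (use one sec in simp)
  then show ?case using one
    by (simp add: delta_frag_of bar_boundary_frag_of frag_extend_add frag_extend_diff
        sec_mult[symmetric] sec(2) phi_unit_def algebra_simps)
next
  case (diff a b)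
  let ?F = "frag_extend (\<lambda>gs. \<phi> (sec (gs ! 0)))"
  have "(frag_cmul t a - phi_unit (\<delta> a) + ?F (bar_boundary P a)) - (frag_cmul t b - phi_unit (\<delta> b) + ?F (bar_boundary P b))
     - (phi_unit (\<delta> a \<otimes>\<^bsub>G\<^esub> inv\<^bsub>G\<^esub> \<delta> b) - (phi_unit (\<delta> a) - phi_unit (\<delta> b))) \<in> B2"
    by (intro addsub_diff B2 diff phi_unit_diff delta_closed)
  then show ?case using diff
    by (simp add: bar_boundary_diff frag_extend_diff frag_cmul_diff2 delta_diff algebra_simps)
qed

text \<open>On the preimage of T the defect t [\<psi> g | \<psi> h] of \<phi> consists of chains of
  T. Modulo these, \<phi> is a homomorphism there, and so it vanishes on \<delta> z as soon as the
  class of \<delta> z does.\<close>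

lemma t_times_cycle:
  assumes T: "subgroup T P" and z: "z \<in> bar_cycles2 P"
    and d: "frag_of [\<delta> z] \<in> bar_boundaries 1 (G\<lparr>carrier := {g \<in> carrier G. \<psi> g \<in> T}\<rparr>)"
  shows "\<exists>b\<in>B2. frag_cmul t z - b \<in> bar_set 2 (P\<lparr>carrier := T\<rparr>)"
proof -
  \<comment> \<open>The sum of the boundaries of P and the 2-chains of T, the subgroup modulo which
    \<phi> becomes additive.\<close>
  define D where "D = {c. \<exists>b\<in>B2. c - b \<in> bar_set 2 (P\<lparr>carrier := T\<rparr>)}"
  have D: "addsub D"
    unfolding addsub_def D_def
  proof (intro conjI ballI; clarify)
    show "\<exists>b\<in>B2. 0 - b \<in> bar_set 2 (P\<lparr>carrier := T\<rparr>)"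
      using addsub_zero[OF B2] bar_set_0 by (intro bexI[of _ 0]) auto
    fix x y b b' assume *: "b \<in> B2" "b' \<in> B2" "x - b \<in> bar_set 2 (P\<lparr>carrier := T\<rparr>)" "y - b' \<in> bar_set 2 (P\<lparr>carrier := T\<rparr>)"
    have "x - y - (b - b') = (x - b) - (y - b')" by simp
    then show "\<exists>c\<in>B2. x - y - c \<in> bar_set 2 (P\<lparr>carrier := T\<rparr>)"
      using addsub_diff[OF addsub_bar_set *(3,4)] addsub_diff[OF B2 *(1,2)] by metis
  qed
  have B2D: "b \<in> D" if "b \<in> B2" for b
    using that bar_set_0 by (auto simp: D_def intro!: bexI[of _ b])
  have TD: "c \<in> D" if "c \<in> bar_set 2 (P\<lparr>carrier := T\<rparr>)" for c
    using that addsub_zero[OF B2] by (auto simp: D_def intro!: bexI[of _ 0])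
  have one: "\<one>\<^bsub>P\<^esub> \<in> T" by (rule subgroup.one_closed[OF T])
  have "frag_of [\<delta> z] \<in> {c. frag_extend (\<lambda>gs. \<phi> (gs ! 0)) c \<in> D}"
  proof (rule bar_boundaries1_least[OF _ _ d])
    show "addsub {c. frag_extend (\<lambda>gs. \<phi> (gs ! 0)) c \<in> D}"
      by (intro addsub_vimage D frag_extend_diff)
    fix g h assume "g \<in> carrier (G\<lparr>carrier := {g \<in> carrier G. \<psi> g \<in> T}\<rparr>)" "h \<in> carrier (G\<lparr>carrier := {g \<in> carrier G. \<psi> g \<in> T}\<rparr>)"
    then have g: "g \<in> carrier G" "h \<in> carrier G" "\<psi> g \<in> T" "\<psi> h \<in> T" by auto
    have "- (\<phi> (g \<otimes>\<^bsub>G\<^esub> h) - \<phi> g - \<phi> h - frag_cmul t (frag_of [\<psi> g, \<psi> h])) - frag_cmul t (frag_of [\<psi> g, \<psi> h]) \<in> D"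
      by (intro addsub_diff addsub_minus D B2D \<phi> g TD addsub_frag_cmul) (use g in simp)
    then show "frag_of [h] - frag_of [g \<otimes>\<^bsub>G\<lparr>carrier := {g \<in> carrier G. \<psi> g \<in> T}\<rparr>\<^esub> h] + frag_of [g]
        \<in> {c. frag_extend (\<lambda>gs. \<phi> (gs ! 0)) c \<in> D}"
      by (simp add: frag_extend_add frag_extend_diff algebra_simps)
  qed
  then have "\<phi> (\<delta> z) \<in> D" by simp
  moreover have "frag_cmul t unit_chain \<in> D"
    by (intro TD addsub_frag_cmul addsub_bar_set) (simp add: one)
  ultimately have "\<phi> (\<delta> z) + frag_cmul t unit_chain \<in> D" by (rule addsub_add[OF D])
  then have "phi_unit (\<delta> z) \<in> D" by (simp add: phi_unit_def)
  moreover have "frag_cmul t z - phi_unit (\<delta> z) \<in> D"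
    using t_times_chain[of z] z by (intro B2D) (simp add: bar_cycles2_def)
  ultimately have "frag_cmul t z \<in> D" using addsub_add[OF D] by fastforce
  then show ?thesis by (simp add: D_def)
qed

end

end

section \<open>Presented groups\<close>

locale presentation =
  fixes S :: "'s set" and R :: "('s word \<times> 's word) set"
  assumes R: "R \<subseteq> lists (S \<times> UNIV) \<times> lists (S \<times> UNIV)"
begin

definition words :: "'s word set" where "words = lists (S \<times> UNIV)"

lemma words_simps [simp]:
  "[] \<in> words" "(x, b) # w \<in> words \<longleftrightarrow> x \<in> S \<and> w \<in> words"
  "u @ v \<in> words \<longleftrightarrow> u \<in> words \<and> v \<in> words"
  by (auto simp: words_def)

abbreviation cls where "cls \<equiv> word_class S R"

lemma word_eq_words: "word_eq S R u v \<Longrightarrow> u \<in> words \<and> v \<in> words"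
  by (induction rule: word_eq.induct) (use R in \<open>auto simp: words_def\<close>)

lemma word_eq_refl: "w \<in> words \<Longrightarrow> word_eq S R w w"
  unfolding words_def by (rule word_eq.refl)

lemma cls_eq_iff:
  assumes "u \<in> words" shows "cls u = cls v \<longleftrightarrow> word_eq S R u v"
proof
  assume "cls u = cls v"
  then have "word_eq S R v u" using word_eq_refl[OF assms] by (auto simp: word_class_def)
  then show "word_eq S R u v" by (rule word_eq.sym)
next
  assume "word_eq S R u v"
  then show "cls u = cls v"
    unfolding word_class_def by (blast intro: word_eq.trans word_eq.sym)
qed

lemma cls_self: "u \<in> words \<Longrightarrow> u \<in> cls u"
  by (simp add: word_class_def word_eq_refl)

lemma cls_mult:
  assumes u: "u \<in> words" and v: "v \<in> words"
  shows "cls u \<otimes>\<^bsub>presented_group S R\<^esub> cls v = cls (u @ v)"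
proof -
  have "cls (u' @ v') = cls (u @ v)" if "u' \<in> cls u" "v' \<in> cls v" for u' v'
  proof -
    have "word_eq S R (u @ v) (u' @ v')"
      using that by (intro word_eq.append) (auto simp: word_class_def)
    then show ?thesis using u v by (subst eq_commute, subst cls_eq_iff) auto
  qed
  then have "(\<Union>u'\<in>cls u. \<Union>v'\<in>cls v. cls (u' @ v')) = cls (u @ v)"
    using cls_self[OF u] cls_self[OF v] by blast
  then show ?thesis by (simp add: presented_group_def)
qed

lemma carrier_presented: "carrier (presented_group S R) = cls ` words"
  by (simp add: presented_group_def words_def)

lemma one_presented: "\<one>\<^bsub>presented_group S R\<^esub> = cls []"
  by (simp add: presented_group_def)

lemma inverse_word: "w \<in> words \<Longrightarrow> word_eq S R (rev (map (\<lambda>(x, b). (x, \<not> b)) w) @ w) []"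
proof (induction w)
  case Nil
  show ?case by (simp add: word_eq_refl)
next
  case (Cons a w)
  obtain x b where a: "a = (x, b)" by (cases a)
  let ?i = "rev (map (\<lambda>(x, b). (x, \<not> b)) w)"
  have i: "?i \<in> words" "w \<in> words" using Cons.prems by (auto simp: words_def)
  have x: "x \<in> S" using Cons.prems by (simp add: a)
  have "word_eq S R ([(x, \<not> b), (x, \<not> \<not> b)] @ w) ([] @ w)"
    by (intro word_eq.append word_eq.cancel x word_eq_refl i)
  then have "word_eq S R (?i @ ([(x, \<not> b), (x, b)] @ w)) (?i @ w)"
    by (intro word_eq.append word_eq_refl i) simp
  then have "word_eq S R (?i @ ([(x, \<not> b), (x, b)] @ w)) []"
    by (rule word_eq.trans) (rule Cons.IH[OF i(2)])
  then show ?case by (simp add: a)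
qed

lemma group_presented: "group (presented_group S R)"
proof (rule groupI)
  fix a assume "a \<in> carrier (presented_group S R)"
  then obtain w where w: "w \<in> words" "a = cls w" by (auto simp: carrier_presented)
  let ?i = "rev (map (\<lambda>(x, b). (x, \<not> b)) w)"
  have i: "?i \<in> words" using w by (auto simp: words_def)
  have "cls ?i \<otimes>\<^bsub>presented_group S R\<^esub> a = \<one>\<^bsub>presented_group S R\<^esub>"
    using inverse_word[OF w(1)] i w by (simp add: cls_mult one_presented cls_eq_iff del: rev_map)
  then show "\<exists>y\<in>carrier (presented_group S R). y \<otimes>\<^bsub>presented_group S R\<^esub> a = \<one>\<^bsub>presented_group S R\<^esub>"
    using i by (auto simp: carrier_presented)
qed (auto simp: carrier_presented cls_mult one_presented)

end

section \<open>The associated group of a quandle\<close>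

context quandle
begin

abbreviation X where "X \<equiv> carrier Q"
abbreviation e where "e \<equiv> As_gen Q"
abbreviation act where "act \<equiv> As_act Q"
abbreviation \<psi> where "\<psi> \<equiv> As_psi Q"

lemma op_closed: "x \<in> X \<Longrightarrow> y \<in> X \<Longrightarrow> x \<triangleright> y \<in> X"
  using bij[of y] by (auto simp: bij_betw_def)

lemma qop_inv:
  assumes "x \<in> X" "y \<in> X"
  shows "qop_inv Q x y \<in> X" "qop_inv Q x y \<triangleright> y = x" "qop_inv Q (x \<triangleright> y) y = x"
  using bij[OF assms(2)] assms inv_into_into[of x "\<lambda>z. z \<triangleright> y" "carrier Q"]
    f_inv_into_f[of x "\<lambda>z. z \<triangleright> y" "carrier Q"] inv_into_f_f[of "\<lambda>z. z \<triangleright> y" "carrier Q" x]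
  unfolding qop_inv_def by (auto simp: bij_betw_def)

sublocale presentation "carrier Q" "As_relations Q"
  by unfold_locales (auto simp: As_relations_def op_closed)

abbreviation C where "C \<equiv> As_class Q"

lemma C_eq: "C = cls"
  by (rule ext) (simp add: As_class_def)

sublocale As: group "As Q"
  unfolding As_def by (rule group_presented)

lemma As_carrier: "carrier (As Q) = C ` words"
  by (simp add: As_def carrier_presented C_eq)

lemma C_in: "w \<in> words \<Longrightarrow> C w \<in> carrier (As Q)"
  by (simp add: As_carrier)

lemma C_mult: "u \<in> words \<Longrightarrow> v \<in> words \<Longrightarrow> C u \<otimes>\<^bsub>As Q\<^esub> C v = C (u @ v)"
  by (simp add: As_def C_eq cls_mult)

lemma As_one: "\<one>\<^bsub>As Q\<^esub> = C []"
  by (simp add: As_def C_eq one_presented)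

lemma e_in: "x \<in> X \<Longrightarrow> e x \<in> carrier (As Q)"
  by (simp add: As_gen_def C_in)

lemma inv_e: "x \<in> X \<Longrightarrow> inv\<^bsub>As Q\<^esub> e x = C [(x, False)]"
proof (rule As.inv_equality)
  assume x: "x \<in> X"
  have "word_eq X (As_relations Q) [(x, False), (x, \<not> False)] []" by (rule word_eq.cancel[OF x])
  then have "C [(x, False), (x, True)] = C []" using x by (simp add: C_eq cls_eq_iff)
  then show "C [(x, False)] \<otimes>\<^bsub>As Q\<^esub> e x = \<one>\<^bsub>As Q\<^esub>"
    using x by (simp add: As_gen_def As_one C_mult)
qed (simp_all add: e_in C_in)

lemma C_Cons:
  assumes "y \<in> X" "w \<in> words"
  shows "C ((y, True) # w) = e y \<otimes>\<^bsub>As Q\<^esub> C w" "C ((y, False) # w) = inv\<^bsub>As Q\<^esub> e y \<otimes>\<^bsub>As Q\<^esub> C w"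
  using assms C_mult[of "[(y, True)]" w] C_mult[of "[(y, False)]" w]
  by (simp_all add: inv_e) (simp add: As_gen_def)

lemma As_induct [consumes 1, case_names one gen inv]:
  assumes "g \<in> carrier (As Q)" "P \<one>\<^bsub>As Q\<^esub>"
    and "\<And>y g. y \<in> X \<Longrightarrow> g \<in> carrier (As Q) \<Longrightarrow> P g \<Longrightarrow> P (e y \<otimes>\<^bsub>As Q\<^esub> g)"
    and "\<And>y g. y \<in> X \<Longrightarrow> g \<in> carrier (As Q) \<Longrightarrow> P g \<Longrightarrow> P (inv\<^bsub>As Q\<^esub> e y \<otimes>\<^bsub>As Q\<^esub> g)"
  shows "P g"
proof -
  have "P (C w)" if "w \<in> words" for w
    using that
  proof (induction w)
    case Nil
    then show ?case using assms(2) by (simp add: As_one)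
  next
    case (Cons a w)
    obtain y b where "a = (y, b)" by (cases a)
    then show ?case using Cons assms(3,4) C_in by (cases b) (auto simp: C_Cons)
  qed
  then show ?thesis using assms(1) by (auto simp: As_carrier)
qed

lemma e_mult: "x \<in> X \<Longrightarrow> y \<in> X \<Longrightarrow> e x \<otimes>\<^bsub>As Q\<^esub> e y = e y \<otimes>\<^bsub>As Q\<^esub> e (x \<triangleright> y)"
proof -
  assume x: "x \<in> X" and y: "y \<in> X"
  then have "word_eq X (As_relations Q) [(x, True), (y, True)] [(y, True), (x \<triangleright> y, True)]"
    by (intro word_eq.relation) (auto simp: As_relations_def)
  then have "C [(x, True), (y, True)] = C [(y, True), (x \<triangleright> y, True)]"
    using x y by (simp add: C_eq cls_eq_iff)
  then show ?thesis using x y by (simp add: As_gen_def C_mult op_closed)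
qed

subsection \<open>The action on the quandle\<close>

lemma word_act_closed: "x \<in> X \<Longrightarrow> w \<in> words \<Longrightarrow> word_act Q x w \<in> X"
proof (induction w arbitrary: x)
  case (Cons a w)
  obtain y b where "a = (y, b)" by (cases a)
  then show ?case using Cons by (auto simp: op_closed qop_inv)
qed simp

lemma word_act_append: "word_act Q x (u @ v) = word_act Q (word_act Q x u) v"
  by (induction u arbitrary: x) auto

lemma word_act_eq: "word_eq X (As_relations Q) u v \<Longrightarrow> x \<in> X \<Longrightarrow> word_act Q x u = word_act Q x v"
proof (induction arbitrary: x rule: word_eq.induct)
  case (append u u' v v')
  then show ?case
    using word_eq_words word_act_closed by (metis word_act_append)
next
  case (cancel y b)
  then show ?case by (auto simp: qop_inv)
next
  case (relation u v)
  then show ?case by (auto simp: As_relations_def distrib)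
qed simp_all

lemma act_C: "x \<in> X \<Longrightarrow> w \<in> words \<Longrightarrow> act x (C w) = word_act Q x w"
  unfolding As_act_def
  by (rule the_elem_image_unique)
     (use cls_self in \<open>auto simp: C_eq word_class_def word_act_eq\<close>)

lemma act_closed: "x \<in> X \<Longrightarrow> g \<in> carrier (As Q) \<Longrightarrow> act x g \<in> X"
  by (auto simp: As_carrier act_C word_act_closed)

lemma act_mult:
  "x \<in> X \<Longrightarrow> g \<in> carrier (As Q) \<Longrightarrow> h \<in> carrier (As Q) \<Longrightarrow> act x (g \<otimes>\<^bsub>As Q\<^esub> h) = act (act x g) h"
  by (auto simp: As_carrier C_mult act_C word_act_closed word_act_append)

lemma act_e: "x \<in> X \<Longrightarrow> y \<in> X \<Longrightarrow> act x (e y) = x \<triangleright> y"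
  by (simp add: As_gen_def act_C)

lemma act_one: "x \<in> X \<Longrightarrow> act x \<one>\<^bsub>As Q\<^esub> = x"
  by (simp add: As_one act_C)

lemma act_inv_e: "x \<in> X \<Longrightarrow> y \<in> X \<Longrightarrow> act x (inv\<^bsub>As Q\<^esub> e y) = qop_inv Q x y"
  by (simp add: inv_e act_C)

text \<open>Extends the defining relation from generators to all of As Q: conjugation moves e_x as
  the action moves x. It yields both the centrality of the kernel and, in a connected quandle, the
  conjugacy of all generators.\<close>

lemma e_conj:
  assumes "g \<in> carrier (As Q)" "x \<in> X"
  shows "e x \<otimes>\<^bsub>As Q\<^esub> g = g \<otimes>\<^bsub>As Q\<^esub> e (act x g)"
  using assms
proof (induction g arbitrary: x rule: As_induct)
  case one
  then show ?case by (simp add: act_one e_in)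
next
  case (gen y g)
  have "e x \<otimes>\<^bsub>As Q\<^esub> (e y \<otimes>\<^bsub>As Q\<^esub> g) = e y \<otimes>\<^bsub>As Q\<^esub> (e (x \<triangleright> y) \<otimes>\<^bsub>As Q\<^esub> g)"
    using e_mult[of x y] gen(1,2,4) by (simp add: e_in op_closed As.m_assoc[symmetric])
  also have "\<dots> = e y \<otimes>\<^bsub>As Q\<^esub> (g \<otimes>\<^bsub>As Q\<^esub> e (act (x \<triangleright> y) g))"
    using gen(3)[OF op_closed[OF gen(4,1)]] by simp
  also have "\<dots> = (e y \<otimes>\<^bsub>As Q\<^esub> g) \<otimes>\<^bsub>As Q\<^esub> e (act x (e y \<otimes>\<^bsub>As Q\<^esub> g))"
    using gen(1,2,4) by (simp add: op_closed e_in act_mult act_e act_closed As.m_assoc)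
  finally show ?case .
next
  case (inv y g)
  let ?x = "qop_inv Q x y"
  have x: "?x \<in> X" "?x \<triangleright> y = x" using inv qop_inv by auto
  have "e y \<otimes>\<^bsub>As Q\<^esub> (e x \<otimes>\<^bsub>As Q\<^esub> inv\<^bsub>As Q\<^esub> e y) = e ?x"
    using arg_cong[where f = "\<lambda>z. z \<otimes>\<^bsub>As Q\<^esub> inv\<^bsub>As Q\<^esub> e y", OF e_mult[OF x(1), of y]] x inv(1,4)
    by (simp add: e_in As.m_assoc)
  then have "e x \<otimes>\<^bsub>As Q\<^esub> inv\<^bsub>As Q\<^esub> e y = inv\<^bsub>As Q\<^esub> e y \<otimes>\<^bsub>As Q\<^esub> e ?x"
    using x inv(1,4) by (intro As.inv_solve_left[THEN iffD2]) (auto simp: e_in)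
  then have "e x \<otimes>\<^bsub>As Q\<^esub> (inv\<^bsub>As Q\<^esub> e y \<otimes>\<^bsub>As Q\<^esub> g) = inv\<^bsub>As Q\<^esub> e y \<otimes>\<^bsub>As Q\<^esub> (e ?x \<otimes>\<^bsub>As Q\<^esub> g)"
    using x inv(1,2,4) by (simp add: e_in As.m_assoc[symmetric])
  also have "\<dots> = inv\<^bsub>As Q\<^esub> e y \<otimes>\<^bsub>As Q\<^esub> (g \<otimes>\<^bsub>As Q\<^esub> e (act ?x g))"
    using inv(3)[OF x(1)] by simp
  also have "\<dots> = (inv\<^bsub>As Q\<^esub> e y \<otimes>\<^bsub>As Q\<^esub> g) \<otimes>\<^bsub>As Q\<^esub> e (act x (inv\<^bsub>As Q\<^esub> e y \<otimes>\<^bsub>As Q\<^esub> g))"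
    using x inv(1,2,4) by (simp add: e_in act_mult act_inv_e act_closed As.m_assoc)
  finally show ?case .
qed

subsection \<open>The inner automorphism group\<close>

lemma psi_apply: "x \<in> X \<Longrightarrow> \<psi> g x = act x g"
  by (simp add: As_psi_def)

lemma psi_ext: "\<psi> g \<in> extensional X"
  by (simp add: As_psi_def)

lemma psi_Bij: assumes g: "g \<in> carrier (As Q)" shows "\<psi> g \<in> Bij X"
proof -
  have "bij_betw (\<lambda>x. act x g) X X"
    by (rule bij_betw_byWitness[where f' = "\<lambda>x. act x (inv\<^bsub>As Q\<^esub> g)"])
       (use g in \<open>auto simp: act_closed act_mult[symmetric] act_one\<close>)
  then show ?thesis
    by (simp add: Bij_def As_psi_def cong: bij_betw_cong)
qed

lemma right_BijGroup_simps:
  "carrier (right_BijGroup X) = Bij X" "\<one>\<^bsub>right_BijGroup X\<^esub> = (\<lambda>x\<in>X. x)"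
  "f \<in> Bij X \<Longrightarrow> g \<in> Bij X \<Longrightarrow> f \<otimes>\<^bsub>right_BijGroup X\<^esub> g = compose X g f"
  by (simp_all add: right_BijGroup_def BijGroup_def)

lemma group_right_BijGroup: "group (right_BijGroup X)"
proof -
  interpret B: group "BijGroup X" by (rule group_BijGroup)
  show ?thesis
    by (rule groupI)
       (auto simp: right_BijGroup_def B.m_assoc intro: bexI[of _ "inv\<^bsub>BijGroup X\<^esub> _"])
qed

lemma psi_mult_right:
  assumes "g \<in> carrier (As Q)" "h \<in> carrier (As Q)"
  shows "\<psi> (g \<otimes>\<^bsub>As Q\<^esub> h) = \<psi> g \<otimes>\<^bsub>right_BijGroup X\<^esub> \<psi> h"
  unfolding right_BijGroup_simps(3)[OF psi_Bij[OF assms(1)] psi_Bij[OF assms(2)]]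
  using assms by (auto simp: compose_def As_psi_def act_mult act_closed)

lemma group_hom_right_psi: "group_hom (As Q) (right_BijGroup X) \<psi>"
  by (intro group_hom.intro group_hom_axioms.intro As.is_group group_right_BijGroup homI)
     (simp_all add: right_BijGroup_simps(1) psi_Bij psi_mult_right)

lemma psi_e: "y \<in> X \<Longrightarrow> \<psi> (e y) = right_translation Q y"
  by (auto simp: As_psi_def right_translation_def act_e)

lemma Inn_carrier: "carrier (Inn Q) = \<psi> ` carrier (As Q)"
proof -
  interpret right_psi: group_hom "As Q" "right_BijGroup X" \<psi> by (rule group_hom_right_psi)
  have tr: "right_translation Q ` X = \<psi> ` e ` X"
    by (auto simp: psi_e image_image)
  have sub: "\<psi> ` e ` X \<subseteq> carrier (right_BijGroup X)"
    using right_psi.hom_closed e_in by blast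
  have 1: "carrier (Inn Q) = generate (right_BijGroup X) (\<psi> ` e ` X)"
    using sub by (simp add: Inn_def carrier_subgroup_generated tr Int_absorb1)
  have "\<psi> g \<in> generate (right_BijGroup X) (\<psi> ` e ` X)" if "g \<in> carrier (As Q)" for g
    using that
  proof (induction g rule: As_induct)
    case one
    then show ?case by (simp add: generate.one)
  next
    case (gen y g)
    then show ?case by (simp add: e_in) (auto intro!: generate.eng intro: generate.incl)
  next
    case (inv y g)
    then show ?case by (simp add: e_in right_psi.hom_inv) (auto intro!: generate.eng intro: generate.inv)
  qed
  moreover have "generate (right_BijGroup X) (\<psi> ` e ` X) \<subseteq> \<psi> ` carrier (As Q)"
    by (rule group.generate_subgroup_incl[OF group_right_BijGroup])
       (use e_in right_psi.img_is_subgroup in auto)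
  ultimately show ?thesis unfolding 1 by blast
qed

lemma Inn_simps: "monoid.mult (Inn Q) = monoid.mult (right_BijGroup X)" "\<one>\<^bsub>Inn Q\<^esub> = \<one>\<^bsub>right_BijGroup X\<^esub>"
  by (simp_all add: Inn_def subgroup_generated_def)

sublocale Inn: group "Inn Q"
  unfolding Inn_def by (rule group.group_subgroup_generated[OF group_right_BijGroup])

lemma psi_hom: "\<psi> \<in> hom (As Q) (Inn Q)"
  by (rule homI) (simp_all add: Inn_carrier Inn_simps psi_mult_right)

lemma psi_one_iff: "g \<in> carrier (As Q) \<Longrightarrow> \<psi> g = \<one>\<^bsub>Inn Q\<^esub> \<longleftrightarrow> (\<forall>x\<in>X. act x g = x)"
  by (auto simp: Inn_simps right_BijGroup_simps As_psi_def fun_eq_iff)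

text \<open>An element acting trivially on Q commutes with every generator by
  \<open>e_conj\<close>.\<close>

lemma psi_kernel_central:
  assumes k: "k \<in> carrier (As Q)" "\<psi> k = \<one>\<^bsub>Inn Q\<^esub>" and g: "g \<in> carrier (As Q)"
  shows "k \<otimes>\<^bsub>As Q\<^esub> g = g \<otimes>\<^bsub>As Q\<^esub> k"
  using g
proof (induction g rule: As_induct)
  case one
  then show ?case using k by simp
next
  case (gen y g)
  have "k \<otimes>\<^bsub>As Q\<^esub> e y = e y \<otimes>\<^bsub>As Q\<^esub> k"
    using e_conj[OF k(1), of y] k gen psi_one_iff by simp
  then show ?case using gen k by (metis As.m_assoc As.m_closed e_in)
next
  case (inv y g)
  have "k \<otimes>\<^bsub>As Q\<^esub> e y = e y \<otimes>\<^bsub>As Q\<^esub> k"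
    using e_conj[OF k(1), of y] k inv psi_one_iff by simp
  then have "k \<otimes>\<^bsub>As Q\<^esub> inv\<^bsub>As Q\<^esub> e y = inv\<^bsub>As Q\<^esub> e y \<otimes>\<^bsub>As Q\<^esub> k"
    by (metis As.inv_closed As.inv_solve_left' As.m_assoc As.m_closed As.r_inv As.r_one e_in inv(1) k(1))
  then show ?case using inv k by (metis As.inv_closed As.m_assoc e_in)
qed

sublocale ext: central_extension "As Q" "Inn Q" \<psi>
  by (intro central_extension.intro central_extension_axioms.intro As.is_group Inn.is_group)
     (rule psi_hom Inn_carrier[symmetric] psi_kernel_central; assumption)+

subsection \<open>The degree\<close>

abbreviation deg where "deg \<equiv> As_degree"
abbreviation word_degree :: "'a word \<Rightarrow> int" where
  "word_degree w \<equiv> \<Sum>(y, b)\<leftarrow>w. if b then 1 else -1"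

lemma word_degree_eq: "word_eq X (As_relations Q) u v \<Longrightarrow> word_degree u = word_degree v"
  by (induction rule: word_eq.induct) (auto simp: As_relations_def)

lemma deg_C: "w \<in> words \<Longrightarrow> deg (C w) = word_degree w"
  unfolding As_degree_def
  by (rule the_elem_image_unique)
     (use cls_self in \<open>auto simp: C_eq word_class_def dest: word_degree_eq\<close>)

lemma deg_mult: "g \<in> carrier (As Q) \<Longrightarrow> h \<in> carrier (As Q) \<Longrightarrow> deg (g \<otimes>\<^bsub>As Q\<^esub> h) = deg g + deg h"
  by (auto simp: As_carrier C_mult deg_C)

lemma deg_one: "deg \<one>\<^bsub>As Q\<^esub> = 0"
  by (simp add: As_one deg_C)

lemma deg_e: "x \<in> X \<Longrightarrow> deg (e x) = 1"
  by (simp add: As_gen_def deg_C)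

definition deg_chain :: "('a word set list \<Rightarrow>\<^sub>0 int) \<Rightarrow> int" where
  "deg_chain c = (\<Sum>gs\<in>Poly_Mapping.keys c. Poly_Mapping.lookup c gs * As_degree (gs ! 0))"

text \<open>Writes the sum over keys as \<open>frag_extend\<close> into the free group on one
  generator, so that additivity is inherited instead of proved by comparing supports.\<close>

lemma deg_chain_frag_extend:
  "deg_chain c = Poly_Mapping.lookup (frag_extend (\<lambda>gs. frag_cmul (deg (gs ! 0)) (frag_of ())) c) ()"
  by (simp add: deg_chain_def frag_extend_def lookup_sum)

lemma deg_chain_diff: "deg_chain (a - b) = deg_chain a - deg_chain b"
  and deg_chain_add: "deg_chain (a + b) = deg_chain a + deg_chain b"
  and deg_chain_cmul: "deg_chain (frag_cmul k a) = k * deg_chain a"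
  and deg_chain_frag_of: "deg_chain (frag_of [g]) = deg g"
  and deg_chain_0: "deg_chain 0 = 0"
  by (simp_all add: deg_chain_frag_extend frag_extend_diff frag_extend_add frag_extend_cmul
      lookup_minus lookup_add)

lemma deg_chain_boundary:
  assumes "T \<subseteq> carrier (As Q)" "b \<in> bar_boundaries 1 ((As Q)\<lparr>carrier := T\<rparr>)"
  shows "deg_chain b = 0"
proof -
  have "b \<in> {c. deg_chain c = 0}"
    by (rule bar_boundaries1_least[OF _ _ assms(2)])
       (use assms(1) in \<open>auto simp: addsub_def deg_chain_0 deg_chain_diff deg_chain_add deg_chain_frag_of deg_mult subset_iff\<close>)
  then show ?thesis by simp
qed

end

section \<open>Commuting pairs and the universal cocycle\<close>

context group
begin

abbreviation B2 where "B2 \<equiv> bar_boundaries 2 G"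
abbreviation bar2 where "bar2 x y \<equiv> frag_of [x, y]"
abbreviation torus where "torus x y \<equiv> bar2 x y - bar2 y x"

lemma B2: "addsub B2"
  by (rule addsub_bar_boundaries)

lemma bar2_assoc: "x \<in> carrier G \<Longrightarrow> y \<in> carrier G \<Longrightarrow> z \<in> carrier G \<Longrightarrow>
    bar2 y z - bar2 (x \<otimes> y) z + bar2 x (y \<otimes> z) - bar2 x y \<in> B2"
  by (rule bar_boundaries2I)

lemma bar2_one_left: "x \<in> carrier G \<Longrightarrow> bar2 \<one> x - bar2 \<one> \<one> \<in> B2"
  using bar2_assoc[of \<one> \<one> x] by simp

lemma bar2_one_right: "x \<in> carrier G \<Longrightarrow> bar2 x \<one> - bar2 \<one> \<one> \<in> B2"
  using addsub_minus[OF B2 bar2_assoc[of x \<one> \<one>]] by simp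

text \<open>The boundary of [x | inv x | x], after normalizing the terms that contain 1.\<close>

lemma bar2_inv:
  assumes "x \<in> carrier G" shows "bar2 x (inv x) - bar2 (inv x) x \<in> B2"
proof -
  have "(bar2 \<one> x - bar2 \<one> \<one>) - (bar2 x \<one> - bar2 \<one> \<one>) +
    (bar2 (inv x) x - bar2 (x \<otimes> inv x) x + bar2 x (inv x \<otimes> x) - bar2 x (inv x)) \<in> B2"
    by (intro addsub_add addsub_diff B2 bar2_one_left bar2_one_right bar2_assoc) (use assms in auto)
  then have "bar2 (inv x) x - bar2 x (inv x) \<in> B2" using assms by (simp add: algebra_simps)
  then show ?thesis by (rule addsub_minus_commute[OF B2])
qed

text \<open>The shuffle of s with [a | b]: the boundaries of [a | s | b], [a | b | s] and
  [s | a | b] combined with alternating signs. The products of s with a and b cancel because they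
  commute.\<close>

lemma torus_mult:
  assumes "a \<in> carrier G" "b \<in> carrier G" "s \<in> carrier G" "a \<otimes> s = s \<otimes> a" "b \<otimes> s = s \<otimes> b"
  shows "torus (a \<otimes> b) s - torus a s - torus b s \<in> B2"
proof -
  have "(bar2 s b - bar2 (a \<otimes> s) b + bar2 a (s \<otimes> b) - bar2 a s)
     - (bar2 b s - bar2 (a \<otimes> b) s + bar2 a (b \<otimes> s) - bar2 a b)
     - (bar2 a b - bar2 (s \<otimes> a) b + bar2 s (a \<otimes> b) - bar2 s a) \<in> B2"
    by (intro addsub_diff B2 bar2_assoc assms)
  then show ?thesis by (simp add: assms(4,5) algebra_simps)
qed

lemma torus_one: "s \<in> carrier G \<Longrightarrow> torus \<one> s \<in> B2"
  using addsub_diff[OF B2 bar2_one_left bar2_one_right, of s s] by simp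

lemma torus_pow:
  assumes "a \<in> carrier G" "s \<in> carrier G" "a \<otimes> s = s \<otimes> a"
  shows "torus (a [^] (n::nat)) s - frag_cmul (int n) (torus a s) \<in> B2"
proof (induction n)
  case 0
  then show ?case using torus_one[OF assms(2)] by simp
next
  case (Suc n)
  have c: "a [^] n \<otimes> s = s \<otimes> a [^] n"
  proof (induction n)
    case (Suc n)
    have "a [^] Suc n \<otimes> s = (a [^] n \<otimes> s) \<otimes> a" using assms by (simp add: m_assoc)
    then show ?case using assms Suc by (simp add: m_assoc)
  qed (use assms in simp)
  have "(torus (a [^] n) s - frag_cmul (int n) (torus a s)) +
      (torus (a [^] n \<otimes> a) s - torus (a [^] n) s - torus a s) \<in> B2"
    by (intro addsub_add B2 Suc torus_mult c assms) (use assms in auto)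
  then show ?case by (simp add: frag_cmul_distrib algebra_simps)
qed

lemma torus_torsion:
  assumes "a \<in> carrier G" "s \<in> carrier G" "a \<otimes> s = s \<otimes> a" "a [^] (n::nat) = \<one>"
  shows "frag_cmul (int n) (torus a s) \<in> B2"
  using addsub_diff[OF B2 torus_one[OF assms(2)] torus_pow[OF assms(1-3), of n]] assms(4) by simp

end

section \<open>Splitting \<open>t\<close> times the universal cocycle over the associated group\<close>

locale pointed_quandle = quandle +
  fixes x0
  assumes x0: "x0 \<in> carrier Q" and connected: "connected_quandle Q"
begin

abbreviation P where "P \<equiv> Inn Q"
abbreviation rho where "rho y \<equiv> \<psi> (e y)"

lemma P_apply_mult:
  assumes "p \<in> carrier P" "q \<in> carrier P" "x \<in> X" shows "(p \<otimes>\<^bsub>P\<^esub> q) x = q (p x)"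
proof -
  obtain g h where g: "g \<in> carrier (As Q)" "p = \<psi> g" and h: "h \<in> carrier (As Q)" "q = \<psi> h"
    using assms by (auto simp: Inn_carrier)
  have eq: "\<psi> g \<otimes>\<^bsub>P\<^esub> \<psi> h = \<psi> (g \<otimes>\<^bsub>As Q\<^esub> h)" using g h by (simp add: ext.\<psi>.hom_mult)
  show ?thesis unfolding g(2) h(2) eq using g h assms(3) by (simp add: psi_apply act_mult act_closed del: ext.\<psi>.hom_mult)
qed

lemma P_apply_closed: "p \<in> carrier P \<Longrightarrow> x \<in> X \<Longrightarrow> p x \<in> X"
  by (auto simp: Inn_carrier psi_apply act_closed)

lemma P_apply_one: "x \<in> X \<Longrightarrow> \<one>\<^bsub>P\<^esub> x = x"
  by (simp add: Inn_simps right_BijGroup_simps)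

lemma rho_in: "y \<in> X \<Longrightarrow> rho y \<in> carrier P"
  by (simp add: Inn_carrier e_in)

lemma rho_apply: "x \<in> X \<Longrightarrow> y \<in> X \<Longrightarrow> rho y x = x \<triangleright> y"
  by (simp add: psi_apply act_e)

lemma rho_conj:
  assumes "p \<in> carrier P" "x \<in> X" shows "rho x \<otimes>\<^bsub>P\<^esub> p = p \<otimes>\<^bsub>P\<^esub> rho (p x)"
proof -
  obtain g where g: "g \<in> carrier (As Q)" "p = \<psi> g" using assms by (auto simp: Inn_carrier)
  have "\<psi> (e x \<otimes>\<^bsub>As Q\<^esub> g) = \<psi> (g \<otimes>\<^bsub>As Q\<^esub> e (act x g))" using e_conj[OF g(1) assms(2)] by simp
  then show ?thesis using g assms act_closed by (simp add: e_in psi_apply)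
qed

lemma rho_pow_apply:
  assumes "x \<in> X" "y \<in> X" shows "(rho y [^]\<^bsub>P\<^esub> n) x = ((\<lambda>z. z \<triangleright> y) ^^ n) x"
proof -
  have "((\<lambda>z. z \<triangleright> y) ^^ n) x \<in> X \<and> (rho y [^]\<^bsub>P\<^esub> n) x = ((\<lambda>z. z \<triangleright> y) ^^ n) x"
    by (induction n) (use assms in \<open>auto simp: P_apply_one P_apply_mult rho_in rho_apply op_closed\<close>)
  then show ?thesis by simp
qed

lemma rho_pow_one:
  assumes "\<And>x y. x \<in> X \<Longrightarrow> y \<in> X \<Longrightarrow> ((\<lambda>z. z \<triangleright> y) ^^ n) x = x" and y: "y \<in> X"
  shows "rho y [^]\<^bsub>P\<^esub> n = \<one>\<^bsub>P\<^esub>"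
proof (rule extensionalityI[of _ X])
  have "rho y [^]\<^bsub>P\<^esub> n \<in> carrier P" by (rule Inn.nat_pow_closed[OF rho_in[OF y]])
  then show "rho y [^]\<^bsub>P\<^esub> n \<in> extensional X" by (auto simp: Inn_carrier psi_ext)
  show "\<one>\<^bsub>P\<^esub> \<in> extensional X" by (simp add: Inn_simps right_BijGroup_simps)
  show "(rho y [^]\<^bsub>P\<^esub> n) x = \<one>\<^bsub>P\<^esub> x" if "x \<in> X" for x
    using rho_pow_apply[OF that y] assms(1)[OF that y] P_apply_one[OF that] by simp
qed

definition point :: "'a \<Rightarrow> 'a \<Rightarrow> 'a" where
  "point y = (SOME p. p \<in> carrier P \<and> p x0 = y)"

lemma point: assumes "y \<in> X" shows "point y \<in> carrier P" "point y x0 = y"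
proof -
  have "\<exists>p. p \<in> carrier P \<and> p x0 = y"
    using connected x0 assms unfolding connected_quandle_def by blast
  from someI_ex[OF this] show "point y \<in> carrier P" "point y x0 = y"
    by (simp_all add: point_def)
qed

text \<open>In the extension of P with cocycle [p | q], this is the chain b with (0, \<rho>) (0, p)
  = (0, p) (b, \<rho>'), where \<rho> = \<open>rho x0\<close> and \<rho>' =
  \<open>rho (p x0)\<close>. When p fixes x_0 it is the torus chain of \<rho> and p.\<close>

abbreviation base_chain where
  "base_chain p \<equiv> Inn.bar2 (rho x0) p - Inn.bar2 p (rho (p x0))"

text \<open>Conjugation by p q is conjugation by p followed by conjugation by q. The 3-chains are
  the three positions of the translation relative to p and q.\<close>

lemma base_chain_mult:
  assumes p: "p \<in> carrier P" and q: "q \<in> carrier P"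
  shows "base_chain (p \<otimes>\<^bsub>P\<^esub> q) - base_chain p - Inn.bar2 (rho (p x0)) q + Inn.bar2 q (rho (q (p x0))) \<in> Inn.B2"
proof -
  let ?x = "p x0" let ?y = "q ?x"
  have X: "?x \<in> X" "?y \<in> X" using p q x0 by (auto intro: P_apply_closed)
  have r: "rho x0 \<in> carrier P" "rho ?x \<in> carrier P" "rho ?y \<in> carrier P" using X x0 rho_in by auto
  have eq: "rho x0 \<otimes>\<^bsub>P\<^esub> p = p \<otimes>\<^bsub>P\<^esub> rho ?x" "rho ?x \<otimes>\<^bsub>P\<^esub> q = q \<otimes>\<^bsub>P\<^esub> rho ?y"
    using rho_conj p q x0 X by auto
  have "(Inn.bar2 p q - Inn.bar2 (rho x0 \<otimes>\<^bsub>P\<^esub> p) q + Inn.bar2 (rho x0) (p \<otimes>\<^bsub>P\<^esub> q) - Inn.bar2 (rho x0) p)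
     - (Inn.bar2 (rho ?x) q - Inn.bar2 (p \<otimes>\<^bsub>P\<^esub> rho ?x) q + Inn.bar2 p (rho ?x \<otimes>\<^bsub>P\<^esub> q) - Inn.bar2 p (rho ?x))
     + (Inn.bar2 q (rho ?y) - Inn.bar2 (p \<otimes>\<^bsub>P\<^esub> q) (rho ?y) + Inn.bar2 p (q \<otimes>\<^bsub>P\<^esub> rho ?y) - Inn.bar2 p q) \<in> Inn.B2"
    by (intro addsub_add addsub_diff Inn.B2 Inn.bar2_assoc p q r)
  then show ?thesis using p q x0 by (simp add: eq P_apply_mult algebra_simps)
qed

end

locale typed_quandle = pointed_quandle +
  fixes t :: nat
  assumes type: "x \<in> carrier Q \<Longrightarrow> y \<in> carrier Q \<Longrightarrow> ((\<lambda>z. z \<triangleright> y) ^^ t) x = x"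
begin

abbreviation tm :: "(('a \<Rightarrow> 'a) list \<Rightarrow>\<^sub>0 int) \<Rightarrow> (('a \<Rightarrow> 'a) list \<Rightarrow>\<^sub>0 int)" where
  "tm \<equiv> frag_cmul (int t)"

lemmas tm_simps = frag_cmul_diff2 frag_cmul_distrib2

text \<open>Writing p = s q with s in the stabilizer, the difference is the torus chain of
  \<open>rho x0\<close> and s, and the t-th power of \<open>rho x0\<close> is 1.\<close>

lemma base_chain_indep:
  assumes p: "p \<in> carrier P" and q: "q \<in> carrier P" and eq: "p x0 = q x0"
  shows "tm (base_chain p) - tm (base_chain q) \<in> Inn.B2"
proof -
  let ?s = "p \<otimes>\<^bsub>P\<^esub> inv\<^bsub>P\<^esub> q"
  have s: "?s \<in> carrier P" using p q by simp
  have sx: "?s x0 = x0"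
    using P_apply_mult[of q "inv\<^bsub>P\<^esub> q" x0] P_apply_mult[of p "inv\<^bsub>P\<^esub> q" x0] p q x0 eq P_apply_one by simp
  have c: "rho x0 \<otimes>\<^bsub>P\<^esub> ?s = ?s \<otimes>\<^bsub>P\<^esub> rho x0" using rho_conj[OF s x0] sx by simp
  have "?s \<otimes>\<^bsub>P\<^esub> q = p" using p q by (simp add: Inn.m_assoc)
  then have "tm (base_chain p - base_chain ?s - base_chain q) \<in> Inn.B2"
    using addsub_frag_cmul[OF Inn.B2 base_chain_mult[OF s q], of "int t"] sx eq by (simp add: algebra_simps)
  moreover have "tm (base_chain ?s) \<in> Inn.B2"
    using Inn.torus_torsion[OF rho_in[OF x0] s c rho_pow_one[OF type x0]] sx by simp
  ultimately have "tm (base_chain p - base_chain ?s - base_chain q) + tm (base_chain ?s) \<in> Inn.B2"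
    by (rule addsub_add[OF Inn.B2])
  then show ?thesis by (simp add: tm_simps del: minus_frag_cmul)
qed

text \<open>In the central extension of \<open>P\<close> by bar \<open>2\<close>-chains modulo boundaries with cocycle \<open>t [p | q]\<close>, the pair
  \<open>(gen_lift y, rho y)\<close> is the conjugate of \<open>(0, rho x0)\<close> by \<open>(0, point y)\<close>, and \<open>word_lift w\<close> is the chain
  component of the product of the lifted letters of \<open>w\<close>. The neutral element is \<open>(- t [1 | 1], 1)\<close>.\<close>

definition gen_lift :: "'a \<Rightarrow> ('a \<Rightarrow> 'a) list \<Rightarrow>\<^sub>0 int" where
  "gen_lift y = tm (base_chain (point y))"

text \<open>The lifts satisfy the defining relation of As Q. Both
  \<open>point (x \<triangleright> y)\<close> and \<open>point x\<close> followed by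
  \<open>rho y\<close> carry x_0 to the same point, so either may be used to form the lift.\<close>

lemma gen_lift_op:
  assumes x: "x \<in> X" and y: "y \<in> X"
  shows "gen_lift (x \<triangleright> y) - gen_lift x - tm (Inn.bar2 (rho x) (rho y)) + tm (Inn.bar2 (rho y) (rho (x \<triangleright> y))) \<in> Inn.B2"
proof -
  have r: "rho y \<in> carrier P" "point x \<in> carrier P" "point x \<otimes>\<^bsub>P\<^esub> rho y \<in> carrier P"
    using rho_in[OF y] point[OF x] by auto
  have ap: "(point x \<otimes>\<^bsub>P\<^esub> rho y) x0 = x \<triangleright> y"
    using r point[OF x] x y x0 by (simp add: P_apply_mult rho_apply)
  have "(tm (base_chain (point (x \<triangleright> y))) - tm (base_chain (point x \<otimes>\<^bsub>P\<^esub> rho y)))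
      + tm (base_chain (point x \<otimes>\<^bsub>P\<^esub> rho y) - base_chain (point x) - Inn.bar2 (rho (point x x0)) (rho y)
      + Inn.bar2 (rho y) (rho (rho y (point x x0)))) \<in> Inn.B2"
    by (intro addsub_add Inn.B2 base_chain_indep addsub_frag_cmul base_chain_mult r)
       (use point op_closed x y ap in simp_all)
  then show ?thesis using point[OF x] x y
    by (simp add: gen_lift_def tm_simps rho_apply algebra_simps del: minus_frag_cmul)
qed

definition letter :: "'a \<Rightarrow> bool \<Rightarrow> 'a \<Rightarrow> 'a" where
  "letter y b = (if b then rho y else inv\<^bsub>P\<^esub> rho y)"

text \<open>For an inverse letter this is the chain d solving (d, inv r) (c, r) = (- t [1 | 1], 1)
  in the extension, with r = \<open>rho y\<close> and c = \<open>gen_lift y\<close>.\<close>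

definition letter_lift :: "'a \<Rightarrow> bool \<Rightarrow> ('a \<Rightarrow> 'a) list \<Rightarrow>\<^sub>0 int" where
  "letter_lift y b = (if b then gen_lift y
     else - gen_lift y - tm (Inn.bar2 (inv\<^bsub>P\<^esub> rho y) (rho y)) - tm (Inn.bar2 \<one>\<^bsub>P\<^esub> \<one>\<^bsub>P\<^esub>))"

fun word_lift :: "'a word \<Rightarrow> ('a \<Rightarrow> 'a) list \<Rightarrow>\<^sub>0 int" where
  "word_lift [] = - tm (Inn.bar2 \<one>\<^bsub>P\<^esub> \<one>\<^bsub>P\<^esub>)"
| "word_lift ((y, b) # w) = letter_lift y b + word_lift w + tm (Inn.bar2 (letter y b) (\<psi> (C w)))"

lemma letter_in: "y \<in> X \<Longrightarrow> letter y b \<in> carrier P"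
  by (simp add: letter_def rho_in)

lemma psi_C_in: "w \<in> words \<Longrightarrow> \<psi> (C w) \<in> carrier P"
  by (simp add: Inn_carrier C_in)

lemma psi_C_Nil: "\<psi> (C []) = \<one>\<^bsub>P\<^esub>"
  using ext.\<psi>.hom_one by (simp add: As_one)

lemma psi_C_append: "u \<in> words \<Longrightarrow> v \<in> words \<Longrightarrow> \<psi> (C (u @ v)) = \<psi> (C u) \<otimes>\<^bsub>P\<^esub> \<psi> (C v)"
  using ext.\<psi>.hom_mult[of "C u" "C v"] by (simp add: C_in C_mult)

lemma psi_C_Cons: "y \<in> X \<Longrightarrow> w \<in> words \<Longrightarrow> \<psi> (C ((y, b) # w)) = letter y b \<otimes>\<^bsub>P\<^esub> \<psi> (C w)"
  by (cases b) (simp_all add: C_Cons letter_def C_in e_in ext.\<psi>.hom_inv)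

text \<open>Associativity of the extension, applied one letter at a time through the boundary of
  [letter | u | v].\<close>

lemma word_lift_append:
  assumes "u \<in> words" "v \<in> words"
  shows "word_lift (u @ v) - word_lift u - word_lift v - tm (Inn.bar2 (\<psi> (C u)) (\<psi> (C v))) \<in> Inn.B2"
  using assms(1)
proof (induction u)
  case Nil
  have "- tm (Inn.bar2 \<one>\<^bsub>P\<^esub> (\<psi> (C v)) - Inn.bar2 \<one>\<^bsub>P\<^esub> \<one>\<^bsub>P\<^esub>) \<in> Inn.B2"
    by (intro addsub_minus Inn.B2 addsub_frag_cmul Inn.bar2_one_left psi_C_in assms)
  then show ?case by (simp add: psi_C_Nil tm_simps del: minus_frag_cmul)
next
  case (Cons a u)
  obtain y b where a: "a = (y, b)" by (cases a)
  then have y: "y \<in> X" "u \<in> words" using Cons by auto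
  have "(word_lift (u @ v) - word_lift u - word_lift v - tm (Inn.bar2 (\<psi> (C u)) (\<psi> (C v))))
    + tm (Inn.bar2 (\<psi> (C u)) (\<psi> (C v)) - Inn.bar2 (letter y b \<otimes>\<^bsub>P\<^esub> \<psi> (C u)) (\<psi> (C v))
       + Inn.bar2 (letter y b) (\<psi> (C u) \<otimes>\<^bsub>P\<^esub> \<psi> (C v)) - Inn.bar2 (letter y b) (\<psi> (C u))) \<in> Inn.B2"
    by (intro addsub_add Inn.B2 Cons.IH y addsub_frag_cmul Inn.bar2_assoc letter_in psi_C_in assms)
  then show ?case using y assms
    by (simp add: a psi_C_append psi_C_Cons tm_simps algebra_simps del: minus_frag_cmul)
qed

lemma psi_C_eq: "word_eq X (As_relations Q) u v \<Longrightarrow> \<psi> (C u) = \<psi> (C v)"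
  using cls_eq_iff[of u v] word_eq_words[of u v] by (simp add: C_eq)

lemma word_lift_eq: "word_eq X (As_relations Q) u v \<Longrightarrow> word_lift u - word_lift v \<in> Inn.B2"
proof (induction rule: word_eq.induct)
  case (refl w)
  then show ?case by (simp add: addsub_zero Inn.B2)
next
  case (sym u v)
  show ?case by (rule addsub_minus_commute[OF Inn.B2 sym.IH])
next
  case (trans u v w)
  show ?case by (rule addsub_trans[OF Inn.B2 trans.IH])
next
  case (append u u' v v')
  have w: "u \<in> words" "u' \<in> words" "v \<in> words" "v' \<in> words"
    using append word_eq_words by blast+
  have "(word_lift (u @ v) - word_lift u - word_lift v - tm (Inn.bar2 (\<psi> (C u)) (\<psi> (C v))))
    - (word_lift (u' @ v') - word_lift u' - word_lift v' - tm (Inn.bar2 (\<psi> (C u')) (\<psi> (C v'))))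
    + (word_lift u - word_lift u') + (word_lift v - word_lift v') \<in> Inn.B2"
    by (intro addsub_add addsub_diff Inn.B2 word_lift_append append.IH w)
  then show ?case
    unfolding psi_C_eq[OF append.hyps(1)] psi_C_eq[OF append.hyps(2)] by (simp add: algebra_simps)
next
  case (cancel x b)
  have r: "rho x \<in> carrier P" by (rule rho_in[OF cancel])
  have C1: "\<psi> (C [(x, c)]) = letter x c" for c
    using psi_C_Cons[OF cancel, of "[]" c] letter_in[OF cancel] by (simp add: psi_C_Nil)
  show ?case
  proof (cases b)
    case True
    \<comment> \<open>\<open>letter_lift\<close> was solved for a left inverse and contains
      [inv r | r], whereas this word produces [r | inv r].\<close>
    have "tm (Inn.bar2 (rho x) (inv\<^bsub>P\<^esub> rho x) - Inn.bar2 (inv\<^bsub>P\<^esub> rho x) (rho x))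
      + tm (Inn.bar2 (inv\<^bsub>P\<^esub> rho x) \<one>\<^bsub>P\<^esub> - Inn.bar2 \<one>\<^bsub>P\<^esub> \<one>\<^bsub>P\<^esub>) \<in> Inn.B2"
      by (intro addsub_add Inn.B2 addsub_frag_cmul Inn.bar2_inv Inn.bar2_one_right r Inn.inv_closed)
    then show ?thesis using True
      by (simp add: letter_lift_def letter_def C1 psi_C_Nil tm_simps algebra_simps del: minus_frag_cmul)
  next
    case False
    have "tm (Inn.bar2 (rho x) \<one>\<^bsub>P\<^esub> - Inn.bar2 \<one>\<^bsub>P\<^esub> \<one>\<^bsub>P\<^esub>) \<in> Inn.B2"
      by (intro Inn.B2 addsub_frag_cmul Inn.bar2_one_right r)
    then show ?thesis using False
      by (simp add: letter_lift_def letter_def C1 psi_C_Nil tm_simps algebra_simps del: minus_frag_cmul)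
  qed
next
  case (relation u v)
  then obtain x y where x: "x \<in> X" and y: "y \<in> X"
    and uv: "u = [(x, True), (y, True)]" "v = [(y, True), (x \<triangleright> y, True)]"
    by (auto simp: As_relations_def)
  have r: "rho y \<in> carrier P" "rho (x \<triangleright> y) \<in> carrier P" using x y op_closed rho_in by auto
  have C1: "\<psi> (C [(z, True)]) = rho z" for z
    by (simp add: As_gen_def)
  have "tm (Inn.bar2 (rho y) \<one>\<^bsub>P\<^esub> - Inn.bar2 \<one>\<^bsub>P\<^esub> \<one>\<^bsub>P\<^esub>) - tm (Inn.bar2 (rho (x \<triangleright> y)) \<one>\<^bsub>P\<^esub> - Inn.bar2 \<one>\<^bsub>P\<^esub> \<one>\<^bsub>P\<^esub>)
    - (gen_lift (x \<triangleright> y) - gen_lift x - tm (Inn.bar2 (rho x) (rho y)) + tm (Inn.bar2 (rho y) (rho (x \<triangleright> y)))) \<in> Inn.B2"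
    by (intro addsub_diff Inn.B2 addsub_frag_cmul Inn.bar2_one_right r gen_lift_op x y)
  then show ?case
    by (simp add: uv letter_lift_def letter_def C1 psi_C_Nil tm_simps algebra_simps del: minus_frag_cmul)
qed

definition lift_chain :: "'a word set \<Rightarrow> ('a \<Rightarrow> 'a) list \<Rightarrow>\<^sub>0 int" where
  "lift_chain g = word_lift (SOME w. w \<in> g)"

lemma lift_chain_C:
  assumes "w \<in> words" shows "lift_chain (C w) - word_lift w \<in> Inn.B2"
proof -
  have "(SOME v. v \<in> C w) \<in> C w" by (rule someI[of _ w]) (use assms cls_self in \<open>simp add: C_eq\<close>)
  then have "word_eq X (As_relations Q) w (SOME v. v \<in> C w)" by (simp add: C_eq word_class_def)
  then show ?thesis unfolding lift_chain_def by (rule word_lift_eq[OF word_eq.sym])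
qed

text \<open>This makes \<open>lift_chain\<close> a function \<phi> as required for
  \<open>ext.t_times_cycle\<close>.\<close>

lemma lift_chain_mult:
  assumes "g \<in> carrier (As Q)" "h \<in> carrier (As Q)"
  shows "lift_chain (g \<otimes>\<^bsub>As Q\<^esub> h) - lift_chain g - lift_chain h - tm (Inn.bar2 (\<psi> g) (\<psi> h)) \<in> Inn.B2"
proof -
  obtain u v where u: "u \<in> words" "g = C u" and v: "v \<in> words" "h = C v"
    using assms by (auto simp: As_carrier)
  have "(lift_chain (C (u @ v)) - word_lift (u @ v)) +
    (word_lift (u @ v) - word_lift u - word_lift v - tm (Inn.bar2 (\<psi> (C u)) (\<psi> (C v))))
    - (lift_chain (C u) - word_lift u) - (lift_chain (C v) - word_lift v) \<in> Inn.B2"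
    by (intro addsub_add addsub_diff Inn.B2 lift_chain_C word_lift_append) (use u v in auto)
  then show ?thesis unfolding u(2) v(2) C_mult[OF u(1) v(1)] by (simp add: algebra_simps)
qed

end

section \<open>Eisermann's isomorphism\<close>

context pointed_quandle
begin

abbreviation N where "N \<equiv> quandle_null2 Q"

definition rack_cycles2 :: "('a \<times> 'a \<Rightarrow>\<^sub>0 int) set" where
  "rack_cycles2 = {c. Poly_Mapping.keys c \<subseteq> X \<times> X \<and> rack_boundary2 Q c = 0}"

lemma rack_boundary2_frag_of: "rack_boundary2 Q (frag_of (x, y)) = frag_of x - frag_of (x \<triangleright> y)"
  by (simp add: rack_boundary2_def)

lemma rack_boundary2_diff: "rack_boundary2 Q (a - b) = rack_boundary2 Q a - rack_boundary2 Q b"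
  and rack_boundary2_add: "rack_boundary2 Q (a + b) = rack_boundary2 Q a + rack_boundary2 Q b"
  and rack_boundary2_0: "rack_boundary2 Q 0 = 0"
  by (simp_all add: rack_boundary2_def frag_extend_diff frag_extend_add frag_extend_minus)

lemma addsub_rack_chains: "addsub {c :: 'a \<times> 'a \<Rightarrow>\<^sub>0 int. Poly_Mapping.keys c \<subseteq> X \<times> X}"
  by (rule addsub_keys)

lemma addsub_rack_cycles2: "addsub rack_cycles2"
  using addsub_rack_chains unfolding rack_cycles2_def addsub_def
  by (auto simp: rack_boundary2_0 rack_boundary2_diff)

lemma rack_boundary3_in:
  assumes "Poly_Mapping.keys c \<subseteq> X \<times> X \<times> X" "addsub D"
    and "\<And>x y z. x \<in> X \<Longrightarrow> y \<in> X \<Longrightarrow> z \<in> X \<Longrightarrow>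
      frag_of (x, z) - frag_of (x \<triangleright> y, z) - frag_of (x, y) + frag_of (x \<triangleright> z, y \<triangleright> z) \<in> D"
  shows "rack_boundary3 Q c \<in> D"
  unfolding rack_boundary3_def
  by (rule frag_extend_in_addsub[OF assms(1,2)]) (use assms(3) in auto)

lemma rack_relation_chain:
  assumes "x \<in> X" "y \<in> X" "z \<in> X"
  shows "Poly_Mapping.keys (frag_of (x, z) - frag_of (x \<triangleright> y, z) - frag_of (x, y) + frag_of (x \<triangleright> z, y \<triangleright> z)) \<subseteq> X \<times> X"
proof -
  have "frag_of (x, z) - frag_of (x \<triangleright> y, z) - frag_of (x, y) + frag_of (x \<triangleright> z, y \<triangleright> z)
      \<in> {c. Poly_Mapping.keys c \<subseteq> X \<times> X}"
    by (intro addsub_add addsub_diff addsub_rack_chains) (use assms op_closed in auto)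
  then show ?thesis by simp
qed

lemma quandle_null_gens:
  "rack_boundary3 Q ` carrier (free_Abelian_group (X \<times> X \<times> X)) \<union> {frag_of (a, a) | a. a \<in> X}
    \<subseteq> carrier (free_Abelian_group (X \<times> X))"
  using rack_boundary3_in[OF _ addsub_rack_chains] rack_relation_chain by auto

lemma N: "addsub N"
  unfolding quandle_null2_def rack_chains2_def by (rule addsub_generate_free(1)[OF quandle_null_gens])

lemma N_least:
  assumes "addsub D" "\<And>a. a \<in> X \<Longrightarrow> frag_of (a, a) \<in> D"
    and "\<And>x y z. x \<in> X \<Longrightarrow> y \<in> X \<Longrightarrow> z \<in> X \<Longrightarrow>
      frag_of (x, z) - frag_of (x \<triangleright> y, z) - frag_of (x, y) + frag_of (x \<triangleright> z, y \<triangleright> z) \<in> D"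
  shows "N \<subseteq> D"
  unfolding quandle_null2_def rack_chains2_def
  by (rule generate_free_least[OF quandle_null_gens assms(1)])
     (use assms rack_boundary3_in[OF _ assms(1,3)] in auto)

lemma N_diag: "a \<in> X \<Longrightarrow> frag_of (a, a) \<in> N"
  unfolding quandle_null2_def by (rule generate.incl) auto

lemma N_rack:
  assumes "x \<in> X" "y \<in> X" "z \<in> X"
  shows "frag_of (x, z) - frag_of (x \<triangleright> y, z) - frag_of (x, y) + frag_of (x \<triangleright> z, y \<triangleright> z) \<in> N"
  unfolding quandle_null2_def
  by (rule generate.incl, rule UnI1, rule image_eqI[of _ _ "frag_of (x, y, z)"])
     (use assms in \<open>auto simp: rack_boundary3_def\<close>)

lemma N_subset: "N \<subseteq> rack_cycles2"
  by (rule N_least[OF addsub_rack_cycles2])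
     (use rack_relation_chain in \<open>auto simp: rack_cycles2_def rack_boundary2_diff rack_boundary2_add
       rack_boundary2_frag_of idem distrib\<close>)

sublocale HQ: frag_addquot rack_cycles2 N
  by unfold_locales (use N addsub_rack_cycles2 N_subset in auto)

lemma quandle_homology2_eq: "quandle_homology2 Q = addgrp rack_cycles2 Mod N"
proof -
  have eq: "{c \<in> carrier (rack_chains2 Q). rack_boundary2 Q c = 0} = rack_cycles2"
    by (auto simp: rack_chains2_def rack_cycles2_def)
  show ?thesis
    unfolding quandle_homology2_def eq unfolding rack_chains2_def free_Abelian_group_addgrp(2) ..
qed

abbreviation eis where "eis \<equiv> eisermann_word Q"

lemma eis_append: "eis x (u @ v) = eis x u + eis (word_act Q x u) v"
  by (induction u arbitrary: x) auto

lemma eis_chain: "x \<in> X \<Longrightarrow> w \<in> words \<Longrightarrow>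
    Poly_Mapping.keys (eis x w) \<subseteq> X \<times> X \<and> rack_boundary2 Q (eis x w) = frag_of x - frag_of (word_act Q x w)"
proof (induction w arbitrary: x)
  case Nil
  then show ?case by (simp add: rack_boundary2_0)
next
  case (Cons a w)
  obtain y b where a: "a = (y, b)" by (cases a)
  then have y: "y \<in> X" "w \<in> words" using Cons by auto
  define x' where "x' = (if b then x \<triangleright> y else qop_inv Q x y)"
  have x': "x' \<in> X" using Cons y qop_inv op_closed by (simp add: x'_def)
  have IH: "eis x' w \<in> {c. Poly_Mapping.keys c \<subseteq> X \<times> X}"
    "rack_boundary2 Q (eis x' w) = frag_of x' - frag_of (word_act Q x' w)"
    using Cons.IH[OF x' y(2)] by auto
  have "(if b then frag_of (x, y) else - frag_of (x', y)) + eis x' w \<in> {c. Poly_Mapping.keys c \<subseteq> X \<times> X}"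
    by (rule addsub_add[OF addsub_rack_chains _ IH(1)]) (use Cons.prems(1) y x' in auto)
  then have "Poly_Mapping.keys (eis x (a # w)) \<subseteq> X \<times> X"
    by (cases b) (simp_all add: a x'_def)
  then show ?case
    using IH(2) Cons.prems(1) y qop_inv(2)
    by (cases b) (auto simp: a x'_def rack_boundary2_add rack_boundary2_diff rack_boundary2_frag_of)
qed

lemma eis_eq: "word_eq X (As_relations Q) u v \<Longrightarrow> x \<in> X \<Longrightarrow> eis x u - eis x v \<in> N"
proof (induction arbitrary: x rule: word_eq.induct)
  case (refl w)
  then show ?case by (simp add: addsub_zero[OF N])
next
  case (sym u v)
  show ?case by (rule addsub_minus_commute[OF N sym.IH[OF sym.prems]])
next
  case (trans u v w)
  show ?case by (rule addsub_trans[OF N trans.IH[OF trans.prems]])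
next
  case (append u u' v v')
  have "word_act Q x u \<in> X" using append word_eq_words word_act_closed by blast
  then have "(eis x u - eis x u') + (eis (word_act Q x u) v - eis (word_act Q x u) v') \<in> N"
    by (intro addsub_add N append.IH append.prems)
  then show ?case
    using word_act_eq[OF append.hyps(1) append.prems] by (simp add: eis_append algebra_simps)
next
  case (cancel y b)
  then show ?case by (cases b) (auto simp: qop_inv addsub_zero[OF N])
next
  case (relation u v)
  then obtain y z where "y \<in> X" "z \<in> X"
    and uv: "u = [(y, True), (z, True)]" "v = [(z, True), (y \<triangleright> z, True)]"
    by (auto simp: As_relations_def)
  then show ?case
    using addsub_minus[OF N N_rack[OF relation.prems, of y z]] by (simp add: algebra_simps)
qed

definition eisg :: "'a \<Rightarrow> 'a word set \<Rightarrow> ('a \<times> 'a \<Rightarrow>\<^sub>0 int)" where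
  "eisg x g = eis x (SOME w. w \<in> g)"

lemma eisg_C:
  assumes "x \<in> X" "w \<in> words" shows "eisg x (C w) - eis x w \<in> N"
proof -
  have "(SOME v. v \<in> C w) \<in> C w" by (rule someI[of _ w]) (use assms cls_self in \<open>simp add: C_eq\<close>)
  then have "word_eq X (As_relations Q) w (SOME v. v \<in> C w)" by (simp add: C_eq word_class_def)
  then show ?thesis unfolding eisg_def by (rule eis_eq[OF word_eq.sym assms(1)])
qed

lemma eisg_chain:
  assumes "x \<in> X" "g \<in> carrier (As Q)"
  shows "Poly_Mapping.keys (eisg x g) \<subseteq> X \<times> X \<and> rack_boundary2 Q (eisg x g) = frag_of x - frag_of (act x g)"
proof -
  obtain w where w: "w \<in> words" "g = C w" using assms by (auto simp: As_carrier)
  let ?v = "SOME v. v \<in> C w"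
  have "?v \<in> C w" by (rule someI[of _ w]) (use w cls_self in \<open>simp add: C_eq\<close>)
  then have eq: "word_eq X (As_relations Q) w ?v" by (simp add: C_eq word_class_def)
  have "?v \<in> words" "word_act Q x ?v = word_act Q x w"
    using word_eq_words[OF eq] word_act_eq[OF eq assms(1)] by simp_all
  then show ?thesis using eis_chain[OF assms(1), of ?v] assms w by (simp add: eisg_def act_C)
qed

text \<open>A crossed homomorphism modulo \<open>N\<close>: the base point of the second factor is
  moved by the first. On the stabilizer of x_0 the base point stays put, and so it factors through
  first homology.\<close>

lemma eisg_mult:
  assumes "x \<in> X" "g \<in> carrier (As Q)" "h \<in> carrier (As Q)"
  shows "eisg x (g \<otimes>\<^bsub>As Q\<^esub> h) - eisg x g - eisg (act x g) h \<in> N"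
proof -
  obtain u v where u: "u \<in> words" "g = C u" and v: "v \<in> words" "h = C v"
    using assms by (auto simp: As_carrier)
  have "(eisg x (C (u @ v)) - eis x (u @ v)) - (eisg x (C u) - eis x u)
     - (eisg (word_act Q x u) (C v) - eis (word_act Q x u) v) \<in> N"
    by (intro addsub_diff N eisg_C assms word_act_closed u v) (use u v in simp)
  then show ?thesis
    unfolding u(2) v(2) C_mult[OF u(1) v(1)] act_C[OF assms(1) u(1)]
    by (simp add: eis_append algebra_simps)
qed

lemma eisg_one: assumes "x \<in> X" shows "eisg x \<one>\<^bsub>As Q\<^esub> \<in> N"
  using eisg_C[OF assms, of "[]"] by (simp add: As_one)

lemma eisg_inv:
  assumes "x \<in> X" "g \<in> carrier (As Q)"
  shows "eisg (act x g) (inv\<^bsub>As Q\<^esub> g) + eisg x g \<in> N"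
  using addsub_diff[OF N eisg_one[OF assms(1)] eisg_mult[OF assms As.inv_closed[OF assms(2)]]] assms
  by (simp add: algebra_simps)

lemma eisg_e: assumes "x \<in> X" "y \<in> X" shows "eisg x (e y) - frag_of (x, y) \<in> N"
  using eisg_C[OF assms(1), of "[(y, True)]"] assms(2) by (simp add: As_gen_def)

subsection \<open>The stabilizer\<close>

abbreviation St where "St \<equiv> As_stab Q x0"
abbreviation GS where "GS \<equiv> (As Q)\<lparr>carrier := St\<rparr>"
abbreviation BS where "BS \<equiv> bar_boundaries 1 GS"
abbreviation T where "T \<equiv> Inn_stab Q x0"

lemma subgroup_T: "subgroup T P"
proof (rule Inn.subgroupI)
  show "T \<subseteq> carrier P" by (auto simp: Inn_stab_def)
  show "T \<noteq> {}" using P_apply_one[OF x0] by (auto simp: Inn_stab_def)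
  show "inv\<^bsub>P\<^esub> p \<in> T" if "p \<in> T" for p
    using that P_apply_mult[of p "inv\<^bsub>P\<^esub> p" x0] x0 P_apply_one by (auto simp: Inn_stab_def)
  show "p \<otimes>\<^bsub>P\<^esub> q \<in> T" if "p \<in> T" "q \<in> T" for p q
    using that x0 by (simp add: Inn_stab_def P_apply_mult)
qed

lemma St_iff: "g \<in> St \<longleftrightarrow> g \<in> carrier (As Q) \<and> act x0 g = x0"
  by (simp add: As_stab_def)

text \<open>Puts the stabilizer into the form of a preimage under \<psi>, in which the results on
  central extensions are stated.\<close>

lemma St_eq: "St = {g \<in> carrier (As Q). \<psi> g \<in> T}"
  by (auto simp: As_stab_def Inn_stab_def Inn_carrier psi_apply x0)

lemma subgroup_St: "subgroup St (As Q)"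
  unfolding St_eq by (rule ext.subgroup_T'[OF subgroup_T])

sublocale GS: group GS
  by (rule As.subgroup_imp_group[OF subgroup_St])

lemma BS: "addsub BS"
  by (rule addsub_bar_boundaries)

lemma St_mult: "g \<in> St \<Longrightarrow> h \<in> St \<Longrightarrow> frag_of [g \<otimes>\<^bsub>As Q\<^esub> h] - frag_of [g] - frag_of [h] \<in> BS"
  using GS.H1_mult[of g h] by simp

lemma St_inv: "g \<in> St \<Longrightarrow> frag_of [inv\<^bsub>As Q\<^esub> g] + frag_of [g] \<in> BS"
  using GS.H1_inv[of g] As.m_inv_consistent[OF subgroup_St, of g] by simp

lemma e_x0_St: "e x0 \<in> St"
  using x0 by (simp add: St_iff e_in act_e idem)

lemma eisermann_chain_eq: "eisermann_chain Q x0 = frag_extend (\<lambda>gs. eisg x0 (gs ! 0))"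
  by (simp add: eisermann_chain_def eisg_def)

lemma eisermann_chain_diff: "eisermann_chain Q x0 (a - b) = eisermann_chain Q x0 a - eisermann_chain Q x0 b"
  and eisermann_chain_add: "eisermann_chain Q x0 (a + b) = eisermann_chain Q x0 a + eisermann_chain Q x0 b"
  and eisermann_chain_0: "eisermann_chain Q x0 0 = 0"
  and eisermann_chain_cmul: "eisermann_chain Q x0 (frag_cmul k a) = frag_cmul k (eisermann_chain Q x0 a)"
  and eisermann_chain_frag_of: "eisermann_chain Q x0 (frag_of [g]) = eisg x0 g"
  by (simp_all add: eisermann_chain_eq frag_extend_diff frag_extend_add frag_extend_cmul)

lemma eisermann_chain_boundary: "b \<in> BS \<Longrightarrow> eisermann_chain Q x0 b \<in> N"
proof -
  assume b: "b \<in> BS"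
  have "b \<in> {c. eisermann_chain Q x0 c \<in> N}"
  proof (rule bar_boundaries1_least[OF _ _ b])
    show "addsub {c. eisermann_chain Q x0 c \<in> N}" by (intro addsub_vimage N eisermann_chain_diff)
    fix g h assume "g \<in> carrier GS" "h \<in> carrier GS"
    then have g: "g \<in> carrier (As Q)" "act x0 g = x0" "h \<in> carrier (As Q)" by (auto simp: St_iff)
    have "- (eisg x0 (g \<otimes>\<^bsub>As Q\<^esub> h) - eisg x0 g - eisg (act x0 g) h) \<in> N"
      by (intro addsub_minus N eisg_mult x0 g)
    then show "frag_of [h] - frag_of [g \<otimes>\<^bsub>GS\<^esub> h] + frag_of [g] \<in> {c. eisermann_chain Q x0 c \<in> N}"
      using g by (simp add: eisermann_chain_diff eisermann_chain_add eisermann_chain_frag_of algebra_simps)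
  qed
  then show ?thesis by simp
qed

lemma eisermann_chain_cycle:
  assumes "c \<in> bar_set 1 GS" shows "eisermann_chain Q x0 c \<in> rack_cycles2"
  unfolding eisermann_chain_eq
proof (rule frag_extend_in_addsub[OF assms[unfolded bar_set_def mem_Collect_eq] addsub_rack_cycles2])
  fix gs assume "gs \<in> {gs. length gs = 1 \<and> set gs \<subseteq> carrier GS}"
  then have "gs ! 0 \<in> carrier (As Q)" "act x0 (gs ! 0) = x0" by (auto simp: length_Suc_conv St_iff)
  then show "eisg x0 (gs ! 0) \<in> rack_cycles2"
    using eisg_chain[OF x0, of "gs ! 0"] by (simp add: rack_cycles2_def)
qed

subsection \<open>The inverse map\<close>

definition path :: "'a \<Rightarrow> 'a word set" where
  "path x = (SOME g. g \<in> carrier (As Q) \<and> act x0 g = x)"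

lemma path: assumes "x \<in> X" shows "path x \<in> carrier (As Q)" "act x0 (path x) = x"
proof -
  have "\<exists>g. g \<in> carrier (As Q) \<and> act x0 g = x"
    using point[OF assms] psi_apply[OF x0] by (auto simp: Inn_carrier)
  from someI_ex[OF this] show "path x \<in> carrier (As Q)" "act x0 (path x) = x"
    by (simp_all add: path_def)
qed

text \<open>Closes the move from x along g into a loop at x_0 by means of the chosen paths;
  successive moves then compose, because the paths in between cancel.\<close>

definition loop :: "'a \<Rightarrow> 'a word set \<Rightarrow> 'a word set" where
  "loop x g = path x \<otimes>\<^bsub>As Q\<^esub> g \<otimes>\<^bsub>As Q\<^esub> inv\<^bsub>As Q\<^esub> path (act x g)"

lemma act_inv: "x \<in> X \<Longrightarrow> g \<in> carrier (As Q) \<Longrightarrow> act (act x g) (inv\<^bsub>As Q\<^esub> g) = x"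
  using act_mult[of x g "inv\<^bsub>As Q\<^esub> g"] by (simp add: act_one)

lemma act_inv_path: "x \<in> X \<Longrightarrow> act x (inv\<^bsub>As Q\<^esub> path x) = x0"
  using act_inv[OF x0 path(1), of x] path(2) by simp

lemma loop_St: "x \<in> X \<Longrightarrow> g \<in> carrier (As Q) \<Longrightarrow> loop x g \<in> St"
  using act_closed by (simp add: loop_def St_iff path act_mult x0 act_inv_path)

lemma loop_mult:
  assumes "x \<in> X" "g \<in> carrier (As Q)" "h \<in> carrier (As Q)"
  shows "loop x (g \<otimes>\<^bsub>As Q\<^esub> h) = loop x g \<otimes>\<^bsub>As Q\<^esub> loop (act x g) h"
proof -
  have "act x g \<in> X" "act (act x g) h \<in> X" using assms act_closed by auto
  then have p: "path x \<in> carrier (As Q)" "path (act x g) \<in> carrier (As Q)"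
    "path (act (act x g) h) \<in> carrier (As Q)" using assms path by auto
  have "inv\<^bsub>As Q\<^esub> path (act x g) \<otimes>\<^bsub>As Q\<^esub> (path (act x g) \<otimes>\<^bsub>As Q\<^esub> z) = z" if "z \<in> carrier (As Q)" for z
    using that p by (simp add: As.m_assoc[symmetric])
  then show ?thesis using assms p by (simp add: loop_def act_mult As.m_assoc)
qed

abbreviation loop_class where "loop_class x g \<equiv> frag_of [loop x g]"

lemma loop_class_mult:
  assumes "x \<in> X" "g \<in> carrier (As Q)" "h \<in> carrier (As Q)"
  shows "loop_class x (g \<otimes>\<^bsub>As Q\<^esub> h) - loop_class x g - loop_class (act x g) h \<in> BS"
  unfolding loop_mult[OF assms]
  by (intro St_mult loop_St act_closed assms)

lemma loop_class_one: assumes "x \<in> X" shows "loop_class x \<one>\<^bsub>As Q\<^esub> \<in> BS"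
  using GS.H1_one assms by (simp add: loop_def act_one path)

definition loop_chain :: "('a \<times> 'a \<Rightarrow>\<^sub>0 int) \<Rightarrow> ('a word set list \<Rightarrow>\<^sub>0 int)" where
  "loop_chain = frag_extend (\<lambda>(x, y). loop_class x (e y))"

lemma loop_chain_frag_of: "loop_chain (frag_of (x, y)) = loop_class x (e y)"
  and loop_chain_diff: "loop_chain (a - b) = loop_chain a - loop_chain b"
  and loop_chain_add: "loop_chain (a + b) = loop_chain a + loop_chain b"
  and loop_chain_0: "loop_chain 0 = 0"
  by (simp_all add: loop_chain_def frag_extend_diff frag_extend_add frag_extend_minus)

lemma loop_chain_closed: "Poly_Mapping.keys c \<subseteq> X \<times> X \<Longrightarrow> loop_chain c \<in> bar_set 1 GS"
  unfolding loop_chain_def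
  by (rule frag_extend_in_addsub[OF _ addsub_bar_set]) (auto simp: loop_St e_in)

text \<open>Multiples of [e_{x_0}] have to be discarded because the degenerate pairs (a, a), which
  vanish in quandle homology, are sent to e_{x_0}.\<close>

definition BS0 where "BS0 = {c. \<exists>n. c - frag_cmul n (frag_of [e x0]) \<in> BS}"

lemma BS0: "addsub BS0"
  unfolding addsub_def BS0_def
proof (intro conjI ballI; clarify)
  show "\<exists>n. 0 - frag_cmul n (frag_of [e x0]) \<in> BS"
    using addsub_zero[OF BS] by (intro exI[of _ 0]) simp
  fix a b n m assume "a - frag_cmul n (frag_of [e x0]) \<in> BS" "b - frag_cmul m (frag_of [e x0]) \<in> BS"
  from addsub_diff[OF BS this] show "\<exists>n. a - b - frag_cmul n (frag_of [e x0]) \<in> BS"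
    by (intro exI[of _ "n - m"]) (simp add: frag_cmul_diff_distrib algebra_simps del: minus_frag_cmul)
qed

lemma BS_BS0: "c \<in> BS \<Longrightarrow> c \<in> BS0"
  by (auto simp: BS0_def intro!: exI[of _ 0])

text \<open>A pair (a, a) gives e_{x_0} because the path to a conjugates e_{x_0} into e_a; a rack
  boundary is a relation of As Q seen from a base point.\<close>

lemma loop_chain_null: "c \<in> N \<Longrightarrow> loop_chain c \<in> BS0"
proof -
  have "N \<subseteq> {c. loop_chain c \<in> BS0}"
  proof (rule N_least)
    show "addsub {c. loop_chain c \<in> BS0}" by (intro addsub_vimage BS0 loop_chain_diff)
    fix a assume a: "a \<in> X"
    have "path a \<otimes>\<^bsub>As Q\<^esub> e a = e x0 \<otimes>\<^bsub>As Q\<^esub> path a"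
      using e_conj[OF path(1)[OF a] x0] path(2)[OF a] by simp
    then have "loop a (e a) = e x0"
      using a path(1)[OF a] x0 by (simp add: loop_def act_e idem e_in As.m_assoc)
    then show "frag_of (a, a) \<in> {c. loop_chain c \<in> BS0}"
      using addsub_zero[OF BS] by (auto simp: loop_chain_frag_of BS0_def intro!: exI[of _ 1])
  next
    fix x y z assume x: "x \<in> X" and y: "y \<in> X" and z: "z \<in> X"
    have yz: "y \<triangleright> z \<in> X" by (rule op_closed[OF y z])
    \<comment> \<open>The two sides of e_y e_z = e_z e_{y * z}, started at x, decompose into the
      four terms of the rack boundary of (x, y, z).\<close>
    have "(loop_class x (e y \<otimes>\<^bsub>As Q\<^esub> e z) - loop_class x (e y) - loop_class (act x (e y)) (e z))
       - (loop_class x (e z \<otimes>\<^bsub>As Q\<^esub> e (y \<triangleright> z)) - loop_class x (e z) - loop_class (act x (e z)) (e (y \<triangleright> z))) \<in> BS"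
      by (intro addsub_diff BS loop_class_mult x y z yz e_in)
    then show "frag_of (x, z) - frag_of (x \<triangleright> y, z) - frag_of (x, y) + frag_of (x \<triangleright> z, y \<triangleright> z) \<in> {c. loop_chain c \<in> BS0}"
      using x y z e_mult[OF y z]
      by (intro CollectI BS_BS0) (simp add: loop_chain_diff loop_chain_add loop_chain_frag_of act_e algebra_simps)
  qed
  then show "c \<in> N \<Longrightarrow> loop_chain c \<in> BS0" by blast
qed

lemma loop_chain_eis:
  "x \<in> X \<Longrightarrow> w \<in> words \<Longrightarrow> loop_chain (eis x w) - loop_class x (C w) \<in> BS"
proof (induction w arbitrary: x)
  case Nil
  then show ?case
    using addsub_minus[OF BS loop_class_one[OF Nil(1)]] by (simp add: loop_chain_0 As_one)
next
  case (Cons a w)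
  obtain y b where a: "a = (y, b)" by (cases a)
  then have y: "y \<in> X" "w \<in> words" using Cons.prems by auto
  note x = Cons.prems(1)
  show ?case
  proof (cases b)
    case True
    have "(loop_chain (eis (x \<triangleright> y) w) - loop_class (x \<triangleright> y) (C w)) -
      (loop_class x (e y \<otimes>\<^bsub>As Q\<^esub> C w) - loop_class x (e y) - loop_class (act x (e y)) (C w)) \<in> BS"
      by (intro addsub_diff BS loop_class_mult Cons.IH x y op_closed e_in C_in)
    then show ?thesis using True x y
      by (simp add: a loop_chain_add loop_chain_frag_of C_Cons act_e algebra_simps)
  next
    case False
    \<comment> \<open>An inverse letter is treated by starting one step back: from
      \<open>?x\<close>, the letter y cancels it and leads to the word w.\<close>
    let ?x = "qop_inv Q x y"
    have x': "?x \<in> X" "?x \<triangleright> y = x" using qop_inv x y by auto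
    have C: "e y \<otimes>\<^bsub>As Q\<^esub> C ((y, False) # w) = C w"
      using y by (simp add: C_Cons e_in C_in As.m_assoc[symmetric])
    have "(loop_chain (eis ?x w) - loop_class ?x (C w)) +
      (loop_class ?x (e y \<otimes>\<^bsub>As Q\<^esub> C ((y, False) # w)) - loop_class ?x (e y) - loop_class (act ?x (e y)) (C ((y, False) # w))) \<in> BS"
      by (intro addsub_add BS loop_class_mult Cons.IH x' y e_in C_in) (use y in simp)
    then show ?thesis using False x' y unfolding C
      by (simp add: a loop_chain_diff loop_chain_frag_of act_e algebra_simps)
  qed
qed

lemma loop_class_St:
  assumes "g \<in> St" shows "loop_class x0 g - frag_of [g] \<in> BS"
proof -
  have g: "g \<in> carrier (As Q)" "act x0 g = x0" using assms by (auto simp: St_iff)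
  have p: "path x0 \<in> St" using path[OF x0] by (simp add: St_iff)
  have "(frag_of [path x0 \<otimes>\<^bsub>As Q\<^esub> g \<otimes>\<^bsub>As Q\<^esub> inv\<^bsub>As Q\<^esub> path x0] - frag_of [path x0 \<otimes>\<^bsub>As Q\<^esub> g] - frag_of [inv\<^bsub>As Q\<^esub> path x0])
    + (frag_of [path x0 \<otimes>\<^bsub>As Q\<^esub> g] - frag_of [path x0] - frag_of [g])
    + (frag_of [inv\<^bsub>As Q\<^esub> path x0] + frag_of [path x0]) \<in> BS"
    by (intro addsub_add BS St_mult St_inv assms p subgroup.m_closed[OF subgroup_St] subgroup.m_inv_closed[OF subgroup_St])
  then show ?thesis using g by (simp add: loop_def)
qed

lemma loop_eisermann:
  assumes "c \<in> bar_set 1 GS" shows "loop_chain (eisermann_chain Q x0 c) - c \<in> BS0"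
  using assms
proof (induction c rule: bar_set_induct1)
  case zero
  then show ?case using addsub_zero[OF BS0] by (simp add: eisermann_chain_0 loop_chain_0)
next
  case (one g)
  then have g: "g \<in> St" by simp
  then obtain w where w: "w \<in> words" "g = C w" by (auto simp: St_iff As_carrier)
  have "loop_chain (eisg x0 (C w) - eis x0 w) + (loop_chain (eis x0 w) - loop_class x0 (C w))
     + (loop_class x0 g - frag_of [g]) \<in> BS0"
    by (intro addsub_add BS0 BS_BS0[OF loop_chain_eis] BS_BS0[OF loop_class_St] loop_chain_null eisg_C x0 w g)
  then show ?case by (simp add: eisermann_chain_frag_of loop_chain_diff w(2))
next
  case (diff a b)
  have "(loop_chain (eisermann_chain Q x0 a) - a) - (loop_chain (eisermann_chain Q x0 b) - b) \<in> BS0"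
    by (intro addsub_diff BS0 diff)
  then show ?case by (simp add: eisermann_chain_diff loop_chain_diff algebra_simps)
qed

lemma St_carrier: "St \<subseteq> carrier (As Q)"
  by (auto simp: St_iff)

text \<open>The inverse map recovers c up to a multiple of [e_{x_0}], and the degree shows that this
  multiple is zero.\<close>

lemma eisermann_injective:
  assumes c: "c \<in> bar_set 1 GS" "deg_chain c = 0" and "eisermann_chain Q x0 c \<in> N"
  shows "c \<in> BS"
proof -
  have "loop_chain (eisermann_chain Q x0 c) - (loop_chain (eisermann_chain Q x0 c) - c) \<in> BS0"
    by (intro addsub_diff BS0 loop_chain_null loop_eisermann assms)
  then obtain n where n: "c - frag_cmul n (frag_of [e x0]) \<in> BS" by (auto simp: BS0_def)
  have "deg_chain (c - frag_cmul n (frag_of [e x0])) = 0"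
    by (rule deg_chain_boundary[OF St_carrier n])
  then have "n = 0" using c x0 by (simp add: deg_chain_diff deg_chain_cmul deg_chain_frag_of deg_e)
  then show ?thesis using n by simp
qed

text \<open>The loop of (x, y) contributes the path to x, the pair itself and the reversed path to x
  * y. The path terms depend on the boundary only and disappear on cycles.\<close>

lemma eisermann_loop:
  assumes "Poly_Mapping.keys c \<subseteq> X \<times> X"
  shows "eisermann_chain Q x0 (loop_chain c) - c - frag_extend (\<lambda>x. eisg x0 (path x)) (rack_boundary2 Q c) \<in> N"
  using assms
proof (induction c rule: frag_induction)
  case zero
  then show ?case using addsub_zero[OF N] by (simp add: loop_chain_0 eisermann_chain_0 rack_boundary2_0)
next
  case (one z)
  obtain x y where z: "z = (x, y)" "x \<in> X" "y \<in> X" using one by (cases z) auto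
  let ?y = "x \<triangleright> y"
  have y: "?y \<in> X" "act x (e y) = ?y" using z op_closed act_e by auto
  note p = path[OF z(2)] path[OF y(1)]
  have ap: "act x0 (path x \<otimes>\<^bsub>As Q\<^esub> e y) = ?y" using p z x0 y by (simp add: act_mult e_in)
  have "(eisg x0 (path x \<otimes>\<^bsub>As Q\<^esub> e y \<otimes>\<^bsub>As Q\<^esub> inv\<^bsub>As Q\<^esub> path ?y) - eisg x0 (path x \<otimes>\<^bsub>As Q\<^esub> e y) - eisg (act x0 (path x \<otimes>\<^bsub>As Q\<^esub> e y)) (inv\<^bsub>As Q\<^esub> path ?y))
    + (eisg x0 (path x \<otimes>\<^bsub>As Q\<^esub> e y) - eisg x0 (path x) - eisg (act x0 (path x)) (e y))
    + (eisg (act x0 (path ?y)) (inv\<^bsub>As Q\<^esub> path ?y) + eisg x0 (path ?y))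
    + (eisg x (e y) - frag_of (x, y)) \<in> N"
    by (intro addsub_add N eisg_mult eisg_inv eisg_e x0 p As.m_closed As.inv_closed e_in z)
  then show ?case
    by (simp add: z(1) loop_chain_frag_of eisermann_chain_frag_of loop_def y ap p
        rack_boundary2_frag_of frag_extend_diff algebra_simps)
next
  case (diff a b)
  let ?L = "frag_extend (\<lambda>x. eisg x0 (path x))"
  have "(eisermann_chain Q x0 (loop_chain a) - a - ?L (rack_boundary2 Q a))
    - (eisermann_chain Q x0 (loop_chain b) - b - ?L (rack_boundary2 Q b)) \<in> N"
    by (intro addsub_diff N diff)
  then show ?case
    by (simp add: loop_chain_diff eisermann_chain_diff rack_boundary2_diff frag_extend_diff algebra_simps)
qed

lemma eisermann_surjective:
  assumes "c \<in> rack_cycles2"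
  shows "\<exists>h\<in>bar_set 1 GS. deg_chain h = 0 \<and> eisermann_chain Q x0 h - c \<in> N"
proof -
  define d where "d = deg_chain (loop_chain c)"
  \<comment> \<open>Subtracting d copies of e_{x_0} makes the degree zero and changes the image only
    by d times the degenerate pair (x_0, x_0).\<close>
  define h where "h = loop_chain c - frag_cmul d (frag_of [e x0])"
  have c: "Poly_Mapping.keys c \<subseteq> X \<times> X" "rack_boundary2 Q c = 0"
    using assms by (auto simp: rack_cycles2_def)
  have "h \<in> bar_set 1 GS"
    unfolding h_def by (intro addsub_diff addsub_frag_cmul addsub_bar_set loop_chain_closed c) (simp add: e_x0_St)
  moreover have "deg_chain h = 0"
    using x0 by (simp add: h_def deg_chain_diff deg_chain_cmul deg_chain_frag_of deg_e d_def)
  moreover have "eisermann_chain Q x0 h - c \<in> N"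
  proof -
    have "(eisermann_chain Q x0 (loop_chain c) - c - frag_extend (\<lambda>x. eisg x0 (path x)) (rack_boundary2 Q c))
       - frag_cmul d ((eisg x0 (e x0) - frag_of (x0, x0)) + frag_of (x0, x0)) \<in> N"
      by (intro addsub_diff addsub_add addsub_frag_cmul N eisermann_loop c eisg_e N_diag x0)
    then show ?thesis
      by (simp add: h_def c eisermann_chain_diff eisermann_chain_cmul eisermann_chain_frag_of algebra_simps del: minus_frag_cmul)
  qed
  ultimately show ?thesis by blast
qed

subsection \<open>The abelianization of the associated group\<close>

text \<open>By \<open>e_conj\<close> the path to y conjugates e_{x_0} into e_y, so in a connected
  quandle all generators have the same class in H_1(As Q).\<close>

lemma As_H1_gen:
  assumes "g \<in> carrier (As Q)"
  shows "frag_of [g] - frag_cmul (deg g) (frag_of [e x0]) \<in> bar_boundaries 1 (As Q)"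
proof -
  let ?B = "bar_boundaries 1 (As Q)"
  have B: "addsub ?B" by (rule addsub_bar_boundaries)
  have gen: "frag_of [e y] - frag_of [e x0] \<in> ?B" if y: "y \<in> X" for y
  proof -
    note p = path[OF y]
    have "(frag_of [e x0 \<otimes>\<^bsub>As Q\<^esub> path y] - frag_of [e x0] - frag_of [path y])
      - (frag_of [path y \<otimes>\<^bsub>As Q\<^esub> e y] - frag_of [path y] - frag_of [e y]) \<in> ?B"
      by (intro addsub_diff B As.H1_mult e_in x0 p y)
    then show ?thesis using e_conj[OF p(1) x0] p(2) by (simp add: algebra_simps)
  qed
  show ?thesis
    using assms
  proof (induction g rule: As_induct)
    case one
    then show ?case using As.H1_one by (simp add: deg_one)
  next
    case (gen y g)
    have "(frag_of [e y \<otimes>\<^bsub>As Q\<^esub> g] - frag_of [e y] - frag_of [g]) + (frag_of [e y] - frag_of [e x0])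
       + (frag_of [g] - frag_cmul (deg g) (frag_of [e x0])) \<in> ?B"
      by (intro addsub_add B As.H1_mult gen \<open>\<And>y. y \<in> X \<Longrightarrow> frag_of [e y] - frag_of [e x0] \<in> ?B\<close> e_in)
    then show ?case using gen by (simp add: deg_mult deg_e e_in frag_cmul_distrib algebra_simps del: minus_frag_cmul)
  next
    case (inv y g)
    have "deg (inv\<^bsub>As Q\<^esub> e y) = - 1"
      using deg_mult[of "inv\<^bsub>As Q\<^esub> e y" "e y"] inv(1) by (simp add: e_in deg_one deg_e)
    then have d: "deg (inv\<^bsub>As Q\<^esub> e y \<otimes>\<^bsub>As Q\<^esub> g) = deg g - 1" using inv by (simp add: deg_mult e_in)
    have "(frag_of [inv\<^bsub>As Q\<^esub> e y \<otimes>\<^bsub>As Q\<^esub> g] - frag_of [inv\<^bsub>As Q\<^esub> e y] - frag_of [g]) 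
       + (frag_of [inv\<^bsub>As Q\<^esub> e y] + frag_of [e y]) - (frag_of [e y] - frag_of [e x0])
       + (frag_of [g] - frag_cmul (deg g) (frag_of [e x0])) \<in> ?B"
      by (intro addsub_add addsub_diff B As.H1_mult As.H1_inv inv \<open>\<And>y. y \<in> X \<Longrightarrow> frag_of [e y] - frag_of [e x0] \<in> ?B\<close> e_in As.inv_closed)
    then show ?case by (simp add: d frag_cmul_diff_distrib algebra_simps del: minus_frag_cmul)
  qed
qed

lemma As_H1_chain:
  assumes "c \<in> bar_set 1 (As Q)"
  shows "c - frag_cmul (deg_chain c) (frag_of [e x0]) \<in> bar_boundaries 1 (As Q)"
  using assms
proof (induction c rule: bar_set_induct1)
  case zero
  then show ?case by (simp add: deg_chain_0 addsub_zero addsub_bar_boundaries)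
next
  case (one g)
  then show ?case using As_H1_gen by (simp add: deg_chain_frag_of)
next
  case (diff a b)
  from addsub_diff[OF addsub_bar_boundaries this] show ?case
    by (simp add: deg_chain_diff frag_cmul_diff_distrib algebra_simps del: minus_frag_cmul)
qed

lemma St_bar_set: "c \<in> bar_set 1 GS \<Longrightarrow> c \<in> bar_set 1 (As Q)"
  by (rule bar_set_mono[OF St_carrier])

lemma deg_zero_iff:
  assumes "c \<in> bar_set 1 GS" shows "c \<in> bar_boundaries 1 (As Q) \<longleftrightarrow> deg_chain c = 0"
  using As_H1_chain[OF St_bar_set[OF assms]] deg_chain_boundary[of "carrier (As Q)" c] by auto

end

section \<open>Relative homology in degree two\<close>

text \<open>The first component of the cone boundary gives the equation; the second one vanishes on
  every bar 1-chain of a group.\<close>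

definition cone_cycles2 ::
  "('g, 'm) monoid_scheme \<Rightarrow> 'g set \<Rightarrow> (('g list \<Rightarrow>\<^sub>0 int) \<times> ('g list \<Rightarrow>\<^sub>0 int)) set" where
  "cone_cycles2 G T = {(a, b). a \<in> bar_set 2 G \<and> b \<in> bar_set 1 (G\<lparr>carrier := T\<rparr>) \<and> bar_boundary G a = b}"

lemma cone_chains_Suc:
  "cone_chains (Suc n) G T = addgrp (bar_set (Suc n) G \<times> bar_set n (G\<lparr>carrier := T\<rparr>))"
  by (auto simp: cone_chains_def DirProd_def bar_chains_eq addgrp_def fun_eq_iff zero_prod_def)

lemma cone_boundary_diff: "cone_boundary G (x - y) = cone_boundary G x - cone_boundary G y"
  by (cases x; cases y) (simp add: cone_boundary_def bar_boundary_diff)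

lemma addsub_times: "addsub A \<Longrightarrow> addsub B \<Longrightarrow> addsub (A \<times> B)"
  by (auto simp: addsub_def zero_prod_def)

lemma addsub_cone_boundaries: "addsub (cone_boundaries (Suc n) G T)"
  unfolding cone_boundaries_def cone_chains_Suc addgrp_simps
  by (intro addsub_image addsub_times addsub_bar_set cone_boundary_diff)

lemma addsub_cone_boundaries2: "addsub (cone_boundaries 2 G T)"
  using addsub_cone_boundaries[of 1 G T] by (simp add: numeral_2_eq_2)

lemma addsub_cone_cycles2: "addsub (cone_cycles2 G T)"
  unfolding addsub_def cone_cycles2_def
  by (auto simp: zero_prod_def bar_set_0 bar_boundary_diff intro: addsub_diff[OF addsub_bar_set])

context group
begin

context
  fixes T
  assumes T: "subgroup T G"
begin

abbreviation sub where "sub \<equiv> G\<lparr>carrier := T\<rparr>"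

interpretation T: group sub
  by (rule subgroup_imp_group[OF T])

lemma bar_set_sub: "c \<in> bar_set n sub \<Longrightarrow> c \<in> bar_set n G"
  by (rule bar_set_mono[OF subgroup.subset[OF T]])

lemma sub_boundary: "v \<in> bar_set 2 sub \<Longrightarrow> bar_boundary G v \<in> bar_boundaries 1 sub"
  using bar_boundaries_eq[of 1 sub] by (auto simp: numeral_2_eq_2)

lemma cone_boundaries2_iff:
  "(a, b) \<in> cone_boundaries 2 G T \<longleftrightarrow>
    (\<exists>u v. u \<in> bar_boundaries 2 G \<and> v \<in> bar_set 2 sub \<and> a = u - v \<and> b = - bar_boundary G v)"
proof -
  have "(a, b) \<in> cone_boundaries 2 G T \<longleftrightarrow>
    (\<exists>u v. u \<in> bar_set 3 G \<and> v \<in> bar_set 2 sub \<and> a = bar_boundary G u - v \<and> b = - bar_boundary G v)"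
    using cone_chains_Suc[of 2 G T]
    by (auto simp: cone_boundaries_def cone_boundary_def image_iff numeral_2_eq_2 numeral_3_eq_3)
  then show ?thesis
    by (auto simp: bar_boundaries_eq numeral_2_eq_2 numeral_3_eq_3)
qed

lemma cone_boundaries2_subset: "cone_boundaries 2 G T \<subseteq> cone_cycles2 G T"
proof clarify
  fix a b assume "(a, b) \<in> cone_boundaries 2 G T"
  then obtain u v where u: "u \<in> bar_boundaries 2 G" and v: "v \<in> bar_set 2 sub"
    and ab: "a = u - v" "b = - bar_boundary G v" by (auto simp: cone_boundaries2_iff)
  have "u \<in> bar_set 2 G" "bar_boundary G u = 0"
    using bar_boundaries2_subset u by (auto simp: bar_cycles2_def)
  moreover have "bar_boundary G v \<in> bar_set 1 sub"
    using sub_boundary[OF v] T.bar_boundaries1_subset by blast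
  ultimately show "(a, b) \<in> cone_cycles2 G T"
    using bar_set_sub[OF v] by (simp add: cone_cycles2_def ab bar_boundary_diff
        addsub_diff[OF addsub_bar_set] addsub_minus[OF addsub_bar_set])
qed

lemma addquot_cone: "addquot (cone_cycles2 G T) (cone_boundaries 2 G T)"
  by unfold_locales (rule addsub_cone_cycles2 addsub_cone_boundaries2 cone_boundaries2_subset)+

lemma relative_homology2_eq:
  "relative_homology 2 G T = addgrp (cone_cycles2 G T) Mod cone_boundaries 2 G T"
proof -
  have "{c \<in> carrier (cone_chains 2 G T). cone_boundary G c = (0, 0)} = cone_cycles2 G T"
    using cone_chains_Suc[of 1 G T] T.bar_boundary_bar_set1
    by (auto simp: cone_cycles2_def cone_boundary_def numeral_2_eq_2)
  moreover have "cone_chains 2 G T = addgrp (bar_set 2 G \<times> bar_set 1 sub)"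
    using cone_chains_Suc[of 1 G T] by (simp add: numeral_2_eq_2)
  ultimately show ?thesis
    by (simp add: relative_homology_def addgrp_def)
qed

lemma connecting_map2:
  assumes "(a, b) \<in> cone_cycles2 G T"
  shows "connecting_map 2 G T (acoset (cone_boundaries 2 G T) (a, b)) = acoset (bar_boundaries 1 sub) b"
  unfolding connecting_map_def
proof (subst induced_map_acoset)
  show "monoid.mult (bar_chains (2 - 1) sub) = (+)" by (simp add: bar_chains_eq addgrp_def)
  show "addsub (cone_boundaries 2 G T)" by (rule addsub_cone_boundaries2)
  show "addsub (bar_boundaries (2 - 1) sub)" by (rule addsub_bar_boundaries)
  fix m assume "m \<in> cone_boundaries 2 G T"
  then obtain v where "v \<in> bar_set 2 sub" "snd m = - bar_boundary G v"
    by (cases m) (auto simp: cone_boundaries2_iff)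
  then show "snd (m + (a, b)) - snd (a, b) \<in> bar_boundaries (2 - 1) sub"
    using sub_boundary by (simp add: addsub_minus addsub_bar_boundaries)
qed simp

lemma bar_cycles2_cone: "z \<in> bar_cycles2 G \<Longrightarrow> (z, 0) \<in> cone_cycles2 G T"
  by (simp add: bar_cycles2_def cone_cycles2_def bar_set_0)

lemma homology_to_relative2:
  "homology_to_relative 2 G T (acoset (bar_boundaries 2 G) z) = acoset (cone_boundaries 2 G T) (z, 0)"
  unfolding homology_to_relative_def
proof (rule induced_map_acoset)
  show "monoid.mult (cone_chains 2 G T) = (+)"
    using cone_chains_Suc[of 1 G T] by (simp add: numeral_2_eq_2 addgrp_def)
  show "addsub (cone_boundaries 2 G T)" by (rule addsub_cone_boundaries2)
  show "addsub (bar_boundaries 2 G)" by (rule addsub_bar_boundaries)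
  fix m assume "m \<in> bar_boundaries 2 G"
  then have "(m, 0) \<in> cone_boundaries 2 G T"
    unfolding cone_boundaries2_iff by (intro exI[of _ m] exI[of _ 0]) (simp add: bar_set_0)
  then show "(m + z, 0) - (z, 0) \<in> cone_boundaries 2 G T" by simp
qed

text \<open>Exactness at the relative group. If b bounds a 2-chain v of T, then (a, b) is homologous
  to (a - v, 0), the image of an absolute cycle.\<close>

lemma kernel_connecting_map2:
  "kernel (relative_homology 2 G T) (group_homology 1 sub) (connecting_map 2 G T) =
    (\<lambda>z. acoset (cone_boundaries 2 G T) (z, 0)) ` bar_cycles2 G" (is "?L = ?R")
proof -
  interpret R: addquot "cone_cycles2 G T" "cone_boundaries 2 G T" by (rule addquot_cone)
  have "acoset (cone_boundaries 2 G T) (a, b) \<in> ?R"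
    if ab: "(a, b) \<in> cone_cycles2 G T" and b: "b \<in> bar_boundaries 1 sub" for a b
  proof -
    obtain v where v: "v \<in> bar_set 2 sub" "b = bar_boundary G v"
      using b by (auto simp: bar_boundaries_eq numeral_2_eq_2)
    have "a - v \<in> bar_cycles2 G"
      using ab v bar_set_sub[OF v(1)]
      by (simp add: cone_cycles2_def bar_cycles2_def bar_boundary_diff addsub_diff[OF addsub_bar_set])
    moreover have "(a, b) - (a - v, 0) \<in> cone_boundaries 2 G T"
      unfolding diff_Pair cone_boundaries2_iff
      by (intro exI[of _ 0] exI[of _ "- v"])
         (use v in \<open>simp add: addsub_zero addsub_bar_boundaries addsub_minus addsub_bar_set bar_boundary_minus\<close>)
    then have "acoset (cone_boundaries 2 G T) (a, b) = acoset (cone_boundaries 2 G T) (a - v, 0)"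
      by (simp only: acoset_eq_iff[OF R.B])
    ultimately show ?thesis by (simp only: image_eqI)
  qed
  moreover have "acoset (cone_boundaries 2 G T) (z, 0) \<in> ?L" if "z \<in> bar_cycles2 G" for z
    using bar_cycles2_cone[OF that] R.acoset_closed T.H1.eq_one_iff[of 0]
    by (simp add: kernel_def relative_homology2_eq T.group_homology1_eq connecting_map2
        addsub_zero addsub_bar_boundaries del: One_nat_def one_FactGroup)
  ultimately show ?thesis
    by (auto simp: kernel_def relative_homology2_eq T.group_homology1_eq connecting_map2 R.carrier
        T.H1.eq_one_iff simp del: One_nat_def one_FactGroup)
qed

lemma connecting_map2_hom: "connecting_map 2 G T \<in> hom (relative_homology 2 G T) (group_homology 1 sub)"
proof -
  interpret R: addquot "cone_cycles2 G T" "cone_boundaries 2 G T" by (rule addquot_cone)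
  show ?thesis
    unfolding relative_homology2_eq T.group_homology1_eq
  proof (rule R.homI)
    fix c c' assume c: "c \<in> cone_cycles2 G T" and c': "c' \<in> cone_cycles2 G T"
    obtain a b a' b' where eq: "c = (a, b)" "c' = (a', b')" by (cases c; cases c')
    show "connecting_map 2 G T (acoset (cone_boundaries 2 G T) c) \<in> carrier (addgrp (bar_set 1 sub) Mod bar_boundaries 1 sub)"
      using c unfolding eq by (simp only: connecting_map2, intro T.H1.acoset_closed) (simp add: cone_cycles2_def)
    have "(a + a', b + b') \<in> cone_cycles2 G T" using addsub_add[OF R.Z c c'] by (simp add: eq)
    then show "connecting_map 2 G T (acoset (cone_boundaries 2 G T) (c + c')) =
      connecting_map 2 G T (acoset (cone_boundaries 2 G T) c) \<otimes>\<^bsub>addgrp (bar_set 1 sub) Mod bar_boundaries 1 sub\<^esub>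
      connecting_map 2 G T (acoset (cone_boundaries 2 G T) c')"
      using c c' unfolding eq by (simp only: connecting_map2 add_Pair T.H1.mult)
  qed
qed

end

end

lemma (in addquot) comm_group_sub:
  assumes "subgroup K (addgrp Z Mod B)" shows "comm_group ((addgrp Z Mod B)\<lparr>carrier := K\<rparr>)"
proof -
  interpret comm_group "addgrp Z Mod B" by (rule comm_group)
  show ?thesis
    by (rule group.group_comm_groupI[OF subgroup_imp_group[OF assms]])
       (use subgroup.subset[OF assms] m_comm in \<open>auto simp del: mult_FactGroup\<close>)
qed

section \<open>The map \<open>\<T>\<^sub>*\<close>\<close>

context pointed_quandle
begin

abbreviation BC where "BC \<equiv> cone_boundaries 2 P T"
abbreviation ZC where "ZC \<equiv> cone_cycles2 P T"
abbreviation delta where "delta \<equiv> extension_delta_chain (As Q) P \<psi>"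
abbreviation trans where "trans z \<equiv> eisermann_chain Q x0 (frag_of [delta z])"

sublocale rel: addquot ZC BC
  by (rule Inn.addquot_cone[OF subgroup_T])

sublocale TP: group "P\<lparr>carrier := T\<rparr>"
  by (rule Inn.subgroup_imp_group[OF subgroup_T])

lemmas BC_iff = Inn.cone_boundaries2_iff[OF subgroup_T]

lemma BS_eq: "bar_boundaries 1 ((As Q)\<lparr>carrier := {g \<in> carrier (As Q). \<psi> g \<in> T}\<rparr>) = BS"
  by (simp add: St_eq)

lemma cycle_bar_set: "z \<in> bar_cycles2 P \<Longrightarrow> z \<in> bar_set 2 P"
  by (simp add: bar_cycles2_def)

lemma delta_St: "z \<in> bar_set 2 P \<Longrightarrow> delta z \<in> St"
  using ext.K_subset_T'[OF subgroup_T ext.delta_closed] by (simp add: St_eq)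

text \<open>Taking all of P as the subgroup in \<open>ext.delta_class_cycle\<close>, \<delta> z
  bounds in As Q and so has degree 0. Consequently \<open>proj_P\<close> leaves its class
  unchanged.\<close>

lemma delta_deg: assumes "z \<in> bar_cycles2 P" shows "deg (delta z) = 0"
proof -
  have "P\<lparr>carrier := carrier P\<rparr> = P" by simp
  then have "frag_of [delta z] \<in> bar_boundaries 1 ((As Q)\<lparr>carrier := {g \<in> carrier (As Q). \<psi> g \<in> carrier P}\<rparr>)"
    using assms by (intro ext.delta_class_cycle[OF Inn.subgroup_self]) (simp_all add: bar_cycles2_def)
  then have "deg_chain (frag_of [delta z]) = 0" by (rule deg_chain_boundary[rotated]) auto
  then show ?thesis by (simp add: deg_chain_frag_of)
qed

lemma trans_diff:
  assumes "a \<in> bar_set 2 P" "b \<in> bar_set 2 P"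
  shows "trans (a - b) - (trans a - trans b) \<in> N"
  using eisermann_chain_boundary[OF ext.delta_class_diff[OF subgroup_T assms, unfolded BS_eq]]
  by (simp add: eisermann_chain_diff)

lemma trans_add:
  assumes "a \<in> bar_set 2 P" "b \<in> bar_set 2 P"
  shows "trans (a + b) - (trans a + trans b) \<in> N"
proof -
  have "- (trans (a + b - b) - (trans (a + b) - trans b)) \<in> N"
    by (intro addsub_minus N trans_diff addsub_add addsub_bar_set assms)
  then show ?thesis by (simp add: algebra_simps)
qed

text \<open>The independence of the lift: a relatively null cycle is a boundary u minus a cycle v of
  T, where \<delta> u is trivial and \<delta> v dies in the abelianized stabilizer.\<close>

lemma trans_cone_boundary:
  assumes "(a, 0) \<in> BC" shows "trans a \<in> N"
proof -
  obtain u v where u: "u \<in> Inn.B2" and v: "v \<in> bar_set 2 (P\<lparr>carrier := T\<rparr>)" "bar_boundary P v = 0"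
    and a: "a = u - v"
    using assms by (auto simp: BC_iff)
  have vP: "v \<in> bar_set 2 P" by (rule Inn.bar_set_sub[OF subgroup_T v(1)])
  have "frag_of [delta v] \<in> BS"
    using ext.delta_class_cycle[OF subgroup_T v] by (simp only: BS_eq)
  then have v0: "trans v \<in> N" by (rule eisermann_chain_boundary)
  have u0: "trans u \<in> N"
    using ext.delta_boundary(2)[OF u] eisg_one[OF x0] by (simp add: eisermann_chain_frag_of)
  have "trans a - (trans u - trans v) \<in> N"
    unfolding a by (rule trans_diff[OF ext.delta_boundary(1)[OF u] vP])
  from addsub_add[OF N this addsub_diff[OF N u0 v0]] show ?thesis
    by (simp only: diff_add_cancel)
qed

lemma trans_cycle: assumes "z \<in> bar_cycles2 P" shows "trans z \<in> rack_cycles2"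
  by (rule eisermann_chain_cycle) (use delta_St cycle_bar_set assms in simp)

lemma H1_As_stab_eq: "H1_As_stab Q x0 = addgrp (bar_set 1 GS) Mod BS"
  by (rule GS.group_homology1_eq)

lemma ker_iotaI:
  assumes c: "c \<in> bar_set 1 GS" and "deg_chain c = 0"
  shows "acoset BS c \<in> ker_iota Q x0"
proof -
  have sub: "BS \<subseteq> bar_boundaries 1 (As Q)"
    using bar_set_mono[OF St_carrier] by (auto simp: bar_boundaries_eq)
  have "homology_incl 1 (As Q) (acoset BS c) = acoset (bar_boundaries 1 (As Q)) c"
    unfolding homology_incl_def
    by (rule induced_map_acoset) (use sub in \<open>auto simp: bar_chains_eq addgrp_def addsub_bar_boundaries\<close>)
  also have "\<dots> = \<one>\<^bsub>group_homology 1 (As Q)\<^esub>"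
    unfolding As.group_homology1_eq As.H1.eq_one_iff deg_zero_iff[OF c] by (rule assms)
  finally show ?thesis
    unfolding ker_iota_def kernel_def using GS.H1.acoset_closed[OF c] by (simp only: H1_As_stab_eq mem_Collect_eq)
qed

lemma H1_degree:
  "H1_degree (acoset BS c) = deg_chain c"
  unfolding H1_degree_def deg_chain_def[symmetric]
  by (rule the_elem_acoset[OF BS]) (simp add: deg_chain_add deg_chain_boundary[OF St_carrier] del: One_nat_def)

lemma eisermann_map:
  assumes "acoset BS c \<in> ker_iota Q x0"
  shows "eisermann_map Q x0 (acoset BS c) = acoset N (eisermann_chain Q x0 c)"
  unfolding eisermann_map_def restrict_apply'[OF assms]
  by (rule induced_map_acoset[OF _ BS N])
     (simp_all add: rack_chains2_def free_Abelian_group_def eisermann_chain_add eisermann_chain_boundary del: One_nat_def)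

lemma T_on_lift_eq:
  assumes z: "z \<in> bar_cycles2 P"
  shows "T_on_lift Q x0 (acoset Inn.B2 z) = acoset N (trans z)"
proof -
  interpret H: comm_group "addgrp (bar_set 1 GS) Mod BS" by (rule GS.H1.comm_group)
  have mem: "frag_of [delta z] \<in> bar_set 1 GS" using delta_St[OF cycle_bar_set[OF z]] by simp
  have c: "H1_As_stab_class Q x0 (delta z) = acoset BS (frag_of [delta z])"
    unfolding H1_As_stab_class_def by (rule r_coset_plus) (simp add: bar_chains_eq addgrp_def)
  have d: "deg_chain (frag_of [delta z]) = 0" using delta_deg[OF z] by (simp add: deg_chain_frag_of)
  have "proj_P Q x0 (acoset BS (frag_of [delta z])) = acoset BS (frag_of [delta z])"
    using H.r_one[OF GS.H1.acoset_closed[OF mem]] H.inv_one int_pow_0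
    unfolding proj_P_def H1_As_stab_eq H1_degree d by (simp only: int_pow_0 H.inv_one)
  then show ?thesis
    unfolding T_on_lift_def ext.extension_delta[OF cycle_bar_set[OF z]] c
    by (simp only: eisermann_map[OF ker_iotaI[OF mem d]])
qed

lemma T_lifts_image:
  assumes z: "z \<in> bar_cycles2 P"
  shows "T_on_lift Q x0 ` T_lifts Q x0 (acoset BC (z, 0)) = {acoset N (trans z)}"
proof -
  have lift: "T_on_lift Q x0 (acoset Inn.B2 w) = acoset N (trans z)"
    if w: "w \<in> bar_cycles2 P" and "acoset BC (w, 0) = acoset BC (z, 0)" for w
  proof -
    have "(w - z, 0) \<in> BC" using that(2) by (simp add: acoset_eq_iff[OF rel.B])
    then have "trans (w - z) \<in> N" by (rule trans_cone_boundary)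
    moreover have "trans (w - z) - (trans w - trans z) \<in> N"
      by (rule trans_diff[OF cycle_bar_set[OF w] cycle_bar_set[OF z]])
    ultimately have "trans (w - z) - (trans (w - z) - (trans w - trans z)) \<in> N"
      by (rule addsub_diff[OF N])
    then show ?thesis by (simp add: T_on_lift_eq[OF w] acoset_eq_iff[OF N])
  qed
  have "acoset Inn.B2 z \<in> T_lifts Q x0 (acoset BC (z, 0))"
    unfolding T_lifts_def mem_Collect_eq Inn.group_homology2_eq
    by (intro conjI Inn.H2.acoset_closed z Inn.homology_to_relative2[OF subgroup_T])
  moreover have "T_on_lift Q x0 c = acoset N (trans z)" if "c \<in> T_lifts Q x0 (acoset BC (z, 0))" for c
  proof -
    from that have "c \<in> acoset Inn.B2 ` bar_cycles2 P" "homology_to_relative 2 P T c = acoset BC (z, 0)"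
      unfolding T_lifts_def mem_Collect_eq Inn.group_homology2_eq Inn.H2.carrier by blast+
    then obtain w where w: "w \<in> bar_cycles2 P" "c = acoset Inn.B2 w" by blast
    have "acoset BC (w, 0) = acoset BC (z, 0)"
      using that(1) Inn.homology_to_relative2[OF subgroup_T, of w]
      by (simp only: T_lifts_def mem_Collect_eq w(2))
    then show ?thesis unfolding w(2) by (rule lift[OF w(1)])
  qed
  ultimately show ?thesis by blast
qed

lemma T_star_eq: "z \<in> bar_cycles2 P \<Longrightarrow> T_star Q x0 (acoset BC (z, 0)) = acoset N (trans z)"
  by (simp add: T_star_def T_lifts_image)

lemma H2_Inn_rel_eq: "H2_Inn_rel Q x0 = addgrp ZC Mod BC"
  by (rule Inn.relative_homology2_eq[OF subgroup_T])

lemma T_domain_eq: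
  "T_domain Q x0 = (addgrp ZC Mod BC)\<lparr>carrier := (\<lambda>z. acoset BC (z, 0)) ` bar_cycles2 P\<rparr>"
  unfolding T_domain_def Inn.kernel_connecting_map2[OF subgroup_T] unfolding H2_Inn_rel_eq ..

lemma T_domain_carrier: "carrier (T_domain Q x0) = (\<lambda>z. acoset BC (z, 0)) ` bar_cycles2 P"
  by (simp add: T_domain_eq)

lemma comm_group_rel: "comm_group (H2_Inn_rel Q x0)"
  unfolding H2_Inn_rel_eq by (rule rel.comm_group)

lemma comm_group_HQ: "comm_group (quandle_homology2 Q)"
  unfolding quandle_homology2_eq by (rule HQ.comm_group)

lemma comm_group_stab: "comm_group (H1_Inn_stab Q x0)"
  unfolding TP.group_homology1_eq by (rule TP.H1.comm_group)

lemma connecting_group_hom: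
  "group_hom (H2_Inn_rel Q x0) (H1_Inn_stab Q x0) (connecting_map 2 P T)"
  by (intro group_hom.intro group_hom_axioms.intro comm_group.axioms(2) comm_group_rel comm_group_stab
      Inn.connecting_map2_hom[OF subgroup_T])

lemma comm_group_T_domain: "comm_group (T_domain Q x0)"
proof -
  have "subgroup (kernel (H2_Inn_rel Q x0) (H1_Inn_stab Q x0) (connecting_map 2 P T)) (H2_Inn_rel Q x0)"
    by (rule group_hom.subgroup_kernel[OF connecting_group_hom])
  then show ?thesis
    unfolding T_domain_def H2_Inn_rel_eq by (rule rel.comm_group_sub)
qed

lemma T_domain_mult: "monoid.mult (T_domain Q x0) = monoid.mult (addgrp ZC Mod BC)"
  by (simp add: T_domain_eq)

lemma T_star_hom: "T_star Q x0 \<in> hom (T_domain Q x0) (quandle_homology2 Q)"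
proof (rule homI)
  fix c assume "c \<in> carrier (T_domain Q x0)"
  then obtain z where z: "z \<in> bar_cycles2 P" "c = acoset BC (z, 0)" by (auto simp: T_domain_carrier)
  then show "T_star Q x0 c \<in> carrier (quandle_homology2 Q)"
    unfolding z(2) T_star_eq[OF z(1)] quandle_homology2_eq by (intro HQ.acoset_closed trans_cycle)
  fix c' assume "c' \<in> carrier (T_domain Q x0)"
  then obtain z' where z': "z' \<in> bar_cycles2 P" "c' = acoset BC (z', 0)" by (auto simp: T_domain_carrier)
  have zz: "z + z' \<in> bar_cycles2 P" by (rule addsub_add[OF Inn.addsub_bar_cycles2 z(1) z'(1)])
  have "c \<otimes>\<^bsub>T_domain Q x0\<^esub> c' = acoset BC (z + z', 0)"
    unfolding z(2) z'(2) T_domain_mult rel.mult by simp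
  then show "T_star Q x0 (c \<otimes>\<^bsub>T_domain Q x0\<^esub> c') = T_star Q x0 c \<otimes>\<^bsub>quandle_homology2 Q\<^esub> T_star Q x0 c'"
    unfolding z(2) z'(2)
    using trans_add[OF cycle_bar_set[OF z(1)] cycle_bar_set[OF z'(1)]]
    by (simp only: T_star_eq[OF zz] T_star_eq[OF z(1)] T_star_eq[OF z'(1)] quandle_homology2_eq HQ.mult
        acoset_eq_iff[OF N])
qed

lemma T_domain_pow:
  "acoset BC (z, 0) [^]\<^bsub>T_domain Q x0\<^esub> (n::nat) = acoset BC (frag_cmul (int n) z, 0)"
proof (induction n)
  case 0
  have "\<one>\<^bsub>T_domain Q x0\<^esub> = acoset BC (0, 0)" using rel.one by (simp add: T_domain_eq zero_prod_def)
  then show ?case by (simp add: nat_pow_def)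
next
  case (Suc n)
  have "acoset BC (z, 0) [^]\<^bsub>T_domain Q x0\<^esub> Suc n =
      acoset BC (z, 0) [^]\<^bsub>T_domain Q x0\<^esub> n \<otimes>\<^bsub>T_domain Q x0\<^esub> acoset BC (z, 0)"
    by (simp add: nat_pow_def)
  also have "\<dots> = acoset BC ((frag_cmul (int n) z, 0) + (z, 0))"
    unfolding Suc T_domain_mult rel.mult ..
  finally show ?case by (simp add: frag_cmul_distrib add.commute)
qed

subsection \<open>Localization\<close>

context
  fixes l :: nat
  assumes l: "prime l" and trivial: "trivial_group (localization l (H1_Inn_stab Q x0))"
begin

lemma stab_torsion:
  assumes "h \<in> carrier (H1_Inn_stab Q x0)"
  shows "\<exists>n::nat. \<not> l dvd n \<and> h [^]\<^bsub>H1_Inn_stab Q x0\<^esub> n = \<one>\<^bsub>H1_Inn_stab Q x0\<^esub>"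
  by (rule localized.trivial_imp_torsion[OF _ trivial assms])
     (intro localized.intro localized_axioms.intro comm_group_stab l)

text \<open>Under the inclusion only the neutral element goes to the neutral element. Conversely, a
  multiple prime to l of any relative class is killed by the connecting map, since every element of
  H_1(Stab) has order prime to l.\<close>

lemma T_domain_incl_loc_iso:
  "T_domain_incl_loc l Q x0 \<in> iso (localization l (T_domain Q x0)) (localization l (H2_Inn_rel Q x0))"
  unfolding T_domain_incl_loc_def
proof (rule localization_map_iso[OF l comm_group_T_domain comm_group_rel])
  interpret conn: group_hom "H2_Inn_rel Q x0" "H1_Inn_stab Q x0" "connecting_map 2 P T"
    by (rule connecting_group_hom)
  show "(\<lambda>c. c) \<in> hom (T_domain Q x0) (H2_Inn_rel Q x0)"
    by (rule homI) (auto simp: T_domain_def kernel_def)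
  show "\<exists>n::nat. \<not> l dvd n \<and> m [^]\<^bsub>T_domain Q x0\<^esub> n = \<one>\<^bsub>T_domain Q x0\<^esub>"
    if "m \<in> carrier (T_domain Q x0)" "m = \<one>\<^bsub>H2_Inn_rel Q x0\<^esub>" for m
    by (rule exI[of _ 1])
       (use that l group.is_monoid[OF comm_group.axioms(2)[OF comm_group_T_domain]] in
         \<open>auto simp: T_domain_def prime_nat_iff monoid.nat_pow_one nat_pow_def\<close>)
  fix y assume y: "y \<in> carrier (H2_Inn_rel Q x0)"
  obtain n :: nat where n: "\<not> l dvd n"
    "connecting_map 2 P T y [^]\<^bsub>H1_Inn_stab Q x0\<^esub> n = \<one>\<^bsub>H1_Inn_stab Q x0\<^esub>"
    using stab_torsion[OF conn.hom_closed[OF y]] by blast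
  have "y [^]\<^bsub>H2_Inn_rel Q x0\<^esub> n \<in> carrier (T_domain Q x0)"
    using n y conn.hom_nat_pow[OF y, of n] conn.G.nat_pow_closed[OF y, of n] by (simp add: T_domain_def kernel_def)
  then show "\<exists>n::nat. \<not> l dvd n \<and> (\<exists>m\<in>carrier (T_domain Q x0). m = y [^]\<^bsub>H2_Inn_rel Q x0\<^esub> n)"
    using n by blast
qed

lemma T_star_coker:
  assumes "y \<in> carrier (quandle_homology2 Q)"
  shows "\<exists>n::nat. \<not> l dvd n \<and> (\<exists>c\<in>carrier (T_domain Q x0). T_star Q x0 c = y [^]\<^bsub>quandle_homology2 Q\<^esub> n)"
proof -
  obtain c where c: "c \<in> rack_cycles2" "y = acoset N c"
    using assms by (auto simp: quandle_homology2_eq HQ.carrier)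
  obtain h where h: "h \<in> bar_set 1 GS" "deg_chain h = 0" "eisermann_chain Q x0 h - c \<in> N"
    using eisermann_surjective[OF c(1)] by blast
  let ?q = "frag_extend (\<lambda>gs. frag_of (map \<psi> gs))"
  \<comment> \<open>What prevents h from coming from the kernel of \<psi> is its image in H_1(Stab),
    and this is killed by some n prime to l.\<close>
  have "?q h \<in> bar_set 1 (P\<lparr>carrier := T\<rparr>)"
    by (rule frag_extend_map_bar_set[OF h(1)]) (simp add: St_eq image_subset_iff)
  then have "acoset (bar_boundaries 1 (P\<lparr>carrier := T\<rparr>)) (?q h) \<in> carrier (H1_Inn_stab Q x0)"
    unfolding TP.group_homology1_eq by (rule TP.H1.acoset_closed)
  then obtain n where n: "\<not> l dvd n"
    "acoset (bar_boundaries 1 (P\<lparr>carrier := T\<rparr>)) (?q h) [^]\<^bsub>H1_Inn_stab Q x0\<^esub> n = \<one>\<^bsub>H1_Inn_stab Q x0\<^esub>"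
    using stab_torsion by blast
  then have "frag_cmul (int n) (?q h) \<in> bar_boundaries 1 (P\<lparr>carrier := T\<rparr>)"
    unfolding TP.group_homology1_eq TP.H1.nat_pow TP.H1.eq_one_iff by blast
  then have "?q (frag_cmul (int n) h) \<in> bar_boundaries 1 (P\<lparr>carrier := T\<rparr>)"
    by (simp add: frag_extend_cmul)
  moreover have "frag_cmul (int n) h \<in> bar_set 1 ((As Q)\<lparr>carrier := {g \<in> carrier (As Q). \<psi> g \<in> T}\<rparr>)"
    using addsub_frag_cmul[OF addsub_bar_set h(1)] by (simp only: St_eq)
  ultimately obtain k where k: "k \<in> ext.K" "frag_cmul (int n) h - frag_of [k] \<in> BS"
    using ext.chain_in_K[OF subgroup_T, of "frag_cmul (int n) h"] unfolding BS_eq by blast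
  have kG: "k \<in> carrier (As Q)" using k(1) by (simp add: ext.K_iff)
  have "deg_chain (frag_cmul (int n) h - frag_of [k]) = 0"
    by (rule deg_chain_boundary[OF St_carrier k(2)])
  \<comment> \<open>Degree 0 is what places k among the boundaries of As Q and hence in the image of
    \<delta>.\<close>
  then have "deg k = 0" using h by (simp add: deg_chain_diff deg_chain_cmul deg_chain_frag_of)
  then have "frag_of [k] \<in> bar_boundaries 1 (As Q)" using As_H1_gen[OF kG] by simp
  then obtain z where z: "z \<in> bar_cycles2 P" "delta z = k"
    using ext.delta_surj_on_boundaries[OF k(1)] by blast
  have "frag_cmul (int n) (eisermann_chain Q x0 h - c) - eisermann_chain Q x0 (frag_cmul (int n) h - frag_of [k]) \<in> N"
    by (intro addsub_diff addsub_frag_cmul N h eisermann_chain_boundary k)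
  then have "trans z - frag_cmul (int n) c \<in> N"
    by (simp add: z eisermann_chain_diff eisermann_chain_cmul frag_cmul_diff2 algebra_simps del: minus_frag_cmul)
  then have "T_star Q x0 (acoset BC (z, 0)) = y [^]\<^bsub>quandle_homology2 Q\<^esub> n"
    unfolding T_star_eq[OF z(1)] c(2) quandle_homology2_eq HQ.nat_pow acoset_eq_iff[OF N] .
  then show ?thesis using n z by (auto simp: T_domain_carrier)
qed

end

end

section \<open>The kernel of \<open>T_star\<close> and the isomorphism at l\<close>

context typed_quandle
begin

lemma T_star_kernel:
  assumes "c \<in> carrier (T_domain Q x0)" "T_star Q x0 c = \<one>\<^bsub>quandle_homology2 Q\<^esub>"
  shows "c [^]\<^bsub>T_domain Q x0\<^esub> t = \<one>\<^bsub>T_domain Q x0\<^esub>"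
proof -
  obtain z where z: "z \<in> bar_cycles2 P" "c = acoset BC (z, 0)" using assms by (auto simp: T_domain_carrier)
  have "trans z \<in> N"
    using assms(2) unfolding z(2) T_star_eq[OF z(1)] quandle_homology2_eq HQ.eq_one_iff .
  then have "frag_of [delta z] \<in> BS"
    by (rule eisermann_injective[rotated 2])
       (use delta_St[OF cycle_bar_set[OF z(1)]] delta_deg[OF z(1)] in \<open>simp_all add: deg_chain_frag_of\<close>)
  then obtain b where b: "b \<in> Inn.B2" "tm z - b \<in> bar_set 2 (P\<lparr>carrier := T\<rparr>)"
    using ext.t_times_cycle[OF lift_chain_mult subgroup_T z(1)] unfolding BS_eq by blast
  have "bar_boundary P b = 0" "bar_boundary P z = 0"
    using b(1) Inn.bar_boundaries2_subset z(1) by (auto simp: bar_cycles2_def)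
  \<comment> \<open>Up to sign, the chain of the stabilizer used in the cone is t z - b; it has no
    boundary because z and b are both cycles.\<close>
  then have "(tm z, 0) \<in> BC"
    unfolding BC_iff using b
    by (intro exI[of _ b] exI[of _ "- (tm z - b)"])
       (simp add: addsub_minus[OF addsub_bar_set, of "tm z - b", simplified] bar_boundary_diff bar_boundary_cmul
         del: minus_frag_cmul)
  then have "acoset BC (tm z, 0) = acoset BC 0" by (simp add: acoset_eq_iff[OF rel.B])
  then show ?thesis using rel.one by (simp add: z(2) T_domain_pow) (simp add: T_domain_eq)
qed

lemma T_star_loc_iso:
  assumes l: "prime l" "coprime l t" and trivial: "trivial_group (localization l (H1_Inn_stab Q x0))"
  shows "T_star_loc l Q x0 \<in> iso (localization l (H2_Inn_rel Q x0)) (localization l (quandle_homology2 Q))"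
proof -
  have lt: "\<not> l dvd t"
    using l by (metis coprime_absorb_left not_prime_unit)
  have f: "localization_map l (quandle_homology2 Q) (T_star Q x0)
      \<in> iso (localization l (T_domain Q x0)) (localization l (quandle_homology2 Q))"
    by (rule localization_map_iso[OF l(1) comm_group_T_domain comm_group_HQ T_star_hom])
       (use T_star_kernel lt T_star_coker[OF l(1) trivial] in blast)+
  interpret D: localized "T_domain Q x0" l
    by (intro localized.intro localized_axioms.intro comm_group_T_domain l)
  have "group (localization l (T_domain Q x0))"
    unfolding D.localization_eq by (rule comm_group.axioms(2)[OF D.comm_group])
  then have "inv_into (carrier (localization l (T_domain Q x0))) (T_domain_incl_loc l Q x0)
      \<in> iso (localization l (H2_Inn_rel Q x0)) (localization l (T_domain Q x0))"
    by (rule group.iso_set_sym[OF _ T_domain_incl_loc_iso[OF l(1) trivial]])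
  from iso_set_trans[OF this f] show ?thesis
    by (simp add: T_star_loc_def[abs_def] comp_def)
qed

end

text \<open>A finite infimum in \<open>enat\<close> comes from a nonempty set and is attained, so
  the type itself is one of the admissible exponents; the empty set would give \<infinity>.\<close>

lemma quandle_typeD:
  assumes "quandle_type Q = enat t" "x \<in> carrier Q" "y \<in> carrier Q"
  shows "((\<lambda>z. z \<triangleright>\<^bsub>Q\<^esub> y) ^^ t) x = x"
proof -
  let ?A = "{enat n | n. 0 < n \<and> (\<forall>x\<in>carrier Q. \<forall>y\<in>carrier Q. ((\<lambda>z. z \<triangleright>\<^bsub>Q\<^esub> y) ^^ n) x = x)}"
  have eq: "Inf ?A = enat t" using assms(1) by (simp add: quandle_type_def)
  have ne: "?A \<noteq> {}"
  proof
    assume "?A = {}"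
    then have "Inf ?A = \<infinity>" unfolding Inf_enat_def by (rule if_P)
    then show False using eq by simp
  qed
  then obtain a where "a \<in> ?A" by blast
  then have "(LEAST a. a \<in> ?A) \<in> ?A" by (rule LeastI)
  moreover have "Inf ?A = (LEAST a. a \<in> ?A)" unfolding Inf_enat_def using ne by (rule if_not_P)
  ultimately have "Inf ?A \<in> ?A" by (simp only:)
  then have "enat t \<in> ?A" unfolding eq .
  then show ?thesis using assms(2,3) by auto
qed

theorem theorem3p4:
  fixes Q :: "('a, 'm) quandle_scheme" and x0 :: 'a
  assumes "quandle Q" and "connected_quandle Q" and "x0 \<in> carrier Q"
  shows "(\<forall>c\<in>carrier (T_domain Q x0). T_on_lift Q x0 ` T_lifts Q x0 c = {T_star Q x0 c}) \<and>
    T_star Q x0 \<in> hom (T_domain Q x0) (quandle_homology2 Q) \<and>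
    (\<forall>(l::nat) (t::nat).
       prime l \<and> quandle_type Q = enat t \<and> coprime l t \<and>
       trivial_group (localization l (H1_Inn_stab Q x0)) \<longrightarrow>
         T_domain_incl_loc l Q x0
           \<in> iso (localization l (T_domain Q x0)) (localization l (H2_Inn_rel Q x0)) \<and>
         T_star_loc l Q x0
           \<in> iso (localization l (H2_Inn_rel Q x0)) (localization l (quandle_homology2 Q)))"
proof (intro conjI ballI allI impI)
  interpret pointed_quandle Q x0
    using assms by (intro pointed_quandle.intro pointed_quandle_axioms.intro)
  show "T_on_lift Q x0 ` T_lifts Q x0 c = {T_star Q x0 c}" if c: "c \<in> carrier (T_domain Q x0)" for c
  proof -
    obtain z where "z \<in> bar_cycles2 P" "c = acoset BC (z, 0)"
      using c unfolding T_domain_carrier by blast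
    then show ?thesis by (simp only: T_lifts_image T_star_eq)
  qed
  show "T_star Q x0 \<in> hom (T_domain Q x0) (quandle_homology2 Q)" by (rule T_star_hom)
  fix l t :: nat
  assume "prime l \<and> quandle_type Q = enat t \<and> coprime l t \<and>
    trivial_group (localization l (H1_Inn_stab Q x0))"
  then have l: "prime l" "coprime l t" and t: "quandle_type Q = enat t"
    and trivial: "trivial_group (localization l (H1_Inn_stab Q x0))"
    by blast+
  show "T_domain_incl_loc l Q x0
      \<in> iso (localization l (T_domain Q x0)) (localization l (H2_Inn_rel Q x0))"
    by (rule T_domain_incl_loc_iso[OF l(1) trivial])
  interpret typed_quandle Q x0 t
    by unfold_locales (rule quandle_typeD[OF t])
  show "T_star_loc l Q x0
      \<in> iso (localization l (H2_Inn_rel Q x0)) (localization l (quandle_homology2 Q))"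
    by (rule T_star_loc_iso[OF l trivial])
qed

end
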